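(* Assume $A$ is associative. Let $\Omega$ be a domain in $V$ and let $f:\Omega\to A$ be $T$-regular. Suppose that $\Omega$ contains an open ball $B=B(p,R)=\{x\in V:\|x-p\|<R\}$ of radius $R>0$ centered at a point $p$ of the mirror $\mathbb{R}_{0,t_0}$. Then for all $x\in B$ \[f(x)=\sum_{k\in\mathbb{N}}\ \sum_{|\mathbf{k}|=k}\mathcal{T}_{\mathbf{k}}(x-p)\,\frac{1}{\mathbf{k}!}\,\delta^{(0,\mathbf{k})}f(p),\] where $\mathbf{k}$ ranges over $\mathbb{N}^{t_0+\tau}$. The series of functions indexed by $k$ converges normally in $B$; indeed, setting $m:=t_0+\tau$, \[\max_{x\in\overline{B}(p,r_1)}\Big\|\sum_{|\mathbf{k}|=k}\mathcal{T}_{\mathbf{k}}(x-p)\frac{1}{\mathbf{k}!}\delta^{(0,\mathbf{k})}f(p)\Big\|\le(1+\omega^2)^\tau\,\omega^2\,\sqrt{2}\,\binom{k+m}{m}\left(\frac{r_1}{r_2}\right)^k\max_{\partial B_I(p,r_2)}\|f_I\|\] for all $k\in\mathbb{N}$ whenever $0<r_1<r_2<R$ and $I\in\mathbb{T}$, where $\overline{B}(p,r_1)=\{x\in V:\|x-p\|\le r_1\}$ and $\partial B_I(p,r_2)=\{x\in\mathbb{R}_I^{t_0+\tau+1}:\|x-p\|=r_2\}$.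
   Context: $\mathbb{N}$ includes $0$. $A$ is a finite-dimensional alternative (unital) real $*$-algebra: a finite-dimensional real vector space with an $\mathbb{R}$-bilinear multiplication such that $x(xy)=x^2y$, $(xy)y=xy^2$ (automatic if $A$ is associative), and with an involutive real-linear antiautomorphism $x\mapsto x^c$; $\mathbb{R}$ is identified with $\mathbb{R}1$. Set $t(x)=x+x^c$, $n(x)=xx^c$, $\mathbb{S}_A=\{x\in A:t(x)=0,\ n(x)=1\}$, assumed nonempty. Let $Q_A=\bigcup_{J\in\mathbb{S}_A}(\mathbb{R}+J\mathbb{R})$. A hypercomplex subspace of $A$ is a real vector subspace $V$ with $\mathbb{R}\subsetneq V\subseteq Q_A$; a hypercomplex basis of $V$ is an ordered real basis $(v_0,\ldots,v_n)$ with $n\ge1$, $v_0=1$, $v_s\in\mathbb{S}_A$ and $v_sv_u=-v_uv_s$ for distinct $s,u\in\{1,\ldots,n\}$. Setting. $V$ is a hypercomplex subspace of $A$ with hypercomplex basis $\mathcal{B}=(v_0,\ldots,v_n)$, completed to a real basis $\mathcal{B}'=(v_0,\ldots,v_d)$ of $A$; $\langle\cdot,\cdot\rangle$ and $\|\cdot\|$ are the Euclidean scalar product and norm on $A$ making $\mathcal{B}'$ orthonormal. $\omega:=\max\{\|uv\|:u\in V,\ v\in A,\ \|u\|=1=\|v\|\}$. A domain is a nonempty connected open subset. Fix $\tau\in\{0,\ldots,n\}$ and a list of steps $T=(t_0,\ldots,t_\tau)\in\mathbb{N}^{\tau+1}$ with $0\le t_0<t_1<\cdots<t_\tau=n$.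 For $0\le\ell\le m\le n$, $\mathbb{R}_{\ell,m}=\mathrm{Span}(v_\ell,\ldots,v_m)$ and $\mathbb{S}_{\ell,m}$ is its unit sphere. The mirror is $\mathbb{R}_{0,t_0}$; the $T$-torus is $\mathbb{T}=\mathbb{S}_{t_0+1,t_1}\times\cdots\times\mathbb{S}_{t_{\tau-1}+1,t_\tau}$ if $\tau\ge1$. For $J=(J_1,\ldots,J_\tau)\in\mathbb{T}$, $\mathcal{B}_J=(v_0,v_1,\ldots,v_{t_0},J_1,\ldots,J_\tau)$ and $\mathbb{R}_J^{t_0+\tau+1}=\mathrm{Span}(\mathcal{B}_J)$, with elements written $x_0+v_1x_1+\cdots+v_{t_0}x_{t_0}+\beta_1J_1+\cdots+\beta_\tau J_\tau$. If $\tau=0$, "$J\in\mathbb{T}$" is read as $J=\emptyset$, with $\mathcal{B}_\emptyset=\mathcal{B}$ and $\mathbb{R}_\emptyset^{t_0+1}=V$. For $Y\subseteq V$ and $f:Y\to A$: $Y_J=Y\cap\mathbb{R}_J^{t_0+\tau+1}$ and $f_J=f|_{Y_J}$. A function $f:\Omega\to A$ on a domain $\Omega\subseteq V$ is $T$-regular if for every $J\in\mathbb{T}$ the restriction $f_J$ is $J$-monogenic, i.e. of class $\mathscr{C}^1$ on the open subset $\Omega_J$ of $\mathbb{R}_J^{t_0+\tau+1}$ with $(\partial_{x_0}+v_1\partial_{x_1}+\cdots+v_{t_0}\partial_{x_{t_0}}+J_1\partial_{\beta_1}+\cdots+J_\tau\partial_{\beta_\tau})f_J\equiv0$ (vacuous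 if $\Omega_J=\emptyset$). Each such $f_J$ is real analytic. Multi-indices: for $\mathbf{k}=(k_1,\ldots,k_{t_0+\tau})$, $|\mathbf{k}|=\sum_sk_s$, $\mathbf{k}!=\prod_sk_s!$; $\epsilon_s$ is the $s$-th standard unit vector of $\mathbb{N}^{t_0+\tau}$. Adapted derivatives ($A$ associative). For $\mathbf{h}=(h_0,\ldots,h_{t_0+\tau})\in\mathbb{N}^{t_0+\tau+1}$ and $f$ $T$-regular on $\Omega$, $\delta^{\mathbf{h}}f:\Omega\to A$ is the function with \[(\delta^{\mathbf{h}}f)_J=(J_\tau^{h_{t_0+\tau}}\cdots J_1^{h_{t_0+1}})^{-1}\,\partial_{x_0}^{h_0}\cdots\partial_{x_{t_0}}^{h_{t_0}}\partial_{\beta_1}^{h_{t_0+1}}\cdots\partial_{\beta_\tau}^{h_{t_0+\tau}}f_J\] in $\Omega_J$ for all $J\in\mathbb{T}$ (this is well defined); for $\tau=0$, $\delta^{\mathbf{h}}=\partial_{x_0}^{h_0}\cdots\partial_{x_n}^{h_n}$. Polynomials $\mathcal{T}_{\mathbf{k}}$ ($A$ associative). For $x=\sum_{\ell=0}^nx_\ell v_\ell\in V$ and $1\le h\le\tau$, put $x^h=\sum_{\ell=t_{h-1}+1}^{t_h}x_\ell v_\ell$. Define $\mathcal{T}_{\mathbf{k}}:V\to A$ by $\mathcal{T}_{\mathbf{k}}\equiv0$ if $\mathbf{k}\in\mathbb{Z}^{t_0+\tau}\setminus\mathbb{N}^{t_0+\tau}$, $\mathcal{T}_{(0,\ldots,0)}\equiv1$,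 and recursively for other $\mathbf{k}\in\mathbb{N}^{t_0+\tau}$ \[|\mathbf{k}|\,\mathcal{T}_{\mathbf{k}}(x)=\sum_{s=1}^{t_0}k_s\,\mathcal{T}_{\mathbf{k}-\epsilon_s}(x)\,(x_s-(-1)^ax_0v_s)+\sum_{s=t_0+1}^{t_0+\tau}(-1)^{b_s}k_s\,\mathcal{T}_{\mathbf{k}-\epsilon_s}(x)\,(x_0+(-1)^{a_s}x^{s-t_0}),\] with $a=\sum_{u=t_0+1}^{t_0+\tau}k_u$, $a_s=a-k_s$, $b_s=\sum_{u=s+1}^{t_0+\tau}k_u$. A series $\sum_kf_k$ of continuous functions converges normally in an open set if $\sum_k\max_C\|f_k\|$ converges for every compact subset $C$ of it. *)

theory Defs
  imports "HOL-Analysis.Analysis"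
begin

text \<open>
  The ambient algebra is a type of sort \<open>{real_algebra_1, euclidean_space}\<close>: an associative unital
  real algebra of finite dimension together with a Euclidean scalar product on the same real vector
  space.  No compatibility between norm and product is imposed; the scalar product is tied to the
  algebra only through \<open>completed_orthonormal\<close> below.
\<close>

definition star_involution :: "('a::real_algebra_1 \<Rightarrow> 'a) \<Rightarrow> bool" where
  "star_involution star \<longleftrightarrow>
     linear star \<and> (\<forall>x y. star (x * y) = star y * star x) \<and> (\<forall>x. star (star x) = x)"

definition imag_units :: "('a::real_algebra_1 \<Rightarrow> 'a) \<Rightarrow> 'a set" where
  "imag_units star = {x. x + star x = 0 \<and> x * star x = 1}"

definition quadratic_cone :: "('a::real_algebra_1 \<Rightarrow> 'a) \<Rightarrow> 'a set" where
  "quadratic_cone star = (\<Union>J\<in>imag_units star. {of_real a + J * of_real b |a b. True})"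

definition hypercomplex_subspace :: "('a::real_algebra_1 \<Rightarrow> 'a) \<Rightarrow> 'a set \<Rightarrow> bool" where
  "hypercomplex_subspace star V \<longleftrightarrow> subspace V \<and> \<real> \<subset> V \<and> V \<subseteq> quadratic_cone star"

definition hypercomplex_basis ::
  "('a::real_algebra_1 \<Rightarrow> 'a) \<Rightarrow> 'a set \<Rightarrow> nat \<Rightarrow> (nat \<Rightarrow> 'a) \<Rightarrow> bool" where
  "hypercomplex_basis star V n v \<longleftrightarrow>
     n \<ge> 1 \<and> inj_on v {0..n} \<and> independent (v ` {0..n}) \<and> span (v ` {0..n}) = V \<and>
     v 0 = 1 \<and> (\<forall>s\<in>{1..n}. v s \<in> imag_units star) \<and>
     (\<forall>s\<in>{1..n}. \<forall>u\<in>{1..n}. s \<noteq> u \<longrightarrow> v s * v u = - (v u * v s))"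

text \<open>\<open>(v 0, \<dots>, v d)\<close> is a basis of the whole algebra extending \<open>(v 0, \<dots>, v n)\<close>, and the scalar
  product of the type is the one for which it is orthonormal.\<close>

definition completed_orthonormal :: "nat \<Rightarrow> nat \<Rightarrow> (nat \<Rightarrow> 'a::euclidean_space) \<Rightarrow> bool" where
  "completed_orthonormal n d v \<longleftrightarrow>
     n \<le> d \<and> inj_on v {0..d} \<and> independent (v ` {0..d}) \<and> span (v ` {0..d}) = UNIV \<and>
     (\<forall>i\<in>{0..d}. \<forall>j\<in>{0..d}. v i \<bullet> v j = (if i = j then 1 else 0))"

text \<open>Here and below, a maximum of a continuous function over a nonempty compact set is written as a
  supremum.\<close>

definition omega :: "'a::{real_algebra_1, euclidean_space} set \<Rightarrow> real" where
  "omega V = Sup {norm (u * w) |u w. u \<in> V \<and> norm u = 1 \<and> norm w = 1}"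

definition domain_in :: "'a::euclidean_space set \<Rightarrow> 'a set \<Rightarrow> bool" where
  "domain_in V \<Omega> \<longleftrightarrow> \<Omega> \<noteq> {} \<and> connected \<Omega> \<and> openin (top_of_set V) \<Omega>"

definition step_list :: "nat \<Rightarrow> nat \<Rightarrow> (nat \<Rightarrow> nat) \<Rightarrow> bool" where
  "step_list n \<tau> t \<longleftrightarrow> \<tau> \<le> n \<and> strict_mono_on {0..\<tau>} t \<and> t \<tau> = n"

definition mirror :: "(nat \<Rightarrow> 'a::real_vector) \<Rightarrow> (nat \<Rightarrow> nat) \<Rightarrow> 'a set" where
  "mirror v t = span (v ` {0..t 0})"

definition unit_sphere_in :: "(nat \<Rightarrow> 'a::euclidean_space) \<Rightarrow> nat \<Rightarrow> nat \<Rightarrow> 'a set" where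
  "unit_sphere_in v l m = {x \<in> span (v ` {l..m}). norm x = 1}"

text \<open>For \<open>\<tau> = 0\<close> the torus is the singleton consisting of the empty family.\<close>

definition torus ::
  "(nat \<Rightarrow> 'a::euclidean_space) \<Rightarrow> nat \<Rightarrow> (nat \<Rightarrow> nat) \<Rightarrow> (nat \<Rightarrow> 'a) set" where
  "torus v \<tau> t = (\<Pi>\<^sub>E h\<in>{1..\<tau>}. unit_sphere_in v (t (h - 1) + 1) (t h))"

text \<open>The family \<open>B_J = (v 0, \<dots>, v (t 0), J 1, \<dots>, J \<tau>)\<close>, indexed by \<open>{0..t 0 + \<tau>}\<close>.\<close>

definition frame :: "(nat \<Rightarrow> 'a) \<Rightarrow> (nat \<Rightarrow> nat) \<Rightarrow> (nat \<Rightarrow> 'a) \<Rightarrow> nat \<Rightarrow> 'a" where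
  "frame v t J i = (if i \<le> t 0 then v i else J (i - t 0))"

definition slice ::
  "(nat \<Rightarrow> 'a::real_vector) \<Rightarrow> nat \<Rightarrow> (nat \<Rightarrow> nat) \<Rightarrow> (nat \<Rightarrow> 'a) \<Rightarrow> 'a set" where
  "slice v \<tau> t J = span (frame v t J ` {0..t 0 + \<tau>})"

text \<open>The partial derivative with respect to the coordinate along a member \<open>w\<close> of a basis of a
  subspace.  At a point of a relatively open subset of that subspace, it (and its iterates along
  basis members) only depends on the restriction of \<open>f\<close> to that subset.\<close>

definition partial_deriv ::
  "'a::real_vector \<Rightarrow> ('a \<Rightarrow> 'b::real_normed_vector) \<Rightarrow> 'a \<Rightarrow> 'b" where
  "partial_deriv w f x = vector_derivative (\<lambda>s. f (x + s *\<^sub>R w)) (at 0)"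

definition C1_along ::
  "(nat \<Rightarrow> 'a::real_normed_vector) \<Rightarrow> nat \<Rightarrow> 'a set \<Rightarrow> ('a \<Rightarrow> 'b::real_normed_vector) \<Rightarrow> bool" where
  "C1_along b m U f \<longleftrightarrow>
     (\<forall>i\<in>{0..m}. (\<forall>x\<in>U. (\<lambda>s::real. f (x + s *\<^sub>R b i)) differentiable (at 0)) \<and>
                 continuous_on U (partial_deriv (b i) f))"

definition monogenic ::
  "(nat \<Rightarrow> 'a::{real_algebra_1, euclidean_space}) \<Rightarrow> nat \<Rightarrow> 'a set \<Rightarrow> ('a \<Rightarrow> 'a) \<Rightarrow> bool" where
  "monogenic b m U f \<longleftrightarrow>
     C1_along b m U f \<and> (\<forall>x\<in>U. (\<Sum>i=0..m. b i * partial_deriv (b i) f x) = 0)"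

definition T_regular ::
  "(nat \<Rightarrow> 'a::{real_algebra_1, euclidean_space}) \<Rightarrow> nat \<Rightarrow> (nat \<Rightarrow> nat) \<Rightarrow> 'a set \<Rightarrow> ('a \<Rightarrow> 'a) \<Rightarrow> bool"
  where
  "T_regular v \<tau> t \<Omega> f \<longleftrightarrow>
     (\<forall>J\<in>torus v \<tau> t. monogenic (frame v t J) (t 0 + \<tau>) (\<Omega> \<inter> slice v \<tau> t J) f)"

text \<open>\<open>iter_partial b m h f\<close> is \<open>\<partial>\<^sub>0\<^bsup>h 0\<^esup> \<dots> \<partial>\<^sub>m\<^bsup>h m\<^esup> f\<close>, the derivative with index \<open>m\<close> being taken first.\<close>

definition iter_partial ::
  "(nat \<Rightarrow> 'a::real_vector) \<Rightarrow> nat \<Rightarrow> (nat \<Rightarrow> nat) \<Rightarrow> ('a \<Rightarrow> 'b::real_normed_vector) \<Rightarrow> 'a \<Rightarrow> 'b" where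
  "iter_partial b m h f = foldr (\<lambda>i. partial_deriv (b i) ^^ h i) [0..<m + 1] f"

definition mult_inverse :: "'a::monoid_mult \<Rightarrow> 'a" where
  "mult_inverse z = (THE y. y * z = 1 \<and> z * y = 1)"

text \<open>The product \<open>J \<tau> ^ h (t 0 + \<tau>) * \<dots> * J 1 ^ h (t 0 + 1)\<close>.\<close>

definition unit_monomial ::
  "nat \<Rightarrow> (nat \<Rightarrow> nat) \<Rightarrow> (nat \<Rightarrow> nat) \<Rightarrow> (nat \<Rightarrow> 'a::monoid_mult) \<Rightarrow> 'a" where
  "unit_monomial \<tau> t h J = prod_list (map (\<lambda>i. J i ^ h (t 0 + i)) (rev [1..<\<tau> + 1]))"

definition adapted_deriv ::
  "(nat \<Rightarrow> 'a::{real_algebra_1, euclidean_space}) \<Rightarrow> nat \<Rightarrow> (nat \<Rightarrow> nat) \<Rightarrow> (nat \<Rightarrow> nat) \<Rightarrow>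
   ('a \<Rightarrow> 'a) \<Rightarrow> 'a \<Rightarrow> 'a" where
  "adapted_deriv v \<tau> t h f x =
     (THE y. \<forall>J\<in>torus v \<tau> t. x \<in> slice v \<tau> t J \<longrightarrow>
        y = mult_inverse (unit_monomial \<tau> t h J) * iter_partial (frame v t J) (t 0 + \<tau>) h f x)"

text \<open>Multi-indices with \<open>m\<close> entries are functions on \<open>{1..m}\<close> extended by \<open>0\<close>.\<close>

definition multi_indices :: "nat \<Rightarrow> nat \<Rightarrow> (nat \<Rightarrow> nat) set" where
  "multi_indices m K = {k. (\<forall>s. s \<notin> {1..m} \<longrightarrow> k s = 0) \<and> (\<Sum>s=1..m. k s) = K}"

definition multi_fact :: "nat \<Rightarrow> (nat \<Rightarrow> nat) \<Rightarrow> real" where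
  "multi_fact m k = (\<Prod>s=1..m. fact (k s))"

text \<open>The component \<open>x\<^sup>h\<close>; the coordinates of \<open>x\<close> in the orthonormal basis are scalar products.\<close>

definition block ::
  "(nat \<Rightarrow> 'a::euclidean_space) \<Rightarrow> (nat \<Rightarrow> nat) \<Rightarrow> nat \<Rightarrow> 'a \<Rightarrow> 'a" where
  "block v t h x = (\<Sum>l=t (h - 1) + 1..t h. (x \<bullet> v l) *\<^sub>R v l)"

text \<open>The polynomials \<open>\<T>\<^sub>k\<close>, for integer multi-indices; only the entries of \<open>k\<close> on
  \<open>{1..t 0 + \<tau>}\<close> are relevant.\<close>

function T_poly ::
  "(nat \<Rightarrow> 'a::{real_algebra_1, euclidean_space}) \<Rightarrow> nat \<Rightarrow> (nat \<Rightarrow> nat) \<Rightarrow> (nat \<Rightarrow> int) \<Rightarrow> 'a \<Rightarrow> 'a" where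
  "T_poly v \<tau> t k x =
     (if \<exists>s\<in>{1..t 0 + \<tau>}. k s < 0 then 0
      else if \<forall>s\<in>{1..t 0 + \<tau>}. k s = 0 then 1
      else
        (let a = (\<Sum>u=t 0 + 1..t 0 + \<tau>. k u);
             as = (\<lambda>s. a - k s);
             bs = (\<lambda>s. \<Sum>u=s + 1..t 0 + \<tau>. k u)
         in (1 / of_int (\<Sum>s=1..t 0 + \<tau>. k s)) *\<^sub>R
           ((\<Sum>s=1..t 0. of_int (k s) *\<^sub>R
               (T_poly v \<tau> t (k(s := k s - 1)) x *
                (of_real (x \<bullet> v s) - ((-1) powi a * (x \<bullet> v 0)) *\<^sub>R v s))) +
            (\<Sum>s=t 0 + 1..t 0 + \<tau>. ((-1) powi bs s * of_int (k s)) *\<^sub>R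
               (T_poly v \<tau> t (k(s := k s - 1)) x *
                (of_real (x \<bullet> v 0) + (-1) powi as s *\<^sub>R block v t (s - t 0) x))))))"
  by pat_completeness auto

lemma T_poly_index_decreases:
  fixes k :: "nat \<Rightarrow> int"
  assumes "\<not> (\<exists>s\<in>{1..m}. k s < 0)" "\<not> (\<forall>s\<in>{1..m}. k s = 0)" "s \<in> {1..m}"
  shows "nat (sum (k(s := k s - 1)) {1..m}) < nat (sum k {1..m})"
proof -
  obtain u where u: "u \<in> {1..m}" "k u > 0"
    using assms(1,2) by force
  have "sum k {1..m} > 0"
    using assms(1) u by (intro sum_pos2[of _ u]) (auto simp: not_less)
  moreover have "sum (k(s := k s - 1)) {1..m} = sum k {1..m} - 1"
    proof -
    have "sum (k(s := k s - 1)) ({1..m} - {s}) = sum k ({1..m} - {s})"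
      by (intro sum.cong) auto
    then show ?thesis
      using sum.remove[OF finite_atLeastAtMost assms(3), of k]
        sum.remove[OF finite_atLeastAtMost assms(3), of "k(s := k s - 1)"] by simp
  qed
  ultimately show ?thesis by simp
qed

termination
  apply (relation "Wellfounded.measure (\<lambda>(v, \<tau>, t, k, x). nat (sum k {1..t 0 + \<tau>}))")
    apply (rule wf_measure)
   apply (simp_all only: in_measure prod.case)
   apply (rule T_poly_index_decreases; simp)+
  done

text \<open>The unconditional recursion equation of \<open>T_poly\<close> would loop as a rewrite rule.\<close>

declare T_poly.simps [simp del]

definition taylor_term ::
  "(nat \<Rightarrow> 'a::{real_algebra_1, euclidean_space}) \<Rightarrow> nat \<Rightarrow> (nat \<Rightarrow> nat) \<Rightarrow> ('a \<Rightarrow> 'a) \<Rightarrow> 'a \<Rightarrow>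
   nat \<Rightarrow> 'a \<Rightarrow> 'a" where
  "taylor_term v \<tau> t f p K x =
     (\<Sum>k\<in>multi_indices (t 0 + \<tau>) K.
        T_poly v \<tau> t (\<lambda>s. int (k s)) (x - p) *
        ((1 / multi_fact (t 0 + \<tau>) k) *\<^sub>R adapted_deriv v \<tau> t (k(0 := 0)) f p))"

text \<open>The empty compact set is excluded because \<open>Sup {}\<close> is unspecified for reals.\<close>

definition normally_convergent_on ::
  "'a::topological_space set \<Rightarrow> (nat \<Rightarrow> 'a \<Rightarrow> 'b::real_normed_vector) \<Rightarrow> bool" where
  "normally_convergent_on U F \<longleftrightarrow>
     (\<forall>k. continuous_on U (F k)) \<and>
     (\<forall>C. compact C \<and> C \<noteq> {} \<and> C \<subseteq> U \<longrightarrow> summable (\<lambda>k. SUP x\<in>C. norm (F k x)))"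

end

theory Submission
  imports Defs
begin

text \<open>
  On a slice, the frame \<open>B_J\<close> is orthonormal and satisfies the Clifford relations, so a
  \<open>J\<close>-monogenic function is harmonic.  Restricted to a ball it is a locally uniform limit of
  harmonic polynomials: averaging over small cubes makes it twice differentiable, and polynomial
  boundary values on a sphere have harmonic polynomial extensions.  For a harmonic polynomial \<open>h\<close>
  the homogeneous part of degree \<open>k\<close> at a unit vector \<open>\<xi>\<close> is the spherical mean of \<open>h\<close> against a
  zonal harmonic; by the Cauchy--Schwarz inequality it is at most
  \<open>sqrt (k + m choose m)\<close> times the maximum of \<open>\<bar>h\<bar>\<close> on the sphere.  Passing to the limit, the
  Taylor series of \<open>f_J\<close> at \<open>p\<close> converges to \<open>f_J\<close> in the whole ball, with this estimate.

  The Cauchy--Riemann equation turns \<open>\<Sum>\<^sub>i x\<^sub>i \<partial>\<^sub>i\<close> into \<open>\<Sum>\<^sub>s (x\<^sub>s - x\<^sub>0 e\<^sub>s) \<partial>\<^sub>s\<close>, which rewrites the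
  Taylor polynomials in terms of Fueter polynomials, and \<open>\<T>\<^sub>k\<close> is on each slice the Fueter
  polynomial times \<open>J\<^sub>\<tau>\<^bsup>k\<^esup> \<dots> J\<^sub>1\<^bsup>k\<^esup>\<close>.  Finally, a monogenic function vanishing on a coordinate
  hyperplane through \<open>p\<close> is zero.  This gives the representation formula
  \<open>f_J = (1 - J\<^sub>h I\<^sub>h) / 2 f_I + (1 + J\<^sub>h I\<^sub>h) / 2 f_I'\<close> for slices differing in one direction, where
  \<open>I'\<close> is \<open>I\<close> with \<open>I\<^sub>h\<close> replaced by \<open>- I\<^sub>h\<close>.  It shows that the adapted derivatives do not
  depend on the slice, and each of the \<open>\<tau>\<close> changes of direction costs a factor
  \<open>1 + \<omega>\<^sup>2\<close> in the estimate.
\<close>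

section \<open>Directional derivatives and polynomials on the span of an orthonormal frame\<close>

text \<open>T-regularity controls \<open>f\<close> only on slices, and only to first order; it says
  nothing directly about \<open>f\<close> as a function on \<Omega>. All analysis is therefore done
  on one slice at a time, with derivatives along single vectors. This reaches every point, because
  each point of \<open>V\<close> lies on some slice and a ball centred on the mirror meets each
  slice in a ball with the same centre. The part of degree \<open>k\<close> of the Taylor series is
  kept as \<open>(1 / fact k) *\<^sub>R (partial_deriv x ^^ k) f p\<close>, an iterated derivative
  along one vector. In this form the estimates pass from harmonic polynomials to \<open>f\<close>
  without any expansion in coordinates; multi-indices enter only through an algebraic rewriting. The
  norm is not submultiplicative. The harmonic estimates involve no products, so \<omega> enters only
  when the slice is changed. The bound obtained has the square root of the binomial coefficient and
  no factor in front of the power of 1 + \<omega>^2; the constant of the theorem follows because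
  \<omega> and the binomial coefficient are at least 1.\<close>

definition has_dd :: "'a::real_normed_vector \<Rightarrow> ('a \<Rightarrow> 'b::real_normed_vector) \<Rightarrow> 'b \<Rightarrow> 'a \<Rightarrow> bool" where
  "has_dd w f D x \<longleftrightarrow> ((\<lambda>s. f (x + s *\<^sub>R w)) has_vector_derivative D) (at 0)"

lemma has_dd_partial_deriv: "has_dd w f D x \<Longrightarrow> partial_deriv w f x = D"
  unfolding has_dd_def partial_deriv_def by (rule vector_derivative_at)

lemma has_dd_unique: "has_dd w f D x \<Longrightarrow> has_dd w f E x \<Longrightarrow> D = E"
  using has_dd_partial_deriv by metis

lemma has_dd_const: "has_dd w (\<lambda>x. c) 0 x"
  unfolding has_dd_def by simp

lemma has_dd_add: "has_dd w f D x \<Longrightarrow> has_dd w g E x \<Longrightarrow> has_dd w (\<lambda>x. f x + g x) (D + E) x"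
  unfolding has_dd_def by (rule has_vector_derivative_add)

lemma has_dd_diff: "has_dd w f D x \<Longrightarrow> has_dd w g E x \<Longrightarrow> has_dd w (\<lambda>x. f x - g x) (D - E) x"
  unfolding has_dd_def by (rule has_vector_derivative_diff)

lemma has_dd_sum:
  "(\<And>i. i \<in> A \<Longrightarrow> has_dd w (f i) (D i) x) \<Longrightarrow> has_dd w (\<lambda>x. \<Sum>i\<in>A. f i x) (\<Sum>i\<in>A. D i) x"
  unfolding has_dd_def by (rule has_vector_derivative_sum)

lemma has_dd_bounded_linear:
  assumes "bounded_linear L" "has_dd w f D x"
  shows "has_dd w (\<lambda>x. L (f x)) (L D) x"
  using assms unfolding has_dd_def by (rule bounded_linear.has_vector_derivative)

lemma has_dd_mult:
  fixes f g :: "_ \<Rightarrow> real"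
  assumes "has_dd w f D x" "has_dd w g E x"
  shows "has_dd w (\<lambda>x. f x * g x) (f x * E + D * g x) x"
  using has_vector_derivative_mult[OF assms[unfolded has_dd_def]] unfolding has_dd_def by simp

lemma has_dd_inner_left: "has_dd w (\<lambda>x. x \<bullet> c) (w \<bullet> c) x"
  unfolding has_dd_def by (auto simp: has_vector_derivative_def inner_add_left intro!: derivative_eq_intros)

lemma has_dd_line:
  assumes "has_dd w f D (x + s *\<^sub>R w)"
  shows "((\<lambda>s. f (x + s *\<^sub>R w)) has_vector_derivative D) (at s)"
proof -
  have "((\<lambda>u. u - s) has_vector_derivative 1) (at s)"
    by (auto intro!: derivative_eq_intros)
  from vector_diff_chain_at[OF this, of "\<lambda>r. f (x + s *\<^sub>R w + r *\<^sub>R w)" D]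
  show ?thesis
    using assms unfolding has_dd_def by (simp add: o_def algebra_simps)
qed

lemma has_dd_affine:
  assumes "has_dd w f D (q + r *\<^sub>R x)"
  shows "has_dd w (\<lambda>x. f (q + r *\<^sub>R x)) (r *\<^sub>R D) x"
proof -
  have "((\<lambda>u::real. r * u) has_vector_derivative r) (at 0)"
    by (auto intro!: derivative_eq_intros)
  from vector_diff_chain_at[OF this, of "\<lambda>s. f (q + r *\<^sub>R x + s *\<^sub>R w)" D]
  show ?thesis
    using assms unfolding has_dd_def by (simp add: o_def algebra_simps)
qed

text \<open>The line \<open>x + s *\<^sub>R w\<close> stays in the subspace, so agreement on a
  relatively open subset is enough. Besides slices, the subspace will also be a hyperplane of a
  slice, where it gives vanishing tangential derivatives.\<close>

lemma has_dd_cong: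
  fixes f g :: "'a::real_normed_vector \<Rightarrow> 'b::real_normed_vector"
  assumes "has_dd w f D x" and U: "openin (top_of_set S) U" "subspace S" "w \<in> S" "x \<in> U"
    and eq: "\<And>y. y \<in> U \<Longrightarrow> f y = g y"
  shows "has_dd w g D x"
proof -
  obtain T where T: "open T" "U = S \<inter> T"
    using U(1) by (auto simp: openin_open)
  have "open ((\<lambda>s. x + s *\<^sub>R w) -` T)"
    using T(1) by (intro continuous_open_vimage continuous_intros) auto
  moreover have "0 \<in> (\<lambda>s. x + s *\<^sub>R w) -` T"
    using T U by auto
  moreover have "f (x + s *\<^sub>R w) = g (x + s *\<^sub>R w)" if "s \<in> (\<lambda>s. x + s *\<^sub>R w) -` T" for s
  proof -
    have "x + s *\<^sub>R w \<in> S"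
      using T(2) U by (intro subspace_add subspace_scale) auto
    then show ?thesis
      using that T(2) eq by blast
  qed
  ultimately show ?thesis
    unfolding has_dd_def
    by (rule has_vector_derivative_transform_within_open[OF assms(1)[unfolded has_dd_def]])
qed

lemma partial_deriv_cong:
  fixes f g :: "'a::real_normed_vector \<Rightarrow> 'b::real_normed_vector"
  assumes U: "openin (top_of_set S) U" "subspace S" "w \<in> S" "x \<in> U"
    and eq: "\<And>y. y \<in> U \<Longrightarrow> f y = g y"
  shows "partial_deriv w f x = partial_deriv w g x"
proof -
  have "has_dd w f D x \<longleftrightarrow> has_dd w g D x" for D
    using has_dd_cong[OF _ U, of f D g] has_dd_cong[OF _ U, of g D f] eq by metis
  then show ?thesis
    unfolding partial_deriv_def vector_derivative_def has_dd_def by simp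
qed

locale orthonormal_frame =
  fixes b :: "nat \<Rightarrow> 'a::euclidean_space" and m :: nat
  assumes orth: "i \<le> m \<Longrightarrow> j \<le> m \<Longrightarrow> b i \<bullet> b j = (if i = j then 1 else 0)"
begin

abbreviation S :: "'a set" where "S \<equiv> span (b ` {0..m})"

abbreviation pd :: "nat \<Rightarrow> ('a \<Rightarrow> 'c::real_normed_vector) \<Rightarrow> 'a \<Rightarrow> 'c" where
  "pd i \<equiv> partial_deriv (b i)"

definition lap :: "('a \<Rightarrow> real) \<Rightarrow> 'a \<Rightarrow> real" where
  "lap p x = (\<Sum>i=0..m. pd i (pd i p) x)"

text \<open>The squared length of the orthogonal projection to \<open>S\<close>. Being a polynomial
  on the whole space, it obeys the rules for \<open>poly_fun\<close>; on \<open>S\<close> it is the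
  squared norm.\<close>

definition rho :: "'a \<Rightarrow> real" where
  "rho x = (\<Sum>i=0..m. (x \<bullet> b i) * (x \<bullet> b i))"

text \<open>Polynomials are generated one coordinate factor at a time, so that differential
  identities are proved by induction with only the product rule for one coordinate.\<close>

inductive poly_fun :: "('a \<Rightarrow> real) \<Rightarrow> bool" where
  const: "poly_fun (\<lambda>x. c)"
| coord: "poly_fun p \<Longrightarrow> i \<le> m \<Longrightarrow> poly_fun (\<lambda>x. (x \<bullet> b i) * p x)"
| add: "poly_fun p \<Longrightarrow> poly_fun q \<Longrightarrow> poly_fun (\<lambda>x. p x + q x)"

inductive hpoly :: "nat \<Rightarrow> ('a \<Rightarrow> real) \<Rightarrow> bool" where
  const: "hpoly 0 (\<lambda>x. c)"
| coord: "hpoly d p \<Longrightarrow> i \<le> m \<Longrightarrow> hpoly (Suc d) (\<lambda>x. (x \<bullet> b i) * p x)"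
| add: "hpoly d p \<Longrightarrow> hpoly d q \<Longrightarrow> hpoly d (\<lambda>x. p x + q x)"

lemma b_in_S: "i \<le> m \<Longrightarrow> b i \<in> S"
  by (intro span_base) auto

lemma norm_b: "i \<le> m \<Longrightarrow> norm (b i) = 1"
  using orth[of i i] by (simp add: norm_eq_sqrt_inner)

lemma S_expand: "x \<in> S \<Longrightarrow> x = (\<Sum>i=0..m. (x \<bullet> b i) *\<^sub>R b i)"
proof (induction rule: span_induct_alt)
  case base
  then show ?case by simp
next
  case (step c y z)
  then obtain j where j: "j \<le> m" "y = b j" by auto
  have "(\<Sum>i=0..m. ((c *\<^sub>R y + z) \<bullet> b i) *\<^sub>R b i)
      = (\<Sum>i=0..m. (if j = i then c *\<^sub>R b j else 0)) + (\<Sum>i=0..m. (z \<bullet> b i) *\<^sub>R b i)"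
    unfolding sum.distrib[symmetric] using j orth
    by (intro sum.cong) (auto simp: algebra_simps)
  then show ?case
    using step(2) j by simp
qed

lemma rho_S: "x \<in> S \<Longrightarrow> rho x = (norm x)\<^sup>2"
proof -
  assume "x \<in> S"
  then have "x \<bullet> x = x \<bullet> (\<Sum>i=0..m. (x \<bullet> b i) *\<^sub>R b i)"
    using S_expand by simp
  then show ?thesis
    by (simp add: inner_sum_right rho_def power2_norm_eq_inner)
qed

lemma poly_fun_scale: "poly_fun p \<Longrightarrow> poly_fun (\<lambda>x. c * p x)"
proof (induction rule: poly_fun.induct)
  case (const c')
  then show ?case by (rule poly_fun.const)
next
  case (coord p i)
  then show ?case using poly_fun.coord[OF coord(3,2)] by (simp add: mult.left_commute)
next
  case (add p q)
  then show ?case using poly_fun.add[OF add(3,4)] by (simp add: distrib_left)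
qed

lemma poly_fun_mult: "poly_fun p \<Longrightarrow> poly_fun q \<Longrightarrow> poly_fun (\<lambda>x. p x * q x)"
proof (induction rule: poly_fun.induct)
  case (const c)
  then show ?case by (rule poly_fun_scale)
next
  case (coord p i)
  then show ?case using poly_fun.coord[OF coord(3,2)] by (simp add: mult.assoc)
next
  case (add p q')
  then show ?case using poly_fun.add[OF add(3,4)] by (simp add: distrib_right)
qed

lemma poly_fun_sum: "(\<And>i. i \<in> A \<Longrightarrow> poly_fun (f i)) \<Longrightarrow> poly_fun (\<lambda>x. \<Sum>i\<in>A. f i x)"
  by (induction A rule: infinite_finite_induct) (auto intro: poly_fun.intros)

lemma poly_fun_inner: "i \<le> m \<Longrightarrow> poly_fun (\<lambda>x. x \<bullet> b i)"
  using poly_fun.coord[OF poly_fun.const[of 1]] by simp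

lemma poly_fun_diff: "poly_fun p \<Longrightarrow> poly_fun q \<Longrightarrow> poly_fun (\<lambda>x. p x - q x)"
  using poly_fun.add[OF _ poly_fun_scale[of q "-1"], of p] by simp

lemma poly_fun_affine: "poly_fun p \<Longrightarrow> poly_fun (\<lambda>x. p (q + r *\<^sub>R x))"
proof (induction rule: poly_fun.induct)
  case (coord p i)
  have "poly_fun (\<lambda>x. (q \<bullet> b i + r * (x \<bullet> b i)) * p (q + r *\<^sub>R x))"
    by (intro poly_fun_mult coord poly_fun.add poly_fun.const poly_fun_scale poly_fun_inner)
  then show ?case by (simp add: inner_add_left)
qed (auto intro: poly_fun.intros)

lemma poly_fun_dd: "poly_fun p \<Longrightarrow> \<exists>p'. poly_fun p' \<and> (\<forall>x. has_dd w p (p' x) x)"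
proof (induction rule: poly_fun.induct)
  case (const c)
  then show ?case using has_dd_const poly_fun.const by blast
next
  case (coord p i)
  then obtain p' where p': "poly_fun p'" "\<forall>x. has_dd w p (p' x) x" by blast
  then have "\<forall>x. has_dd w (\<lambda>x. (x \<bullet> b i) * p x) ((x \<bullet> b i) * p' x + (w \<bullet> b i) * p x) x"
    by (auto intro!: has_dd_mult has_dd_inner_left)
  moreover have "poly_fun (\<lambda>x. (x \<bullet> b i) * p' x + (w \<bullet> b i) * p x)"
    using coord p' by (auto intro!: poly_fun.intros poly_fun_scale)
  ultimately show ?case by blast
next
  case (add p q)
  then obtain p' q' where "poly_fun p'" "\<forall>x. has_dd w p (p' x) x"
    "poly_fun q'" "\<forall>x. has_dd w q (q' x) x" by blast
  then show ?case
    by (intro exI[of _ "\<lambda>x. p' x + q' x"]) (auto intro: poly_fun.intros has_dd_add)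
qed

lemma poly_fun_has_dd: "poly_fun p \<Longrightarrow> has_dd w p (partial_deriv w p x) x"
  using poly_fun_dd has_dd_partial_deriv by metis

lemma poly_fun_partial_deriv: "poly_fun p \<Longrightarrow> poly_fun (partial_deriv w p)"
proof -
  assume "poly_fun p"
  then obtain p' where p': "poly_fun p'" "\<forall>x. has_dd w p (p' x) x"
    using poly_fun_dd by blast
  then have "partial_deriv w p = p'"
    using has_dd_partial_deriv by blast
  then show ?thesis using p' by simp
qed

lemma dd_const: "partial_deriv (w::'a) (\<lambda>x. c) = (\<lambda>x. 0)"
  by (rule ext, rule has_dd_partial_deriv, rule has_dd_const)

lemma dd_add: "poly_fun p \<Longrightarrow> poly_fun q \<Longrightarrow>
    partial_deriv w (\<lambda>x. p x + q x) = (\<lambda>x. partial_deriv w p x + partial_deriv w q x)"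
  by (intro ext has_dd_partial_deriv has_dd_add poly_fun_has_dd)

lemma dd_diff: "poly_fun p \<Longrightarrow> poly_fun q \<Longrightarrow>
    partial_deriv w (\<lambda>x. p x - q x) = (\<lambda>x. partial_deriv w p x - partial_deriv w q x)"
  by (intro ext has_dd_partial_deriv has_dd_diff poly_fun_has_dd)

lemma dd_mult: "poly_fun p \<Longrightarrow> poly_fun q \<Longrightarrow>
    partial_deriv w (\<lambda>x. p x * q x) = (\<lambda>x. p x * partial_deriv w q x + partial_deriv w p x * q x)"
  by (intro ext has_dd_partial_deriv has_dd_mult poly_fun_has_dd)

lemma dd_scale: "poly_fun p \<Longrightarrow> partial_deriv w (\<lambda>x. c * p x) = (\<lambda>x. c * partial_deriv w p x)"
  using dd_mult[OF poly_fun.const] by (simp add: dd_const)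

lemma dd_inner: "partial_deriv w (\<lambda>x. x \<bullet> c) = (\<lambda>x. w \<bullet> c)"
  by (intro ext has_dd_partial_deriv has_dd_inner_left)

lemma dd_coord: "poly_fun p \<Longrightarrow> i \<le> m \<Longrightarrow> partial_deriv w (\<lambda>x. (x \<bullet> b i) * p x)
    = (\<lambda>x. (x \<bullet> b i) * partial_deriv w p x + (w \<bullet> b i) * p x)"
  using dd_mult[OF poly_fun_inner, of i p w] by (simp add: dd_inner)

lemma dd_sum: "(\<And>i. i \<in> A \<Longrightarrow> poly_fun (f i)) \<Longrightarrow>
    partial_deriv w (\<lambda>x. \<Sum>i\<in>A. f i x) = (\<lambda>x. \<Sum>i\<in>A. partial_deriv w (f i) x)"
  by (intro ext has_dd_partial_deriv has_dd_sum poly_fun_has_dd)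

lemma dd_affine: "poly_fun p \<Longrightarrow>
    partial_deriv w (\<lambda>x. p (q + r *\<^sub>R x)) = (\<lambda>x. r * partial_deriv w p (q + r *\<^sub>R x))"
  using has_dd_affine[OF poly_fun_has_dd, of p w q r] by (intro ext has_dd_partial_deriv) simp

lemma dd_chain: "poly_fun p \<Longrightarrow> partial_deriv w p x = (\<Sum>i=0..m. (w \<bullet> b i) * pd i p x)"
proof (induction rule: poly_fun.induct)
  case (const c)
  then show ?case by (simp add: dd_const)
next
  case (coord p j)
  have "(\<Sum>i=0..m. (w \<bullet> b i) * pd i (\<lambda>x. (x \<bullet> b j) * p x) x)
     = (\<Sum>i=0..m. (x \<bullet> b j) * ((w \<bullet> b i) * pd i p x) + (if i = j then (w \<bullet> b j) * p x else 0))"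
    using coord by (intro sum.cong refl) (simp add: dd_coord orth distrib_left mult.left_commute)
  also have "\<dots> = (x \<bullet> b j) * partial_deriv w p x + (w \<bullet> b j) * p x"
    using coord by (simp add: sum.distrib sum_distrib_left)
  finally show ?case using coord by (simp add: dd_coord)
next
  case (add p q)
  then show ?case by (simp add: dd_add distrib_left sum.distrib)
qed

lemma dd_commute: "poly_fun p \<Longrightarrow>
    partial_deriv w (partial_deriv u p) = partial_deriv u (partial_deriv w p)"
proof (induction rule: poly_fun.induct)
  case (const c)
  then show ?case by (simp add: dd_const)
next
  case (coord p j)
  then show ?case
    by (simp add: dd_coord dd_add dd_scale poly_fun_partial_deriv poly_fun.coord poly_fun_scale fun_eq_iff)
next
  case (add p q)
  then show ?case by (simp add: dd_add poly_fun_partial_deriv)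
qed

lemma lap_const: "lap (\<lambda>x. c) = (\<lambda>x. 0)"
  unfolding lap_def dd_const by simp

lemma lap_add: "poly_fun p \<Longrightarrow> poly_fun q \<Longrightarrow> lap (\<lambda>x. p x + q x) = (\<lambda>x. lap p x + lap q x)"
  by (simp add: lap_def dd_add poly_fun_partial_deriv sum.distrib fun_eq_iff)

lemma lap_diff: "poly_fun p \<Longrightarrow> poly_fun q \<Longrightarrow> lap (\<lambda>x. p x - q x) = (\<lambda>x. lap p x - lap q x)"
  by (simp add: lap_def dd_diff poly_fun_partial_deriv sum_subtractf fun_eq_iff)

lemma lap_scale: "poly_fun p \<Longrightarrow> lap (\<lambda>x. c * p x) = (\<lambda>x. c * lap p x)"
  by (simp add: lap_def dd_scale poly_fun_partial_deriv sum_distrib_left fun_eq_iff)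

lemma lap_sum: "(\<And>i. i \<in> A \<Longrightarrow> poly_fun (f i)) \<Longrightarrow> lap (\<lambda>x. \<Sum>i\<in>A. f i x) = (\<lambda>x. \<Sum>i\<in>A. lap (f i) x)"
  by (induction A rule: infinite_finite_induct) (simp_all add: lap_const lap_add poly_fun_sum)

lemma lap_affine: "poly_fun p \<Longrightarrow> lap (\<lambda>x. p (q + r *\<^sub>R x)) = (\<lambda>x. r * r * lap p (q + r *\<^sub>R x))"
proof -
  assume p: "poly_fun p"
  have "pd i (pd i (\<lambda>x. p (q + r *\<^sub>R x))) x = r * (r * pd i (pd i p) (q + r *\<^sub>R x))" for i x
    unfolding dd_affine[OF p]
    by (subst dd_scale) (simp_all only: poly_fun_affine poly_fun_partial_deriv p
        dd_affine[OF poly_fun_partial_deriv[OF p]])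
  then show ?thesis
    by (simp add: lap_def sum_distrib_left mult.assoc fun_eq_iff)
qed

lemma lap_mult:
  assumes p: "poly_fun p" and q: "poly_fun q"
  shows "lap (\<lambda>x. p x * q x) = (\<lambda>x. p x * lap q x + 2 * (\<Sum>i=0..m. pd i p x * pd i q x) + lap p x * q x)"
proof
  fix x
  have "pd i (pd i (\<lambda>x. p x * q x)) x
      = p x * pd i (pd i q) x + 2 * (pd i p x * pd i q x) + pd i (pd i p) x * q x" for i
    unfolding dd_mult[OF p q]
    by (subst dd_add) (simp_all add: p q poly_fun_mult poly_fun_partial_deriv dd_mult)
  then show "lap (\<lambda>x. p x * q x) x
      = p x * lap q x + 2 * (\<Sum>i=0..m. pd i p x * pd i q x) + lap p x * q x"
    unfolding lap_def by (simp only: sum.distrib flip: sum_distrib_left sum_distrib_right)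
qed

lemma lap_dd: "poly_fun p \<Longrightarrow> lap (partial_deriv w p) = partial_deriv w (lap p)"
proof -
  assume p: "poly_fun p"
  have "pd i (pd i (partial_deriv w p)) = partial_deriv w (pd i (pd i p))" for i
    using dd_commute[OF p] dd_commute[OF poly_fun_partial_deriv[OF p]] by metis
  then show ?thesis
    unfolding lap_def using p by (simp add: dd_sum poly_fun_partial_deriv)
qed

lemma poly_fun_rho: "poly_fun rho"
  unfolding rho_def by (intro poly_fun_sum poly_fun_mult poly_fun_inner) auto

lemma dd_rho: "i \<le> m \<Longrightarrow> pd i rho = (\<lambda>x. 2 * (x \<bullet> b i))"
proof -
  assume i: "i \<le> m"
  have "pd i rho = (\<lambda>x. \<Sum>j=0..m. (x \<bullet> b j) * (b i \<bullet> b j) + (b i \<bullet> b j) * (x \<bullet> b j))"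
    unfolding rho_def
    by (subst dd_sum) (auto simp: poly_fun_mult poly_fun_inner dd_mult dd_inner)
  also have "\<dots> = (\<lambda>x. \<Sum>j=0..m. if i = j then 2 * (x \<bullet> b i) else 0)"
    using i orth by (intro ext sum.cong) auto
  finally show ?thesis using i by simp
qed

lemma lap_rho: "lap rho = (\<lambda>x. 2 * (real m + 1))"
proof -
  have "pd i (pd i rho) x = 2" if "i \<le> m" for i x
    using that by (simp add: dd_rho dd_scale dd_inner poly_fun_inner orth)
  then show ?thesis by (simp add: lap_def fun_eq_iff)
qed

section \<open>Homogeneous polynomials\<close>

lemma hpoly_poly_fun: "hpoly d p \<Longrightarrow> poly_fun p"
  by (induction rule: hpoly.induct) (auto intro: poly_fun.intros)

lemma hpoly_zero: "hpoly d (\<lambda>x. 0)"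
proof (induction d)
  case (Suc d)
  then show ?case using hpoly.coord[OF Suc, of 0] by simp
qed (rule hpoly.const)

lemma hpoly_mult: "hpoly d p \<Longrightarrow> hpoly e q \<Longrightarrow> hpoly (d + e) (\<lambda>x. p x * q x)"
proof (induction rule: hpoly.induct)
  case (const c)
  from const have "hpoly e (\<lambda>x. c * q x)"
  proof (induction rule: hpoly.induct)
    case (coord d p i)
    then show ?case using hpoly.coord[OF coord(3,2)] by (simp add: mult.left_commute)
  next
    case (add d p q)
    then show ?case using hpoly.add[OF add(3,4)] by (simp add: distrib_left)
  qed (rule hpoly.const)
  then show ?case by simp
next
  case (coord d p i)
  then show ?case using hpoly.coord[OF coord(3,2)] by (simp add: mult.assoc)
next
  case (add d p q')
  then show ?case using hpoly.add[OF add(3,4)] by (simp add: distrib_right)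
qed

lemma hpoly_scale: "hpoly d p \<Longrightarrow> hpoly d (\<lambda>x. c * p x)"
  using hpoly_mult[OF hpoly.const] by simp

lemma hpoly_diff: "hpoly d p \<Longrightarrow> hpoly d q \<Longrightarrow> hpoly d (\<lambda>x. p x - q x)"
  using hpoly.add[OF _ hpoly_scale[of d q "-1"], of p] by simp

lemma hpoly_sum: "(\<And>i. i \<in> A \<Longrightarrow> hpoly d (f i)) \<Longrightarrow> hpoly d (\<lambda>x. \<Sum>i\<in>A. f i x)"
  by (induction A rule: infinite_finite_induct) (auto intro: hpoly.intros hpoly_zero)

lemma hpoly_inner: "i \<le> m \<Longrightarrow> hpoly 1 (\<lambda>x. x \<bullet> b i)"
  using hpoly.coord[OF hpoly.const[of 1]] by simp

lemma hpoly_rho: "hpoly 2 rho"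
proof -
  have "hpoly (1 + 1) rho"
    unfolding rho_def by (intro hpoly_sum hpoly_mult hpoly_inner) auto
  then show ?thesis by (simp add: numeral_2_eq_2)
qed

text \<open>The second conjunct repairs the truncated \<open>d - 1\<close> at \<open>d = 0\<close>:
  a coordinate times the derivative of a constant must still count as degree 0, which works because
  that derivative is zero.\<close>

lemma hpoly_dd: "hpoly d p \<Longrightarrow> hpoly (d - 1) (partial_deriv w p) \<and> (d = 0 \<longrightarrow> partial_deriv w p = (\<lambda>x. 0))"
proof (induction rule: hpoly.induct)
  case (const c)
  then show ?case using hpoly.const by (simp add: dd_const)
next
  case (coord d p i)
  have "hpoly d (\<lambda>x. (x \<bullet> b i) * partial_deriv w p x)"
  proof (cases d)
    case 0
    then show ?thesis using coord by (simp add: hpoly.const)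
  next
    case (Suc e)
    then show ?thesis using coord hpoly.coord[of e "partial_deriv w p" i] by simp
  qed
  then have "hpoly d (\<lambda>x. (x \<bullet> b i) * partial_deriv w p x + (w \<bullet> b i) * p x)"
    using coord by (intro hpoly.add hpoly_scale)
  then show ?case using coord by (simp add: dd_coord hpoly_poly_fun)
next
  case (add d p q)
  then show ?case using hpoly.add by (auto simp: dd_add hpoly_poly_fun)
qed

lemma hpoly_homogeneous: "hpoly d p \<Longrightarrow> p (r *\<^sub>R x) = r ^ d * p x"
  by (induction rule: hpoly.induct) (auto simp: algebra_simps)

lemma hpoly_euler: "hpoly d p \<Longrightarrow> (\<Sum>i=0..m. (x \<bullet> b i) * pd i p x) = real d * p x"
proof (induction rule: hpoly.induct)
  case (const c)
  then show ?case by (simp add: dd_const)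
next
  case (coord d p j)
  then have p: "poly_fun p" by (simp add: hpoly_poly_fun)
  have "(\<Sum>i=0..m. (x \<bullet> b i) * pd i (\<lambda>x. (x \<bullet> b j) * p x) x)
     = (\<Sum>i=0..m. (x \<bullet> b j) * ((x \<bullet> b i) * pd i p x) + (if i = j then (x \<bullet> b j) * p x else 0))"
    using coord p by (intro sum.cong refl) (simp add: dd_coord orth distrib_left mult.left_commute)
  also have "\<dots> = (x \<bullet> b j) * (real d * p x) + (x \<bullet> b j) * p x"
    using coord by (simp add: sum.distrib flip: sum_distrib_left)
  finally show ?case by (simp add: algebra_simps)
next
  case (add d p q)
  then show ?case by (simp add: dd_add hpoly_poly_fun distrib_left sum.distrib)
qed

lemma hpoly_dd_self: "hpoly d p \<Longrightarrow> partial_deriv x p x = real d * p x"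
  using hpoly_euler dd_chain[OF hpoly_poly_fun] by metis

text \<open>Homogeneity is used with the factor 0, where \<open>0 ^ 0 = 1\<close>.\<close>

lemma hpoly_0_const: "hpoly 0 p \<Longrightarrow> p x = p y"
  using hpoly_homogeneous[of 0 p 0 x] hpoly_homogeneous[of 0 p 0 y] by simp

lemma hpoly_at_0: "hpoly d p \<Longrightarrow> d > 0 \<Longrightarrow> p 0 = 0"
  using hpoly_homogeneous[of d p 0 0] by (simp add: power_0_left split: if_splits)

text \<open>In the coefficient, 2 (m + 1) is the Laplacian of \<open>rho\<close> on a space of
  dimension m + 1, and 4 d comes from the mixed term through Euler's identity.\<close>

lemma lap_rho_mult: "hpoly d p \<Longrightarrow> lap (\<lambda>x. rho x * p x)
    = (\<lambda>x. rho x * lap p x + 2 * (real m + 1 + 2 * real d) * p x)"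
proof -
  assume p: "hpoly d p"
  have "(\<Sum>j=0..m. pd j rho x * pd j p x) = 2 * (\<Sum>j=0..m. (x \<bullet> b j) * pd j p x)" for x
    unfolding sum_distrib_left by (intro sum.cong) (auto simp: dd_rho)
  then show ?thesis
    using p hpoly_euler[OF p] by (simp add: lap_mult poly_fun_rho hpoly_poly_fun lap_rho algebra_simps fun_eq_iff)
qed

end

section \<open>Harmonic polynomials and their homogeneous parts\<close>

text \<open>A positive second derivative would make \<open>g1\<close>, which vanishes at the
  interior maximum, positive just to the right of 0, so \<open>g\<close> would exceed
  \<open>g 0\<close> there.\<close>

lemma second_derivative_nonpos_at_max:
  fixes g :: "real \<Rightarrow> real"
  assumes "\<delta> > 0" and g1: "\<And>s. \<bar>s\<bar> < \<delta> \<Longrightarrow> (g has_real_derivative g1 s) (at s)"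
    and g2: "(g1 has_real_derivative D) (at 0)" and max: "\<And>s. \<bar>s\<bar> < \<delta> \<Longrightarrow> g s \<le> g 0"
  shows "D \<le> 0"
proof (rule ccontr)
  assume "\<not> D \<le> 0"
  moreover have "g1 0 = 0"
    using DERIV_local_max[OF g1[of 0] \<open>\<delta> > 0\<close>] max \<open>\<delta> > 0\<close> by simp
  ultimately obtain d where d: "d > 0" "\<And>h. 0 < h \<Longrightarrow> h < d \<Longrightarrow> 0 < g1 h"
    using DERIV_pos_inc_right[OF g2] by auto
  define e where "e = min d \<delta> / 2"
  have e: "0 < e" "e < d" "e < \<delta>"
    using d(1) \<open>\<delta> > 0\<close> by (auto simp: e_def)
  have "g 0 < g e"
    using e d(2) by (intro DERIV_pos_imp_increasing_open[OF e(1)])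
      (auto intro!: exI g1 continuous_at_imp_continuous_on DERIV_isCont[OF g1])
  then show False
    using max[of e] e by simp
qed

context orthonormal_frame
begin

lemma has_dd_real_line:
  fixes f :: "'a \<Rightarrow> real"
  assumes "has_dd w f D (x + s *\<^sub>R w)"
  shows "((\<lambda>s. f (x + s *\<^sub>R w)) has_real_derivative D) (at s)"
  using has_dd_line[OF assms] by (simp add: has_real_derivative_iff_has_vector_derivative)

text \<open>Adding e |y - p|^2 makes the sum of the second derivatives strictly positive, which is
  incompatible with an interior maximum, where each of them is nonpositive. Only pure second
  derivatives along the frame are involved, which is what averaged functions provide.\<close>

theorem max_principle:
  fixes u :: "'a \<Rightarrow> real"
  assumes p: "p \<in> S" and cont: "continuous_on (cball p r \<inter> S) u"
    and d1: "\<And>x i. x \<in> ball p r \<inter> S \<Longrightarrow> i \<le> m \<Longrightarrow> has_dd (b i) u (u1 i x) x"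
    and d2: "\<And>x i. x \<in> ball p r \<inter> S \<Longrightarrow> i \<le> m \<Longrightarrow> has_dd (b i) (u1 i) (u2 i x) x"
    and harmonic: "\<And>x. x \<in> ball p r \<inter> S \<Longrightarrow> (\<Sum>i=0..m. u2 i x) = 0"
    and bd: "\<And>x. x \<in> sphere p r \<inter> S \<Longrightarrow> u x \<le> c"
    and x: "x \<in> cball p r \<inter> S"
  shows "u x \<le> c"
proof (rule ccontr)
  assume "\<not> u x \<le> c"
  then have ux: "u x > c" by simp
  have "r \<ge> 0" using x by (auto intro: order_trans[OF zero_le_dist])
  \<comment> \<open>The perturbation raises the boundary values by at most e r^2, which is at most
    half of the excess \<open>u x - c\<close>; the \<open>+ 1\<close> covers r = 0.\<close>
  define e where "e = (u x - c) / (2 * (r\<^sup>2 + 1))"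
  have e: "e > 0" using ux by (simp add: e_def add_nonneg_pos)
  have "e * r\<^sup>2 \<le> e * (r\<^sup>2 + 1)" using e by simp
  also have "\<dots> = (u x - c) / 2"
    unfolding e_def using add_nonneg_pos[of "r\<^sup>2" 1] by (simp add: field_simps)
  finally have er: "e * r\<^sup>2 < u x - c" using ux by argo
  define w where "w y = u y + e * (norm (y - p))\<^sup>2" for y
  have "compact (cball p r \<inter> S)"
    by (intro compact_Int_closed compact_cball closed_subspace subspace_span)
  moreover have "continuous_on (cball p r \<inter> S) w"
    unfolding w_def by (intro continuous_intros cont)
  ultimately obtain z where z: "z \<in> cball p r \<inter> S" "\<And>y. y \<in> cball p r \<inter> S \<Longrightarrow> w y \<le> w z"
    using continuous_attains_sup[of "cball p r \<inter> S" w] x by blast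
  have "u x \<le> w x" using e by (simp add: w_def)
  then have wz: "c + e * r\<^sup>2 < w z" using z(2)[OF x] er by linarith
  have "dist p z \<noteq> r"
  proof
    assume "dist p z = r"
    then have "w z \<le> c + e * r\<^sup>2"
      using bd[of z] z(1) by (auto simp: w_def dist_norm norm_minus_commute)
    then show False using wz by simp
  qed
  then have zb: "dist p z < r" using z(1) by simp
  have "u2 i z + 2 * e \<le> 0" if i: "i \<le> m" for i
  proof (rule second_derivative_nonpos_at_max)
    show "r - dist p z > 0" using zb by simp
    have bi: "norm (b i) = 1" using i by (rule norm_b)
    have in_ball: "z + s *\<^sub>R b i \<in> ball p r \<inter> S" if "\<bar>s\<bar> < r - dist p z" for s
    proof -
      have "dist p (z + s *\<^sub>R b i) \<le> dist p z + dist z (z + s *\<^sub>R b i)"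
        by (rule dist_triangle)
      also have "dist z (z + s *\<^sub>R b i) = \<bar>s\<bar>" by (simp add: dist_norm bi)
      finally show ?thesis
        using that z(1) b_in_S[OF i] by (auto intro: span_add span_scale)
    qed
    have quad: "w (z + s *\<^sub>R b i) = u (z + s *\<^sub>R b i)
        + e * ((norm (z - p))\<^sup>2 + 2 * s * ((z - p) \<bullet> b i) + s\<^sup>2)" for s
    proof -
      have "(norm (z + s *\<^sub>R b i - p))\<^sup>2 = ((z - p) + s *\<^sub>R b i) \<bullet> ((z - p) + s *\<^sub>R b i)"
        unfolding power2_norm_eq_inner by (simp add: algebra_simps)
      also have "\<dots> = (z - p) \<bullet> (z - p) + 2 * s * ((z - p) \<bullet> b i) + s\<^sup>2 * (b i \<bullet> b i)"
        unfolding inner_add_left inner_add_right inner_scaleR_left inner_scaleR_right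
          inner_commute[of "b i" "z - p"] power2_eq_square by (simp add: distrib_left)
      finally show ?thesis
        using orth[OF i i] by (simp add: w_def power2_norm_eq_inner)
    qed
    show "((\<lambda>s. w (z + s *\<^sub>R b i)) has_real_derivative
        u1 i (z + s *\<^sub>R b i) + e * (2 * ((z - p) \<bullet> b i) + 2 * s)) (at s)"
      if "\<bar>s\<bar> < r - dist p z" for s
      unfolding quad
      by (auto intro!: derivative_eq_intros has_dd_real_line[OF d1[OF in_ball[OF that] i]])
    have "has_dd (b i) (u1 i) (u2 i z) (z + 0 *\<^sub>R b i)"
      using d2[of z i] zb z(1) i by simp
    from has_dd_real_line[OF this]
    show "((\<lambda>s. u1 i (z + s *\<^sub>R b i) + e * (2 * ((z - p) \<bullet> b i) + 2 * s)) has_real_derivative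
        u2 i z + 2 * e) (at 0)"
      by (auto intro!: derivative_eq_intros)
    show "w (z + s *\<^sub>R b i) \<le> w (z + 0 *\<^sub>R b i)" if "\<bar>s\<bar> < r - dist p z" for s
      using z(2)[of "z + s *\<^sub>R b i"] in_ball[OF that] by auto
  qed
  then have "(\<Sum>i=0..m. u2 i z + 2 * e) \<le> 0"
    by (intro sum_nonpos) auto
  moreover have "(\<Sum>i=0..m. u2 i z + 2 * e) = 2 * e * (real m + 1)"
    using harmonic[of z] zb z(1) by (simp add: sum.distrib algebra_simps)
  moreover have "2 * e * (real m + 1) > 0" using e by simp
  ultimately show False by linarith
qed

section \<open>Harmonic polynomials and the Dirichlet problem on a sphere\<close>

lemma continuous_poly_fun: "poly_fun p \<Longrightarrow> continuous_on A p"
  by (induction rule: poly_fun.induct) (auto intro!: continuous_intros)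

definition hharm :: "nat \<Rightarrow> ('a \<Rightarrow> real) \<Rightarrow> bool" where
  "hharm d p \<longleftrightarrow> hpoly d p \<and> lap p = (\<lambda>x. 0)"

lemma hharmD:
  assumes "hharm d p"
  shows "hpoly d p" "lap p = (\<lambda>x. 0)" "poly_fun p"
  using assms hpoly_poly_fun by (auto simp: hharm_def)

text \<open>Sums of homogeneous pieces rather than all polynomials with vanishing Laplacian, because
  the correction in \<open>raise\<close> depends on the degree.\<close>

inductive harm :: "('a \<Rightarrow> real) \<Rightarrow> bool" where
  hharm: "hharm d p \<Longrightarrow> harm p"
| add: "harm p \<Longrightarrow> harm q \<Longrightarrow> harm (\<lambda>x. p x + q x)"

lemma harm_poly_fun: "harm p \<Longrightarrow> poly_fun p"
  by (induction rule: harm.induct) (auto simp: hharm_def intro: hpoly_poly_fun poly_fun.add)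

lemma harm_lap: "harm p \<Longrightarrow> lap p = (\<lambda>x. 0)"
  by (induction rule: harm.induct) (auto simp: hharm_def lap_add harm_poly_fun)

lemma hharm_scale: "hharm d p \<Longrightarrow> hharm d (\<lambda>x. c * p x)"
  using lap_scale[OF hpoly_poly_fun, of d p c] by (simp add: hharm_def hpoly_scale)

lemma hharm_const: "hharm 0 (\<lambda>x. c)"
  by (simp add: hharm_def hpoly.const lap_const)

lemma harm_scale: "harm p \<Longrightarrow> harm (\<lambda>x. c * p x)"
  by (induction rule: harm.induct) (auto simp: distrib_left intro: harm.intros hharm_scale)

lemma harm_diff: "harm p \<Longrightarrow> harm q \<Longrightarrow> harm (\<lambda>x. p x - q x)"
  using harm.add[OF _ harm_scale[of q "-1"], of p] by simp

lemma hharm_dd: "hharm d p \<Longrightarrow> hharm (d - 1) (partial_deriv w p)"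
  using hpoly_dd[of d p w] lap_dd[OF hpoly_poly_fun, of d p w] dd_const[of w "0::real"]
  unfolding hharm_def by metis

lemma hpoly_inner_S: "\<xi> \<in> S \<Longrightarrow> hpoly 1 (\<lambda>x. x \<bullet> \<xi>)"
proof -
  assume "\<xi> \<in> S"
  then have "x \<bullet> \<xi> = (\<Sum>i=0..m. (\<xi> \<bullet> b i) * (x \<bullet> b i))" for x
    by (subst S_expand[of \<xi>]) (simp_all add: inner_sum_right)
  then have "(\<lambda>x. x \<bullet> \<xi>) = (\<lambda>x. \<Sum>i=0..m. (\<xi> \<bullet> b i) * (x \<bullet> b i))"
    by auto
  then show ?thesis
    by (auto intro!: hpoly_sum hpoly_scale hpoly_inner[unfolded One_nat_def])
qed

text \<open>If \<open>p\<close> is harmonic and homogeneous of degree \<open>j\<close>, this is the harmonic summand of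
  \<open>(x \<bullet> \<xi>) * p x\<close>; for \<open>j = 0\<close>, where the denominator may vanish, the correction is zero anyway.\<close>

definition raise :: "'a \<Rightarrow> nat \<Rightarrow> ('a \<Rightarrow> real) \<Rightarrow> 'a \<Rightarrow> real" where
  "raise \<xi> j p x = (x \<bullet> \<xi>) * p x - (1 / (real m + 2 * real j - 1)) * (rho x * partial_deriv \<xi> p x)"

text \<open>The Laplacian of \<open>(x \<bullet> \<xi>) * p x\<close> is twice the derivative of
  \<open>p\<close> along \<xi>. That of \<open>rho\<close> times this derivative, which has degree
  \<open>j - 1\<close>, is the same derivative times 2 (m + 2 j - 1). The coefficient in
  \<open>raise\<close> makes the two cancel; for \<open>j = 0\<close> the derivative is
  zero.\<close>

lemma hharm_raise:
  assumes \<xi>: "\<xi> \<in> S" and p: "hharm j p"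
  shows "hharm (Suc j) (raise \<xi> j p)"
proof -
  let ?c = "1 / (real m + 2 * real j - 1)"
  have hp: "hpoly j p" "poly_fun p" and lp: "lap p = (\<lambda>x. 0)"
    using p by (auto dest: hharmD)
  have hd: "hpoly (j - 1) (partial_deriv \<xi> p)" and dz: "j = 0 \<Longrightarrow> partial_deriv \<xi> p = (\<lambda>x. 0)"
    using hpoly_dd[OF hp(1)] by auto
  have lin: "hpoly 1 (\<lambda>x. x \<bullet> \<xi>)" using \<xi> by (rule hpoly_inner_S)
  have "hpoly (Suc j) (\<lambda>x. rho x * partial_deriv \<xi> p x)"
    using hpoly_mult[OF hpoly_rho hd] dz hpoly_zero by (cases j) auto
  then have "hpoly (Suc j) (raise \<xi> j p)"
    unfolding raise_def using hpoly_mult[OF lin hp(1)] by (intro hpoly_diff hpoly_scale) auto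
  moreover have "lap (raise \<xi> j p) = (\<lambda>x. 0)"
  proof
    fix x
    have "lap (\<lambda>x. x \<bullet> \<xi>) = (\<lambda>x. 0)" unfolding lap_def dd_inner dd_const by simp
    moreover have "(\<Sum>i=0..m. pd i (\<lambda>x. x \<bullet> \<xi>) x * pd i p x) = partial_deriv \<xi> p x"
      unfolding dd_chain[OF hp(2), of \<xi>] dd_inner by (simp add: inner_commute)
    ultimately have 1: "lap (\<lambda>x. (x \<bullet> \<xi>) * p x) x = 2 * partial_deriv \<xi> p x"
      using lap_mult[OF hpoly_poly_fun[OF lin] hp(2)] lp by simp
    have 2: "lap (\<lambda>x. rho x * partial_deriv \<xi> p x) x
        = 2 * (real m + 1 + 2 * real (j - 1)) * partial_deriv \<xi> p x"
      using lap_rho_mult[OF hd] hp lp by (simp add: lap_dd dd_const)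
    have "?c * (2 * (real m + 1 + 2 * real (j - 1)) * partial_deriv \<xi> p x) = 2 * partial_deriv \<xi> p x"
    proof (cases j)
      case 0
      then show ?thesis using dz by simp
    next
      case (Suc k)
      define a where "a = real m + 1 + 2 * real k"
      have "a > 0" by (simp add: a_def)
      moreover have "real m + 2 * real j - 1 = a" "real m + 1 + 2 * real (j - 1) = a"
        using Suc by (simp_all add: a_def)
      ultimately show ?thesis by simp
    qed
    moreover have "lap (raise \<xi> j p) x = lap (\<lambda>x. (x \<bullet> \<xi>) * p x) x
        - ?c * lap (\<lambda>x. rho x * partial_deriv \<xi> p x) x"
      unfolding raise_def
      using hpoly_poly_fun[OF lin] hp(2)
      by (simp only: lap_diff lap_scale poly_fun_mult poly_fun_scale poly_fun_rho poly_fun_partial_deriv)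
    ultimately show "lap (raise \<xi> j p) x = 0" using 1 2 by simp
  qed
  ultimately show ?thesis by (simp add: hharm_def)
qed

text \<open>On the level set \<open>rho x = R\<close>, where \<open>R\<close> is a squared radius,
  the term subtracted in \<open>raise\<close> is a constant times a derivative of \<open>p\<close>,
  hence agrees with a harmonic polynomial; adding it back recovers the product.\<close>

lemma harm_coord_mult:
  assumes "i \<le> m"
  shows "harm u \<Longrightarrow> \<exists>w. harm w \<and> (\<forall>x. rho x = R \<longrightarrow> w x = (x \<bullet> b i) * u x)"
proof (induction rule: harm.induct)
  case (hharm d p)
  let ?w = "\<lambda>x. raise (b i) d p x + (R / (real m + 2 * real d - 1)) * pd i p x"
  have "harm ?w"
    using hharm_raise[OF b_in_S[OF assms] hharm] hharm_dd[OF hharm]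
    by (intro harm.add harm_scale) (auto intro: harm.hharm)
  then show ?case by (intro exI[of _ ?w]) (auto simp: raise_def)
next
  case (add p q)
  then obtain w w' where "harm w" "\<forall>x. rho x = R \<longrightarrow> w x = (x \<bullet> b i) * p x"
    "harm w'" "\<forall>x. rho x = R \<longrightarrow> w' x = (x \<bullet> b i) * q x" by blast
  then show ?case
    by (intro exI[of _ "\<lambda>x. w x + w' x"]) (auto intro: harm.add simp: distrib_left)
qed

text \<open>On a sphere, multiplication by a coordinate preserves restrictions of harmonic polynomials,
  by the splitting in \<open>raise\<close>; so polynomial boundary values have harmonic polynomial extensions.\<close>

theorem dirichlet_poly: "poly_fun g \<Longrightarrow> \<exists>u. harm u \<and> (\<forall>x. rho x = R \<longrightarrow> u x = g x)"
proof (induction rule: poly_fun.induct)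
  case (const c)
  then show ?case using harm.hharm[OF hharm_const] by blast
next
  case (coord p i)
  then obtain u where u: "harm u" "\<forall>x. rho x = R \<longrightarrow> u x = p x" by blast
  with harm_coord_mult[OF coord(2) u(1), of R] show ?case by metis
next
  case (add p q)
  then obtain u u' where "harm u" "\<forall>x. rho x = R \<longrightarrow> u x = p x"
    "harm u'" "\<forall>x. rho x = R \<longrightarrow> u' x = q x" by blast
  then show ?case
    by (intro exI[of _ "\<lambda>x. u x + u' x"]) (auto intro: harm.add)
qed

section \<open>Spherical means of polynomials\<close>

lemma harm_max_principle:
  assumes "poly_fun u" "lap u = (\<lambda>x. 0)" "p \<in> S" "\<And>x. x \<in> sphere p r \<inter> S \<Longrightarrow> u x \<le> c"
    "x \<in> cball p r \<inter> S"
  shows "u x \<le> c"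
proof (rule max_principle)
  show "has_dd (b i) u (pd i u x) x" "has_dd (b i) (pd i u) (pd i (pd i u) x) x" for i x
    using assms(1) by (simp_all add: poly_fun_has_dd poly_fun_partial_deriv)
  show "(\<Sum>i=0..m. pd i (pd i u) x) = 0" for x
    using assms(2) unfolding lap_def by metis
qed (use assms continuous_poly_fun in auto)

text \<open>The mean value of a polynomial over the unit sphere, encoded without integration as the value
  at the centre of the harmonic extension.  Positivity comes from the maximum principle.\<close>

definition mean :: "('a \<Rightarrow> real) \<Rightarrow> real" where
  "mean g = (THE c. \<exists>u. harm u \<and> (\<forall>x\<in>S. norm x = 1 \<longrightarrow> u x = g x) \<and> c = u 0)"

lemma harm_0_le:
  assumes "harm u" "\<And>x. x \<in> S \<Longrightarrow> norm x = 1 \<Longrightarrow> u x \<le> c"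
  shows "u 0 \<le> c"
proof (rule harm_max_principle)
  show "u x \<le> c" if "x \<in> sphere 0 1 \<inter> S" for x
    using that assms(2)[of x] by simp
qed (use assms(1) in \<open>auto simp: harm_poly_fun harm_lap span_zero\<close>)

lemma mean_eq:
  assumes "harm u" "\<And>x. x \<in> S \<Longrightarrow> norm x = 1 \<Longrightarrow> u x = g x"
  shows "mean g = u 0"
  unfolding mean_def
proof (rule the_equality)
  show "\<exists>u'. harm u' \<and> (\<forall>x\<in>S. norm x = 1 \<longrightarrow> u' x = g x) \<and> u 0 = u' 0"
    using assms by blast
next
  fix c assume "\<exists>u. harm u \<and> (\<forall>x\<in>S. norm x = 1 \<longrightarrow> u x = g x) \<and> c = u 0"
  then obtain u' where u': "harm u'" "\<forall>x\<in>S. norm x = 1 \<longrightarrow> u' x = g x" "c = u' 0" by blast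
  have "u 0 - u' 0 \<le> 0" "u' 0 - u 0 \<le> 0"
    using harm_0_le[OF harm_diff[OF assms(1) u'(1)], of 0]
      harm_0_le[OF harm_diff[OF u'(1) assms(1)], of 0] assms(2) u'(2) by auto
  then show "c = u 0" using u'(3) by simp
qed

lemma mean_ex: "poly_fun g \<Longrightarrow> \<exists>u. harm u \<and> (\<forall>x\<in>S. norm x = 1 \<longrightarrow> u x = g x)"
  using dirichlet_poly[of g 1] rho_S by (metis power_one)

lemma mean_le:
  assumes "poly_fun g" "\<And>x. x \<in> S \<Longrightarrow> norm x = 1 \<Longrightarrow> g x \<le> c"
  shows "mean g \<le> c"
proof -
  obtain u where "harm u" "\<forall>x\<in>S. norm x = 1 \<longrightarrow> u x = g x"
    using mean_ex assms(1) by blast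
  then show ?thesis using mean_eq[of u g] harm_0_le[of u c] assms(2) by simp
qed

lemma mean_add: "poly_fun f \<Longrightarrow> poly_fun g \<Longrightarrow> mean (\<lambda>x. f x + g x) = mean f + mean g"
proof -
  assume "poly_fun f" "poly_fun g"
  then obtain u w where "harm u" "\<forall>x\<in>S. norm x = 1 \<longrightarrow> u x = f x"
    "harm w" "\<forall>x\<in>S. norm x = 1 \<longrightarrow> w x = g x"
    using mean_ex by metis
  then show ?thesis
    using mean_eq[of u f] mean_eq[of w g] mean_eq[OF harm.add, of u w "\<lambda>x. f x + g x"] by auto
qed

lemma mean_scale: "poly_fun f \<Longrightarrow> mean (\<lambda>x. c * f x) = c * mean f"
proof -
  assume "poly_fun f"
  then obtain u where "harm u" "\<forall>x\<in>S. norm x = 1 \<longrightarrow> u x = f x"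
    using mean_ex by metis
  then show ?thesis
    using mean_eq[of u f] mean_eq[OF harm_scale[of u c], of "\<lambda>x. c * f x"] by auto
qed

lemma mean_diff: "poly_fun f \<Longrightarrow> poly_fun g \<Longrightarrow> mean (\<lambda>x. f x - g x) = mean f - mean g"
  using mean_add[OF _ poly_fun_scale[of g "-1"], of f] mean_scale[of g "-1"] by simp

lemma mean_harm: "harm u \<Longrightarrow> mean u = u 0"
  by (rule mean_eq) auto

lemma mean_zero: "mean (\<lambda>x. 0) = 0"
  using mean_harm[OF harm.hharm[OF hharm_const]] by simp

lemma mean_sum: "finite A \<Longrightarrow> (\<And>i. i \<in> A \<Longrightarrow> poly_fun (f i)) \<Longrightarrow>
    mean (\<lambda>x. \<Sum>i\<in>A. f i x) = (\<Sum>i\<in>A. mean (f i))"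
  by (induction A rule: finite_induct) (auto simp: mean_zero mean_add poly_fun_sum)

lemma mean_cong:
  assumes "\<And>x. x \<in> S \<Longrightarrow> norm x = 1 \<Longrightarrow> f x = g x"
  shows "mean f = mean g"
  unfolding mean_def using assms by (metis (no_types, lifting))

lemma mean_nonneg: "poly_fun g \<Longrightarrow> (\<And>x. 0 \<le> g x) \<Longrightarrow> 0 \<le> mean g"
  using mean_le[OF poly_fun_scale[of g "-1"], of 0] mean_scale[of g "-1"] by simp

text \<open>The mean of \<open>(Z x - s * h x)\<close> squared is nonnegative for every
  \<open>s\<close>. With the mean of the square of \<open>h\<close> replaced by its bound
  \<open>c\<^sup>2\<close>, the optimal choice \<open>s = ?B / c\<^sup>2\<close> gives the
  inequality.\<close>

lemma mean_cauchy_schwarz: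
  assumes Z: "poly_fun Z" and h: "poly_fun h"
    and bd: "\<And>x. x \<in> S \<Longrightarrow> norm x = 1 \<Longrightarrow> \<bar>h x\<bar> \<le> c"
  shows "(mean (\<lambda>x. Z x * h x))\<^sup>2 \<le> mean (\<lambda>x. Z x * Z x) * c\<^sup>2"
proof -
  let ?A = "mean (\<lambda>x. Z x * Z x)" and ?B = "mean (\<lambda>x. Z x * h x)"
  have pf: "poly_fun (\<lambda>x. Z x * Z x)" "poly_fun (\<lambda>x. Z x * h x)" "poly_fun (\<lambda>x. h x * h x)"
    using Z h by (auto intro: poly_fun_mult)
  have hh: "mean (\<lambda>x. h x * h x) \<le> c\<^sup>2"
    using pf(3) bd by (intro mean_le) (auto simp flip: power2_eq_square simp: abs_le_square_iff
      power2_abs intro!: power2_le_iff_abs_le[THEN iffD2] order_trans[OF abs_ge_zero bd])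
  have key: "0 \<le> ?A - 2 * s * ?B + s\<^sup>2 * c\<^sup>2" for s
  proof -
    have "0 \<le> mean (\<lambda>x. (Z x - s * h x) * (Z x - s * h x))"
      using Z h by (intro mean_nonneg poly_fun_mult poly_fun_diff poly_fun_scale) auto
    also have "(\<lambda>x. (Z x - s * h x) * (Z x - s * h x))
        = (\<lambda>x. (Z x * Z x - (2 * s) * (Z x * h x)) + s\<^sup>2 * (h x * h x))"
      by (auto simp: algebra_simps power2_eq_square)
    also have "mean \<dots> = ?A - 2 * s * ?B + s\<^sup>2 * mean (\<lambda>x. h x * h x)"
      using pf by (simp add: mean_add mean_diff mean_scale poly_fun_diff poly_fun_scale)
    also have "\<dots> \<le> ?A - 2 * s * ?B + s\<^sup>2 * c\<^sup>2"
      using hh by (simp add: mult_left_mono)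
    finally show ?thesis .
  qed
  show ?thesis
  proof (cases "c = 0")
    case True
    then have "?B = mean (\<lambda>x. 0)"
      using bd by (intro mean_cong) auto
    then show ?thesis using True by (simp add: mean_zero)
  next
    case False
    have "0 \<le> (?A - 2 * (?B / c\<^sup>2) * ?B + (?B / c\<^sup>2)\<^sup>2 * c\<^sup>2) * c\<^sup>2"
      using key[of "?B / c\<^sup>2"] by simp
    also have "\<dots> = ?A * c\<^sup>2 - ?B\<^sup>2"
      using False by (simp add: field_simps power2_eq_square)
    finally show ?thesis by simp
  qed
qed

section \<open>Orthogonality of degrees and zonal harmonics\<close>

lemma mean_inner_mult:
  assumes \<xi>: "\<xi> \<in> S" and p: "hharm j p" and g: "poly_fun g"
  shows "mean (\<lambda>x. (x \<bullet> \<xi>) * g x * p x) = mean (\<lambda>x. g x * raise \<xi> j p x)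
    + (1 / (real m + 2 * real j - 1)) * mean (\<lambda>x. g x * partial_deriv \<xi> p x)"
proof -
  let ?c = "1 / (real m + 2 * real j - 1)"
  have pf: "poly_fun (raise \<xi> j p)" "poly_fun (partial_deriv \<xi> p)"
    using hharm_raise[OF \<xi> p] hharm_dd[OF p, of \<xi>] by (auto dest: hharmD)
  have "mean (\<lambda>x. (x \<bullet> \<xi>) * g x * p x)
      = mean (\<lambda>x. g x * raise \<xi> j p x + ?c * (g x * partial_deriv \<xi> p x))"
    by (intro mean_cong) (simp add: raise_def rho_S algebra_simps)
  also have "\<dots> = mean (\<lambda>x. g x * raise \<xi> j p x) + ?c * mean (\<lambda>x. g x * partial_deriv \<xi> p x)"
    using g pf by (simp only: mean_add mean_scale poly_fun_mult poly_fun_scale)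
  finally show ?thesis .
qed

text \<open>A coordinate factor of \<open>g\<close> is moved onto \<open>p\<close>, where it splits
  into harmonic parts of degrees \<open>j + 1\<close> and \<open>j - 1\<close>. The degree of
  \<open>g\<close> drops by one and so stays below both. In the end a constant is paired with a
  harmonic polynomial of positive degree, whose value at 0 is 0.\<close>

lemma mean_orthogonal:
  "hpoly d g \<Longrightarrow> hharm j p \<Longrightarrow> d < j \<Longrightarrow> mean (\<lambda>x. g x * p x) = 0"
proof (induction arbitrary: j p rule: hpoly.induct)
  case (const c)
  then have "mean (\<lambda>x. c * p x) = c * p 0"
    by (intro mean_harm harm_scale harm.hharm)
  then show ?case
    using const hpoly_at_0[of j p] by (simp add: hharm_def)
next
  case (coord d g i)
  have bi: "b i \<in> S" using coord by (simp add: b_in_S)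
  have "mean (\<lambda>x. g x * raise (b i) j p x) = 0"
    using coord by (intro coord.IH[of "Suc j"] hharm_raise bi) auto
  moreover have "mean (\<lambda>x. g x * pd i p x) = 0"
    using coord by (intro coord.IH[of "j - 1"] hharm_dd) auto
  ultimately show ?case
    using mean_inner_mult[OF bi coord.prems(1), of g] coord by (simp add: hpoly_poly_fun)
next
  case (add d f g)
  have p: "poly_fun p" using add.prems(1) by (rule hharmD)
  have "mean (\<lambda>x. (f x + g x) * p x) = mean (\<lambda>x. f x * p x + g x * p x)"
    by (simp add: distrib_right)
  then show ?case
    using add p by (simp add: mean_add poly_fun_mult hpoly_poly_fun)
qed

text \<open>The zonal harmonic with pole \<xi>, scaled so that it arises from the constant 1 by
  repeated \<open>raise\<close>; no closed Gegenbauer formula is involved.\<close>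

fun zonal :: "'a \<Rightarrow> nat \<Rightarrow> 'a \<Rightarrow> real" where
  "zonal \<xi> 0 = (\<lambda>x. 1)"
| "zonal \<xi> (Suc k) = raise \<xi> k (zonal \<xi> k)"

text \<open>The constant in the reproducing property of \<open>zonal\<close>. The ratio of
  consecutive values is the factor k + 1 from Euler's identity over the denominator m + 2 (k + 1) -
  1 of \<open>raise\<close>.\<close>

fun zonal_norm :: "nat \<Rightarrow> real" where
  "zonal_norm 0 = 1"
| "zonal_norm (Suc k) = zonal_norm k * (real k + 1) / (real m + 1 + 2 * real k)"

lemma hharm_zonal: "\<xi> \<in> S \<Longrightarrow> hharm k (zonal \<xi> k)"
  by (induction k) (auto intro: hharm_const hharm_raise)

lemma zonal_norm_pos: "zonal_norm k > 0"
  by (induction k) auto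

text \<open>After one step of the recursion for \<open>zonal\<close>, orthogonality removes the
  derivative of the zonal function, whose degree is too low. Once \<open>x \<bullet> \<xi>\<close>
  has been moved onto \<open>p\<close>, it also removes the part of degree k + 2. What is left pairs
  \<open>zonal \<xi> k\<close> with the derivative of \<open>p\<close> along \<xi>, whose value at
  \<xi> is known from Euler's identity.\<close>

theorem mean_zonal:
  assumes \<xi>: "\<xi> \<in> S"
  shows "hharm k p \<Longrightarrow> mean (\<lambda>x. zonal \<xi> k x * p x) = zonal_norm k * p \<xi>"
proof (induction k arbitrary: p)
  case 0
  then show ?case
    using mean_harm[OF harm.hharm[OF 0]] hpoly_0_const[of p 0 \<xi>] by (simp add: hharm_def)
next
  case (Suc k)
  let ?Z = "zonal \<xi> k" and ?c = "1 / (real m + 2 * real k - 1)"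
  have Z: "hharm k ?Z" "poly_fun ?Z" "hpoly k ?Z"
    using hharm_zonal[OF \<xi>] by (auto dest: hharmD)
  have p: "poly_fun p" using Suc.prems by (rule hharmD)
  have lin: "poly_fun (\<lambda>x. x \<bullet> \<xi>)" using \<xi> hpoly_inner_S hpoly_poly_fun by blast
  have "mean (\<lambda>x. zonal \<xi> (Suc k) x * p x)
      = mean (\<lambda>x. (x \<bullet> \<xi>) * ?Z x * p x - ?c * (partial_deriv \<xi> ?Z x * p x))"
    by (intro mean_cong) (simp add: raise_def rho_S algebra_simps)
  also have "\<dots> = mean (\<lambda>x. (x \<bullet> \<xi>) * ?Z x * p x) - ?c * mean (\<lambda>x. partial_deriv \<xi> ?Z x * p x)"
    using Z p lin by (simp only: mean_diff mean_scale poly_fun_mult poly_fun_scale poly_fun_partial_deriv)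
  also have "mean (\<lambda>x. partial_deriv \<xi> ?Z x * p x) = 0"
    using hharm_dd[OF Z(1), of \<xi>] Suc.prems by (intro mean_orthogonal) (auto simp: hharm_def)
  also have "mean (\<lambda>x. (x \<bullet> \<xi>) * ?Z x * p x) = mean (\<lambda>x. ?Z x * raise \<xi> (Suc k) p x)
      + (1 / (real m + 2 * real (Suc k) - 1)) * mean (\<lambda>x. ?Z x * partial_deriv \<xi> p x)"
    using mean_inner_mult[OF \<xi> Suc.prems Z(2)] .
  also have "mean (\<lambda>x. ?Z x * raise \<xi> (Suc k) p x) = 0"
    using hharm_raise[OF \<xi> Suc.prems] Z by (intro mean_orthogonal) auto
  also have "mean (\<lambda>x. ?Z x * partial_deriv \<xi> p x) = zonal_norm k * partial_deriv \<xi> p \<xi>"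
    using hharm_dd[OF Suc.prems, of \<xi>] by (intro Suc.IH) simp
  also have "partial_deriv \<xi> p \<xi> = (real k + 1) * p \<xi>"
    using hpoly_dd_self[of "Suc k" p \<xi>] Suc.prems by (simp add: hharm_def)
  finally show ?case by (simp add: algebra_simps add_divide_distrib)
qed

text \<open>The binomial coefficient is the number of monomials of degree \<open>k\<close> in m + 1
  variables. Both sides are followed from \<open>k\<close> to \<open>k + 1\<close>, and only their
  growth factors are compared.\<close>

lemma zonal_at_pole:
  assumes \<xi>: "\<xi> \<in> S" "norm \<xi> = 1"
  shows "0 \<le> zonal \<xi> k \<xi> \<and> zonal \<xi> k \<xi> \<le> real (k + m choose m) * zonal_norm k"
proof (induction k)
  case (Suc k)
  let ?z = "zonal \<xi> k \<xi>" and ?q = "1 - real k / (real m + 2 * real k - 1)"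
  have "partial_deriv \<xi> (zonal \<xi> k) \<xi> = real k * ?z"
    using hharm_zonal[OF \<xi>(1), of k] by (simp add: hharm_def hpoly_dd_self)
  moreover have "rho \<xi> = 1" "\<xi> \<bullet> \<xi> = 1"
    using rho_S[OF \<xi>(1)] \<xi>(2) power2_norm_eq_inner[of \<xi>] by simp_all
  ultimately have eq: "zonal \<xi> (Suc k) \<xi> = ?z * ?q"
    by (simp add: raise_def algebra_simps)
  \<comment> \<open>The case \<open>k = 0\<close> is separate since the denominator m - 1 need not
    be positive; there \<open>?q\<close> is 1.\<close>
  have q: "0 \<le> ?q \<and> ?q * (real m + 1 + 2 * real k) \<le> real m + 1 + real k"
  proof (cases "k = 0")
    case False
    then have pos: "real m + 2 * real k - 1 > 0" and k: "real k \<ge> 1" by auto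
    have "?q = (real m + real k - 1) / (real m + 2 * real k - 1)"
      using pos by (simp add: field_simps)
    moreover have "(real m + real k - 1) * (real m + 1 + 2 * real k)
        \<le> (real m + 1 + real k) * (real m + 2 * real k - 1)"
      by (simp add: algebra_simps)
    ultimately show ?thesis using pos k by (simp add: divide_le_eq)
  qed auto
  have "real (Suc k + m choose m) * (real k + 1) = real (k + m choose m) * (real m + 1 + real k)"
  proof -
    have "Suc (k + m) * (k + m choose k) = (Suc (k + m) choose Suc k) * Suc k"
      by (rule Suc_times_binomial_eq)
    moreover have "(k + m choose k) = (k + m choose m)" "(Suc (k + m) choose Suc k) = (Suc k + m choose m)"
      using binomial_symmetric[of m "k + m"] binomial_symmetric[of m "Suc k + m"] by auto
    ultimately have "real (Suc (k + m)) * real (k + m choose m) = real (Suc k + m choose m) * real (Suc k)"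
      by (metis of_nat_mult)
    then show ?thesis by (simp add: algebra_simps)
  qed
  then have bin: "real (Suc k + m choose m) * zonal_norm (Suc k)
      = real (k + m choose m) * zonal_norm k * ((real m + 1 + real k) / (real m + 1 + 2 * real k))"
    by (simp only: zonal_norm.simps times_divide_eq_right mult.left_commute mult.assoc mult.commute)
  have "?q \<le> (real m + 1 + real k) / (real m + 1 + 2 * real k)"
    using q by (simp add: pos_le_divide_eq)
  then have "?z * ?q \<le> (real (k + m choose m) * zonal_norm k)
      * ((real m + 1 + real k) / (real m + 1 + 2 * real k))"
    using Suc.IH q by (intro mult_mono) auto
  then show ?case
    unfolding eq bin using Suc.IH q by auto
qed auto

theorem homogeneous_part_bound_unit:
  assumes H: "\<And>d. d \<le> n \<Longrightarrow> hharm d (H d)" and h: "\<And>x. h x = (\<Sum>d\<le>n. H d x)"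
    and bd: "\<And>x. x \<in> S \<Longrightarrow> norm x = 1 \<Longrightarrow> \<bar>h x\<bar> \<le> c"
    and k: "k \<le> n" and \<xi>: "\<xi> \<in> S" "norm \<xi> = 1"
  shows "\<bar>H k \<xi>\<bar> \<le> sqrt (real (k + m choose m)) * c"
proof -
  let ?Z = "zonal \<xi> k" and ?B = "real (k + m choose m)"
  have c: "c \<ge> 0" using bd[OF \<xi>] by simp
  have Z: "hharm k ?Z" "hpoly k ?Z" "poly_fun ?Z"
    using hharm_zonal[OF \<xi>(1)] by (auto dest: hharmD)
  have Hp: "poly_fun (H d)" "hpoly d (H d)" if "d \<le> n" for d
    using H[OF that] by (auto dest: hharmD)
  have "mean (\<lambda>x. ?Z x * h x) = mean (\<lambda>x. \<Sum>d\<le>n. ?Z x * H d x)"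
    by (simp add: h sum_distrib_left)
  also have "\<dots> = (\<Sum>d\<le>n. mean (\<lambda>x. ?Z x * H d x))"
    using Z Hp by (intro mean_sum poly_fun_mult) auto
  also have "\<dots> = (\<Sum>d\<le>n. if d = k then zonal_norm k * H k \<xi> else 0)"
  proof (intro sum.cong refl)
    fix d assume d: "d \<in> {..n}"
    consider "d = k" | "d < k" | "k < d" by linarith
    then show "mean (\<lambda>x. ?Z x * H d x) = (if d = k then zonal_norm k * H k \<xi> else 0)"
    proof cases
      case 1
      then show ?thesis using mean_zonal[OF \<xi>(1)] H d by simp
    next
      case 2
      then show ?thesis
        using mean_orthogonal[OF Hp(2) Z(1), of d] d by (simp add: mult.commute)
    next
      case 3
      then show ?thesis using mean_orthogonal[OF Z(2) H, of d] d by simp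
    qed
  qed
  also have "\<dots> = zonal_norm k * H k \<xi>" using k by simp
  finally have mZh: "mean (\<lambda>x. ?Z x * h x) = zonal_norm k * H k \<xi>" .
  have "poly_fun (\<lambda>x. \<Sum>d\<le>n. H d x)" using Hp by (intro poly_fun_sum) auto
  moreover have "h = (\<lambda>x. \<Sum>d\<le>n. H d x)" using h by auto
  ultimately have "poly_fun h" by simp
  from mean_cauchy_schwarz[OF Z(3) this bd]
  have "(zonal_norm k * H k \<xi>)\<^sup>2 \<le> mean (\<lambda>x. ?Z x * ?Z x) * c\<^sup>2"
    by (simp add: mZh)
  \<comment> \<open>The reproducing property is applied to the zonal function itself.\<close>
  also have "mean (\<lambda>x. ?Z x * ?Z x) = zonal_norm k * ?Z \<xi>"
    by (rule mean_zonal[OF \<xi>(1) Z(1)])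
  also have "\<dots> * c\<^sup>2 \<le> zonal_norm k * (?B * zonal_norm k) * c\<^sup>2"
    using zonal_at_pole[OF \<xi>, of k] zonal_norm_pos[of k] by (intro mult_right_mono mult_left_mono) auto
  finally have "(zonal_norm k)\<^sup>2 * (H k \<xi>)\<^sup>2 \<le> (zonal_norm k)\<^sup>2 * (?B * c\<^sup>2)"
    by (simp add: power2_eq_square algebra_simps)
  then have "(H k \<xi>)\<^sup>2 \<le> ?B * c\<^sup>2"
    using zonal_norm_pos[of k] by (simp add: mult_le_cancel_left)
  then have "sqrt ((H k \<xi>)\<^sup>2) \<le> sqrt (?B * c\<^sup>2)" by (rule real_sqrt_le_mono)
  then show ?thesis using c by (simp add: real_sqrt_mult)
qed

section \<open>Homogeneous decomposition and Taylor expansion of harmonic polynomials\<close>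

lemma poly_fun_decompose:
  "poly_fun p \<Longrightarrow> \<exists>n H. (\<forall>d. hpoly d (H d)) \<and> (\<forall>d>n. H d = (\<lambda>x. 0)) \<and> (\<forall>x. p x = (\<Sum>d\<le>n. H d x))"
proof (induction rule: poly_fun.induct)
  case (const c)
  show ?case
    by (rule exI[of _ 0], rule exI[of _ "\<lambda>d x. if d = 0 then c else 0"])
      (auto intro: hpoly.const hpoly_zero)
next
  case (coord p i)
  then obtain n H where H: "\<forall>d. hpoly d (H d)" "\<forall>d>n. H d = (\<lambda>x. 0)" "\<forall>x. p x = (\<Sum>d\<le>n. H d x)"
    by blast
  define G where "G d = (case d of 0 \<Rightarrow> (\<lambda>x. 0) | Suc e \<Rightarrow> (\<lambda>x. (x \<bullet> b i) * H e x))" for d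
  have "hpoly d (G d)" for d
    using H coord by (cases d) (auto simp: G_def hpoly_zero hpoly.coord)
  moreover have "G d = (\<lambda>x. 0)" if "d > Suc n" for d
    using H that by (cases d) (auto simp: G_def)
  moreover have "(x \<bullet> b i) * p x = (\<Sum>d\<le>Suc n. G d x)" for x
    using H(3) by (simp add: sum.atMost_Suc_shift G_def sum_distrib_left del: sum.atMost_Suc)
  ultimately show ?case by blast
next
  case (add p q)
  then obtain n H n' H' where H: "\<forall>d. hpoly d (H d)" "\<forall>d>n. H d = (\<lambda>x. 0)" "\<forall>x. p x = (\<Sum>d\<le>n. H d x)"
    and H': "\<forall>d. hpoly d (H' d)" "\<forall>d>n'. H' d = (\<lambda>x. 0)" "\<forall>x. q x = (\<Sum>d\<le>n'. H' d x)"
    by blast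
  have "(\<Sum>d\<le>n. H d x) = (\<Sum>d\<le>max n n'. H d x)" "(\<Sum>d\<le>n'. H' d x) = (\<Sum>d\<le>max n n'. H' d x)" for x
    using H(2) H'(2) by (auto intro!: sum.mono_neutral_left) (metis not_le)+
  then show ?case
    using H H' by (intro exI[of _ "max n n'"] exI[of _ "\<lambda>d x. H d x + H' d x"])
      (auto intro: hpoly.add simp: sum.distrib)
qed

text \<open>The Laplacian of the part of degree \<open>d\<close> scales like the power d - 2. After
  multiplication by \<open>s\<^sup>2\<close>, the vanishing total is a polynomial in
  \<open>s\<close> along each ray, so every coefficient is zero.\<close>

lemma hharm_components:
  assumes H: "\<And>d. hpoly d (H d)" and p: "\<And>x. p x = (\<Sum>d\<le>n. H d x)"
    and lap0: "lap p = (\<lambda>x. 0)" and k: "k \<le> n"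
  shows "hharm k (H k)"
proof -
  have pf: "poly_fun (H d)" for d using H hpoly_poly_fun by blast
  have "p = (\<lambda>x. \<Sum>d\<le>n. H d x)" using p by auto
  then have sum0: "(\<Sum>d\<le>n. lap (H d) y) = 0" for y
    using lap0 lap_sum[of "{..n}" H] pf by (metis)
  have hom: "s\<^sup>2 * lap (H d) (s *\<^sub>R x) = s ^ d * lap (H d) x" for s d x
  proof -
    have "H d (0 + s *\<^sub>R x) = s ^ d * H d x" for x
      using hpoly_homogeneous[OF H] by simp
    then have "lap (\<lambda>x. H d (0 + s *\<^sub>R x)) x = lap (\<lambda>x. s ^ d * H d x) x" by simp
    then show ?thesis
      by (simp only: lap_affine[OF pf] lap_scale[OF pf]) (simp add: power2_eq_square)
  qed
  have "lap (H k) x = 0" for x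
  proof -
    have "(\<Sum>d\<le>n. lap (H d) x * s ^ d) = 0" for s
    proof -
      have "(\<Sum>d\<le>n. lap (H d) x * s ^ d) = s\<^sup>2 * (\<Sum>d\<le>n. lap (H d) (s *\<^sub>R x))"
        unfolding sum_distrib_left hom by (simp add: mult.commute)
      then show ?thesis using sum0 by simp
    qed
    then show ?thesis
      using polyfun_eq_0[of "\<lambda>d. lap (H d) x" n] k by simp
  qed
  then show ?thesis using H by (auto simp: hharm_def)
qed

text \<open>In the second claim the direction and the point of evaluation coincide, so each
  derivative contributes one factor by Euler's identity.\<close>

lemma hpoly_iter_dd:
  assumes "hpoly d p"
  shows "k \<le> d \<Longrightarrow> hpoly (d - k) ((partial_deriv w ^^ k) p)"
    and "k \<le> d \<Longrightarrow> (partial_deriv x ^^ k) p x = (\<Prod>i<k. real (d - i)) * p x"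
    and "k > d \<Longrightarrow> (partial_deriv w ^^ k) p = (\<lambda>x. 0)"
proof -
  show 1: "k \<le> d \<Longrightarrow> hpoly (d - k) ((partial_deriv w ^^ k) p)" for k w
  proof (induction k)
    case (Suc k)
    then show ?case using hpoly_dd[of "d - k" "(partial_deriv w ^^ k) p" w] by simp
  qed (use assms in simp)
  show "k \<le> d \<Longrightarrow> (partial_deriv x ^^ k) p x = (\<Prod>i<k. real (d - i)) * p x" for k
  proof (induction k)
    case (Suc k)
    then show ?case using hpoly_dd_self[OF 1[of k x], of x] by (simp add: mult.commute mult.left_commute)
  qed simp
  show "k > d \<Longrightarrow> (partial_deriv w ^^ k) p = (\<lambda>x. 0)" for k
  proof (induction k)
    case (Suc k)
    show ?case
    proof (cases "k = d")
      case True
      then show ?thesis using hpoly_dd[OF 1[of d w], of w] by simp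
    next
      case False
      then show ?thesis using Suc by (simp add: dd_const)
    qed
  qed simp
qed

lemma poly_fun_iter_dd: "poly_fun p \<Longrightarrow> poly_fun ((partial_deriv w ^^ k) p)"
  by (induction k) (auto intro: poly_fun_partial_deriv)

lemma iter_dd_sum:
  assumes "\<And>i. i \<in> A \<Longrightarrow> poly_fun (f i)"
  shows "(partial_deriv w ^^ k) (\<lambda>x. \<Sum>i\<in>A. f i x) = (\<lambda>x. \<Sum>i\<in>A. (partial_deriv w ^^ k) (f i) x)"
  using assms by (induction k) (auto simp: dd_sum poly_fun_iter_dd)

lemma iter_dd_translate:
  assumes "poly_fun p"
  shows "(partial_deriv w ^^ k) (\<lambda>x. p (q + x)) = (\<lambda>x. (partial_deriv w ^^ k) p (q + x))"
proof (induction k)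
  case (Suc k)
  then show ?case
    using dd_affine[OF poly_fun_iter_dd[OF assms, of k w], of w q 1] by simp
qed simp

text \<open>The scaled derivative is the part of degree \<open>k\<close> of the polynomial
  \<open>h\<close> translated by \<open>q\<close>, evaluated at \<open>x\<close>. Hence the
  expansion is finite, and the bound is the one for the unit sphere after rescaling.\<close>

theorem harmonic_taylor:
  assumes h: "poly_fun h" "lap h = (\<lambda>x. 0)" and r: "r > 0" and x: "x \<in> S" and q: "q \<in> S"
    and bd: "\<And>y. y \<in> sphere q r \<inter> S \<Longrightarrow> \<bar>h y\<bar> \<le> c"
  shows "\<bar>(partial_deriv x ^^ k) h q / fact k\<bar> \<le> sqrt (real (k + m choose m)) * (norm x / r) ^ k * c"
    and "(\<lambda>k. (partial_deriv x ^^ k) h q / fact k) sums h (q + x)"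
proof -
  define g where "g = (\<lambda>x. h (q + x))"
  have g: "poly_fun g" "lap g = (\<lambda>x. 0)"
    using poly_fun_affine[OF h(1), of q 1] lap_affine[OF h(1), of q 1] h(2) by (simp_all add: g_def)
  obtain n H where H: "\<And>d. hpoly d (H d)" "\<And>d. d > n \<Longrightarrow> H d = (\<lambda>x. 0)" "\<And>x. g x = (\<Sum>d\<le>n. H d x)"
    using poly_fun_decompose[OF g(1)] by metis
  have Hh: "hharm d (H d)" if "d \<le> n" for d
    using hharm_components[OF H(1) H(3) g(2) that] .
  have pf: "poly_fun (H d)" for d using H hpoly_poly_fun by blast
  have deriv: "(partial_deriv x ^^ k) h q / fact k = H k x" for k
  proof -
    have "(partial_deriv x ^^ k) h q = (partial_deriv x ^^ k) g 0"
      unfolding g_def using iter_dd_translate[OF h(1)] by simp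
    also have "g = (\<lambda>x. \<Sum>d\<le>n. H d x)" using H(3) by auto
    also have "(partial_deriv x ^^ k) \<dots> 0 = (\<Sum>d\<le>n. (partial_deriv x ^^ k) (H d) 0)"
      using pf by (simp add: iter_dd_sum)
    \<comment> \<open>At 0 the parts of lower degree have been differentiated away, those of higher
      degree still vanish, and the part of degree \<open>k\<close> has become a constant.\<close>
    also have "\<dots> = (\<Sum>d\<le>n. if d = k then fact k * H k x else 0)"
    proof (intro sum.cong refl)
      fix d
      consider "d = k" | "k < d" | "d < k" by linarith
      then show "(partial_deriv x ^^ k) (H d) 0 = (if d = k then fact k * H k x else 0)"
      proof cases
        case 1
        have "(\<Prod>i<k. real (k - i)) = fact k"
          unfolding fact_prod_rev by (simp add: atLeast0LessThan)
        then show ?thesis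
          using 1 hpoly_iter_dd(1)[OF H(1), of k d x] hpoly_iter_dd(2)[OF H(1), of k d x]
            hpoly_0_const[of "(partial_deriv x ^^ k) (H d)" 0 x] by simp
      next
        case 2
        then show ?thesis
          using hpoly_at_0[OF hpoly_iter_dd(1)[OF H(1), of k d x]] by simp
      next
        case 3
        then show ?thesis using hpoly_iter_dd(3)[OF H(1), of d k x] by simp
      qed
    qed
    also have "\<dots> = fact k * H k x" using H(2)[of k] by auto
    finally show ?thesis by simp
  qed
  have c: "c \<ge> 0"
  proof -
    have "q + r *\<^sub>R b 0 \<in> sphere q r \<inter> S"
      using q r norm_b[of 0] b_in_S[of 0] by (auto simp: dist_norm intro: span_add span_scale)
    then show ?thesis using bd abs_ge_zero order_trans by blast
  qed
  show "(\<lambda>k. (partial_deriv x ^^ k) h q / fact k) sums h (q + x)"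
    unfolding deriv
    using sums_finite[of "{..n}" "\<lambda>k. H k x"] H(2,3) by (simp add: g_def)
  show "\<bar>(partial_deriv x ^^ k) h q / fact k\<bar> \<le> sqrt (real (k + m choose m)) * (norm x / r) ^ k * c"
  proof (cases "k \<le> n")
    case True
    \<comment> \<open>For \<open>x = 0\<close> any unit vector of the span serves, since only
      \<open>x = norm x *\<^sub>R \<xi>\<close> is used.\<close>
    define \<xi> where "\<xi> = (if x = 0 then b 0 else (1 / norm x) *\<^sub>R x)"
    have \<xi>: "\<xi> \<in> S" "norm \<xi> = 1" "x = norm x *\<^sub>R \<xi>"
      using x norm_b[of 0] b_in_S[of 0] by (auto simp: \<xi>_def span_scale)
    have "\<bar>r ^ k * H k \<xi>\<bar> \<le> sqrt (real (k + m choose m)) * c"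
    proof (rule homogeneous_part_bound_unit[where n = n and H = "\<lambda>d x. r ^ d * H d x"])
      show "hharm d (\<lambda>x. r ^ d * H d x)" if "d \<le> n" for d
        using Hh that hharm_scale by blast
      show "g (r *\<^sub>R x) = (\<Sum>d\<le>n. r ^ d * H d x)" for x
        using H(3) hpoly_homogeneous[OF H(1)] by simp
      show "\<bar>g (r *\<^sub>R x)\<bar> \<le> c" if "x \<in> S" "norm x = 1" for x
        unfolding g_def using that q r by (intro bd) (auto simp: dist_norm intro: span_add span_scale)
    qed (use True \<xi> in auto)
    moreover have "H k x = norm x ^ k * H k \<xi>"
      using hpoly_homogeneous[OF H(1)] \<xi>(3) by metis
    then have "H k x = (norm x / r) ^ k * (r ^ k * H k \<xi>)"
      using r by (simp add: power_divide)
    then have "\<bar>H k x\<bar> = (norm x / r) ^ k * \<bar>r ^ k * H k \<xi>\<bar>"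
      using r by (simp add: abs_mult)
    ultimately have "\<bar>H k x\<bar> \<le> (norm x / r) ^ k * (sqrt (real (k + m choose m)) * c)"
      using r by (metis mult_left_mono zero_le_divide_iff less_imp_le norm_ge_zero zero_le_power)
    then show ?thesis
      unfolding deriv by (simp add: mult_ac)
  next
    case False
    then show ?thesis
      unfolding deriv using H(2) c r by (auto intro!: mult_nonneg_nonneg divide_nonneg_pos)
  qed
qed

end

section \<open>Locally uniform limits of harmonic polynomials\<close>

text \<open>This is the binomial series of \<open>(1 - \<rho>) powr (- (real m + 1))\<close>,
  rewritten by negating the upper index.\<close>

lemma summable_binomial_power:
  fixes \<rho> :: real
  assumes "0 \<le> \<rho>" "\<rho> < 1"
  shows "summable (\<lambda>k. real (k + m choose m) * \<rho> ^ k)"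
proof -
  have "(\<lambda>k. ((- (real m + 1)) gchoose k) * (- \<rho>) ^ k) sums (1 + (- \<rho>)) powr (- (real m + 1))"
    using assms by (intro gen_binomial_real) auto
  moreover have "((- (real m + 1)) gchoose k) * (- \<rho>) ^ k = real (k + m choose m) * \<rho> ^ k" for k
  proof -
    have "((- (real m + 1)) gchoose k) = (- 1) ^ k * (real (k + m) gchoose k)"
      by (subst gbinomial_minus) (simp add: algebra_simps)
    also have "(real (k + m) gchoose k) = real (k + m choose m)"
      using binomial_symmetric[of m "k + m"] by (simp add: binomial_gbinomial)
    finally have "((- (real m + 1)) gchoose k) * (- \<rho>) ^ k
        = ((- 1) ^ k * (- 1) ^ k) * (real (k + m choose m) * \<rho> ^ k)"
      by (subst power_minus) (simp only: mult_ac)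
    then show ?thesis by (simp flip: power_mult_distrib)
  qed
  ultimately show ?thesis by (auto simp: sums_iff)
qed

context orthonormal_frame
begin

lemma openin_ball_S: "openin (top_of_set S) (ball p R \<inter> S)"
  by (auto simp: openin_open)

text \<open>The approximating sequence is an argument of the predicate, so that its derivatives can
  be named as the approximating sequence for the derivatives of \<open>f\<close>.\<close>

definition harm_limit :: "'a \<Rightarrow> real \<Rightarrow> (nat \<Rightarrow> 'a \<Rightarrow> real) \<Rightarrow> ('a \<Rightarrow> real) \<Rightarrow> bool" where
  "harm_limit p R h f \<longleftrightarrow> (\<forall>n. poly_fun (h n) \<and> lap (h n) = (\<lambda>x. 0)) \<and>
     (\<forall>r<R. uniform_limit (cball p r \<inter> S) h f sequentially)"

lemma harm_limit_cong:
  assumes "harm_limit p R h f" "\<And>x. x \<in> ball p R \<inter> S \<Longrightarrow> f x = g x"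
  shows "harm_limit p R h g"
proof -
  have "uniform_limit (cball p r \<inter> S) h g sequentially" if "r < R" for r
  proof -
    have "uniform_limit (cball p r \<inter> S) h f sequentially"
      using assms(1) that by (simp add: harm_limit_def)
    moreover have "f x = g x" if "x \<in> cball p r \<inter> S" for x
      using that \<open>r < R\<close> by (intro assms(2)) auto
    ultimately show ?thesis
      using uniform_limit_cong'[of "cball p r \<inter> S" h h f g sequentially] by simp
  qed
  then show ?thesis using assms(1) by (simp add: harm_limit_def)
qed

lemma harm_limit_tendsto:
  assumes "harm_limit p R h f" "x \<in> ball p R \<inter> S"
  shows "(\<lambda>n. h n x) \<longlonglongrightarrow> f x"
proof -
  have "uniform_limit (cball p (dist p x) \<inter> S) h f sequentially"
    using assms by (simp add: harm_limit_def)
  from tendsto_uniform_limitI[OF this] show ?thesis using assms(2) by simp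
qed

lemma harmonic_gradient_bound:
  assumes "poly_fun h" "lap h = (\<lambda>x. 0)" "r > 0" "w \<in> S" "q \<in> S"
    "\<And>y. y \<in> sphere q r \<inter> S \<Longrightarrow> \<bar>h y\<bar> \<le> c"
  shows "\<bar>partial_deriv w h q\<bar> \<le> sqrt (real (Suc m choose m)) * (norm w / r) * c"
  using harmonic_taylor(1)[OF assms, of 1] by simp

text \<open>A ball of radius \<open>r' - r\<close> about a point of the smaller ball lies in the
  larger one, so the gradient bound turns the uniform Cauchy property of \<open>h\<close> into that
  of its derivatives. One limit function serves all radii because it is given pointwise by
  \<open>lim\<close>.\<close>

lemma harm_limit_dd_limit:
  assumes p: "p \<in> S" and harm_limit: "harm_limit p R h f" and w: "w \<in> S"
  obtains g where "\<And>r. r < R \<Longrightarrow> uniform_limit (cball p r \<inter> S) (\<lambda>n. partial_deriv w (h n)) g sequentially"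
proof
  fix r assume r: "r < R"
  define r' where "r' = (r + R) / 2"
  have r': "r < r'" "r' < R" using r by (auto simp: r'_def)
  \<comment> \<open>The \<open>+ 1\<close> keeps \<open>C\<close> positive for \<open>w = 0\<close>
    and makes the final inequality strict.\<close>
  define C where "C = sqrt (real (Suc m choose m)) * (norm w / (r' - r)) + 1"
  have C: "C > 0" using r' by (auto simp: C_def intro!: add_nonneg_pos mult_nonneg_nonneg divide_nonneg_pos)
  have hn: "poly_fun (h n)" "lap (h n) = (\<lambda>x. 0)" for n
    using harm_limit by (auto simp: harm_limit_def)
  have "uniform_limit (cball p r' \<inter> S) h f sequentially"
    using harm_limit r' by (simp add: harm_limit_def)
  then have "uniformly_Cauchy_on (cball p r' \<inter> S) h"
    using uniformly_convergent_on_def uniformly_convergent_Cauchy by blast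
  have "uniformly_Cauchy_on (cball p r \<inter> S) (\<lambda>n. partial_deriv w (h n))"
    unfolding uniformly_Cauchy_on_def
  proof (intro allI impI)
    fix e :: real assume e: "e > 0"
    then obtain M where M: "\<And>x k n. x \<in> cball p r' \<inter> S \<Longrightarrow> k \<ge> M \<Longrightarrow> n \<ge> M \<Longrightarrow> dist (h k x) (h n x) < e / C"
      using \<open>uniformly_Cauchy_on (cball p r' \<inter> S) h\<close> C unfolding uniformly_Cauchy_on_def
      by (metis divide_pos_pos)
    have "dist (partial_deriv w (h k) x) (partial_deriv w (h n) x) < e"
      if x: "x \<in> cball p r \<inter> S" and kn: "k \<ge> M" "n \<ge> M" for x k n
    proof -
      have "\<bar>partial_deriv w (\<lambda>x. h k x - h n x) x\<bar>
          \<le> sqrt (real (Suc m choose m)) * (norm w / (r' - r)) * (e / C)"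
      proof (rule harmonic_gradient_bound)
        show "lap (\<lambda>x. h k x - h n x) = (\<lambda>x. 0)"
          using hn by (simp add: lap_diff)
        fix y assume y: "y \<in> sphere x (r' - r) \<inter> S"
        have "dist p y \<le> dist p x + dist x y" by (rule dist_triangle)
        then have "y \<in> cball p r' \<inter> S" using x y by auto
        from M[OF this kn] show "\<bar>h k y - h n y\<bar> \<le> e / C" by (simp add: dist_real_def)
      qed (use hn r' w x in \<open>auto intro: poly_fun_diff\<close>)
      also have "\<dots> < C * (e / C)"
        using e C by (intro mult_strict_right_mono) (auto simp: C_def)
      also have "\<dots> = e" using C by simp
      finally show ?thesis using hn by (simp add: dd_diff dist_real_def)
    qed
    then show "\<exists>M. \<forall>x\<in>cball p r \<inter> S. \<forall>k\<ge>M. \<forall>n\<ge>M.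
        dist (partial_deriv w (h k) x) (partial_deriv w (h n) x) < e"
      by blast
  qed
  then have "uniformly_convergent_on (cball p r \<inter> S) (\<lambda>n. partial_deriv w (h n))"
    by (rule Cauchy_uniformly_convergent)
  then show "uniform_limit (cball p r \<inter> S) (\<lambda>n. partial_deriv w (h n))
      (\<lambda>x. lim (\<lambda>n. partial_deriv w (h n) x)) sequentially"
    by (simp add: uniformly_convergent_uniform_limit_iff)
qed

text \<open>Uniform convergence of the derivatives along a segment through \<open>x\<close> makes
  the limit differentiable there. The derivative is again a limit of harmonic polynomials, so the
  step can be iterated.\<close>

lemma harm_limit_dd:
  assumes p: "p \<in> S" and harm_limit: "harm_limit p R h f" and w: "w \<in> S"
  shows "x \<in> ball p R \<inter> S \<Longrightarrow> has_dd w f (partial_deriv w f x) x"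
    and "harm_limit p R (\<lambda>n. partial_deriv w (h n)) (partial_deriv w f)"
proof -
  obtain g where g: "\<And>r. r < R \<Longrightarrow> uniform_limit (cball p r \<inter> S) (\<lambda>n. partial_deriv w (h n)) g sequentially"
    using harm_limit_dd_limit[OF assms] by blast
  have hn: "poly_fun (h n)" "lap (h n) = (\<lambda>x. 0)" for n
    using harm_limit by (auto simp: harm_limit_def)
  have dd: "has_dd w f (g x) x" if x: "x \<in> ball p R \<inter> S" for x
  proof -
    define r where "r = (dist p x + R) / 2"
    have r: "dist p x < r" "r < R" using x by (auto simp: r_def)
    \<comment> \<open>For \<open>s\<close> between -\<delta> and \<delta> the point
      \<open>x + s *\<^sub>R w\<close> stays in the closed ball of radius \<open>r\<close>;
      \<open>norm w + 1\<close> avoids a division by zero.\<close>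
    define \<delta> where "\<delta> = (r - dist p x) / (norm w + 1)"
    have \<delta>: "\<delta> > 0" using r by (auto simp: \<delta>_def intro!: divide_pos_pos add_nonneg_pos)
    define I where "I = {-\<delta><..<\<delta>}"
    have in_cball: "x + s *\<^sub>R w \<in> cball p r \<inter> S" if "s \<in> I" for s
    proof -
      have "\<bar>s\<bar> * norm w \<le> \<delta> * (norm w + 1)"
        using that by (intro mult_mono) (auto simp: I_def)
      also have "\<dots> = r - dist p x"
        unfolding \<delta>_def using add_nonneg_pos[of "norm w" 1] by simp
      finally have "dist x (x + s *\<^sub>R w) \<le> r - dist p x" by (simp add: dist_norm)
      moreover have "dist p (x + s *\<^sub>R w) \<le> dist p x + dist x (x + s *\<^sub>R w)" by (rule dist_triangle)
      ultimately show ?thesis using x w by (auto intro: span_add span_scale)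
    qed
    have "\<exists>G. \<forall>s\<in>I. (\<lambda>n. h n (x + s *\<^sub>R w)) \<longlonglongrightarrow> G s \<and>
        (G has_derivative (\<lambda>t. t * g (x + s *\<^sub>R w))) (at s within I)"
    proof (rule has_derivative_sequence)
      show "convex I" by (simp add: I_def)
      show "((\<lambda>s. h n (x + s *\<^sub>R w)) has_derivative (\<lambda>t. t * partial_deriv w (h n) (x + s *\<^sub>R w))) (at s within I)"
        for n s
      proof -
        have "has_dd w (h n) (partial_deriv w (h n) (x + s *\<^sub>R w)) (x + s *\<^sub>R w)"
          by (rule poly_fun_has_dd[OF hn(1)])
        from has_dd_line[OF this] show ?thesis
          by (auto simp: has_vector_derivative_def intro: has_derivative_at_withinI)
      qed
      show "\<forall>\<^sub>F n in sequentially. \<forall>s\<in>I. \<forall>t.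
          norm (t * partial_deriv w (h n) (x + s *\<^sub>R w) - t * g (x + s *\<^sub>R w)) \<le> e * norm t"
        if "e > 0" for e
        using uniform_limitD[OF g[OF r(2)] that]
      proof eventually_elim
        case (elim n)
        show ?case
        proof (intro ballI allI)
          fix s t assume "s \<in> I"
          then have "\<bar>partial_deriv w (h n) (x + s *\<^sub>R w) - g (x + s *\<^sub>R w)\<bar> \<le> e"
            using elim in_cball by (auto simp: dist_real_def intro: less_imp_le)
          then have "\<bar>t\<bar> * \<bar>partial_deriv w (h n) (x + s *\<^sub>R w) - g (x + s *\<^sub>R w)\<bar> \<le> \<bar>t\<bar> * e"
            by (intro mult_left_mono) auto
          then show "norm (t * partial_deriv w (h n) (x + s *\<^sub>R w) - t * g (x + s *\<^sub>R w)) \<le> e * norm t"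
            by (simp add: mult.commute flip: right_diff_distrib abs_mult)
        qed
      qed
      show "0 \<in> I" using \<delta> by (simp add: I_def)
      show "(\<lambda>n. h n (x + 0 *\<^sub>R w)) \<longlonglongrightarrow> f x"
        using harm_limit_tendsto[OF harm_limit x] by simp
    qed
    then obtain G where G: "\<And>s. s \<in> I \<Longrightarrow> (\<lambda>n. h n (x + s *\<^sub>R w)) \<longlonglongrightarrow> G s"
      "\<And>s. s \<in> I \<Longrightarrow> (G has_derivative (\<lambda>t. t * g (x + s *\<^sub>R w))) (at s within I)"
      by blast
    have "0 \<in> I" using \<delta> by (simp add: I_def)
    then have "(G has_derivative (\<lambda>t. t * g x)) (at 0)"
      using G(2)[of 0] at_within_open[of 0 I] by (simp add: I_def)
    then have "(G has_vector_derivative g x) (at 0)"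
      by (simp add: has_vector_derivative_def)
    then have "((\<lambda>s. f (x + s *\<^sub>R w)) has_vector_derivative g x) (at 0)"
    proof (rule has_vector_derivative_transform_within_open)
      show "open I" "0 \<in> I" using \<open>0 \<in> I\<close> by (auto simp: I_def)
      fix s assume s: "s \<in> I"
      have "x + s *\<^sub>R w \<in> ball p R \<inter> S" using in_cball[OF s] r by auto
      then show "G s = f (x + s *\<^sub>R w)"
        using LIMSEQ_unique[OF G(1)[OF s] harm_limit_tendsto[OF harm_limit]] by simp
    qed
    then show ?thesis by (simp add: has_dd_def)
  qed
  show "x \<in> ball p R \<inter> S \<Longrightarrow> has_dd w f (partial_deriv w f x) x" for x
    using dd has_dd_partial_deriv by metis
  have "harm_limit p R (\<lambda>n. partial_deriv w (h n)) g"
    using g hn by (auto simp: harm_limit_def poly_fun_partial_deriv lap_dd dd_const)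
  then show "harm_limit p R (\<lambda>n. partial_deriv w (h n)) (partial_deriv w f)"
    by (rule harm_limit_cong) (rule has_dd_partial_deriv[OF dd, symmetric])
qed

lemma harm_limit_iter_dd:
  assumes p: "p \<in> S" and harm_limit: "harm_limit p R h f" and w: "w \<in> S"
  shows "harm_limit p R (\<lambda>n. (partial_deriv w ^^ k) (h n)) ((partial_deriv w ^^ k) f)"
proof (induction k)
  case (Suc k)
  then show ?case using harm_limit_dd(2)[OF p Suc w] by simp
qed (use harm_limit in simp)

lemma harm_limit_taylor_bound:
  assumes p: "p \<in> S" and harm_limit: "harm_limit p R h f" and r: "0 < r" "r < R" and x: "x \<in> S"
    and bd: "\<And>y. y \<in> sphere p r \<inter> S \<Longrightarrow> \<bar>f y\<bar> \<le> c"
  shows "\<bar>(partial_deriv x ^^ k) f p / fact k\<bar> \<le> sqrt (real (k + m choose m)) * (norm x / r) ^ k * c"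
proof (rule field_le_epsilon)
  fix e :: real assume e: "e > 0"
  let ?A = "sqrt (real (k + m choose m)) * (norm x / r) ^ k"
  have A: "?A \<ge> 0" using r by simp
  \<comment> \<open>Late approximants are bounded by \<open>c + \<epsilon>\<close> on the sphere;
    this \<epsilon> makes the additional contribution \<open>?A * \<epsilon>\<close> at most
    \<open>e\<close>.\<close>
  define \<epsilon> where "\<epsilon> = e / (?A + 1)"
  have \<epsilon>: "\<epsilon> > 0" using e A by (simp add: \<epsilon>_def)
  have "?A * \<epsilon> \<le> (?A + 1) * \<epsilon>" using \<epsilon> by (simp add: distrib_right)
  also have "\<dots> = e" using A by (simp add: \<epsilon>_def)
  finally have Ae: "?A * \<epsilon> \<le> e" .
  have hn: "poly_fun (h n)" "lap (h n) = (\<lambda>x. 0)" for n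
    using harm_limit by (auto simp: harm_limit_def)
  have "p \<in> ball p R \<inter> S" using p r by auto
  then have "(\<lambda>n. \<bar>(partial_deriv x ^^ k) (h n) p / fact k\<bar>) \<longlonglongrightarrow> \<bar>(partial_deriv x ^^ k) f p / fact k\<bar>"
    by (intro tendsto_intros harm_limit_tendsto[OF harm_limit_iter_dd[OF p harm_limit x]]) auto
  moreover have "\<forall>\<^sub>F n in sequentially. \<bar>(partial_deriv x ^^ k) (h n) p / fact k\<bar> \<le> ?A * (c + \<epsilon>)"
  proof -
    have "uniform_limit (cball p r \<inter> S) h f sequentially"
      using harm_limit r by (simp add: harm_limit_def)
    from uniform_limitD[OF this \<epsilon>] show ?thesis
    proof eventually_elim
      case (elim n)
      show ?case
      proof (rule harmonic_taylor(1)[OF hn r(1) x p])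
        fix y assume y: "y \<in> sphere p r \<inter> S"
        then have "\<bar>h n y - f y\<bar> < \<epsilon>" using elim by (auto simp: dist_real_def)
        then show "\<bar>h n y\<bar> \<le> c + \<epsilon>" using bd[OF y] by linarith
      qed
    qed
  qed
  ultimately have "\<bar>(partial_deriv x ^^ k) f p / fact k\<bar> \<le> ?A * (c + \<epsilon>)"
    by (rule tendsto_upperbound) simp
  also have "\<dots> \<le> ?A * c + e" using Ae by (simp add: distrib_left)
  finally show "\<bar>(partial_deriv x ^^ k) f p / fact k\<bar> \<le> ?A * c + e" .
qed

lemma summable_sqrt_binomial_power:
  fixes \<rho> :: real
  assumes "0 \<le> \<rho>" "\<rho> < 1"
  shows "summable (\<lambda>k. sqrt (real (k + m choose m)) * \<rho> ^ k * c)"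
proof -
  have "summable (\<lambda>k. sqrt (real (k + m choose m)) * \<rho> ^ k)"
  proof (rule summable_comparison_test'[OF summable_binomial_power[OF assms, of m]])
    fix k
    have "1 \<le> real (k + m choose m)"
      by (simp add: Suc_le_eq)
    then have "sqrt (real (k + m choose m)) \<le> sqrt ((real (k + m choose m))\<^sup>2)"
      by (intro real_sqrt_le_mono self_le_power) auto
    then have "sqrt (real (k + m choose m)) \<le> real (k + m choose m)" by simp
    then show "norm (sqrt (real (k + m choose m)) * \<rho> ^ k) \<le> real (k + m choose m) * \<rho> ^ k"
      using assms by (simp add: abs_mult mult_right_mono)
  qed
  then show ?thesis by (rule summable_mult2)
qed

lemma harm_limit_bounded:
  assumes "harm_limit p R h f" "r < R"
  obtains c where "\<And>y. y \<in> cball p r \<inter> S \<Longrightarrow> \<bar>f y\<bar> \<le> c"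
proof -
  have "uniform_limit (cball p r \<inter> S) h f sequentially"
    using assms by (simp add: harm_limit_def)
  from uniform_limitD[OF this, of 1] obtain n where "\<forall>y\<in>cball p r \<inter> S. dist (h n y) (f y) < 1"
    unfolding eventually_sequentially by auto
  then have n: "dist (h n y) (f y) < 1" if "y \<in> cball p r \<inter> S" for y
    using that by blast
  have "compact (cball p r \<inter> S)"
    by (intro compact_Int_closed compact_cball closed_subspace subspace_span)
  then have "compact (h n ` (cball p r \<inter> S))"
    using assms(1) by (intro compact_continuous_image continuous_poly_fun) (auto simp: harm_limit_def)
  then obtain c where c: "\<forall>y\<in>cball p r \<inter> S. \<bar>h n y\<bar> \<le> c"
    by (auto dest!: compact_imp_bounded simp: bounded_iff)
  have "\<bar>f y\<bar> \<le> c + 1" if "y \<in> cball p r \<inter> S" for y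
    using n[OF that] bspec[OF c that] by (simp add: dist_real_def)
  then show ?thesis using that by blast
qed

text \<open>Each \<open>h n\<close> equals its own Taylor series. Tannery's theorem exchanges the
  limit in \<open>n\<close> with the sum over \<open>k\<close>; the majorant is the Taylor bound
  from an intermediate sphere, uniform for large \<open>n\<close>.\<close>

lemma harm_limit_taylor_sums:
  assumes p: "p \<in> S" and harm_limit: "harm_limit p R h f" and x: "x \<in> S" "norm x < R"
  shows "(\<lambda>k. (partial_deriv x ^^ k) f p / fact k) sums f (p + x)"
proof -
  define r where "r = (norm x + R) / 2"
  have "0 < R" using le_less_trans[OF norm_ge_zero x(2)] .
  then have r: "norm x < r" "0 < r" "r < R"
    using x(2) by (simp_all add: r_def add_nonneg_pos)
  have hn: "poly_fun (h n)" "lap (h n) = (\<lambda>x. 0)" for n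
    using harm_limit by (auto simp: harm_limit_def)
  obtain c where c: "\<And>y. y \<in> cball p r \<inter> S \<Longrightarrow> \<bar>f y\<bar> \<le> c"
    using harm_limit_bounded[OF harm_limit r(3)] by blast
  have pB: "p \<in> ball p R \<inter> S" "p + x \<in> ball p R \<inter> S"
    using p x r by (auto simp: dist_norm intro: span_add)
  let ?a = "\<lambda>k n. (partial_deriv x ^^ k) (h n) p / fact k"
  \<comment> \<open>\<open>c + 1\<close> bounds \<open>h n\<close> on the closed ball as soon as
    \<open>h n\<close> is within 1 of \<open>f\<close>.\<close>
  let ?M = "\<lambda>k. sqrt (real (k + m choose m)) * (norm x / r) ^ k * (c + 1)"
  have lim: "(\<lambda>n. ?a k n) \<longlonglongrightarrow> (partial_deriv x ^^ k) f p / fact k" for k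
    using pB by (intro tendsto_intros harm_limit_tendsto[OF harm_limit_iter_dd[OF p harm_limit x(1)]]) auto
  have "uniform_limit (cball p r \<inter> S) h f sequentially"
    using harm_limit r by (simp add: harm_limit_def)
  from uniform_limitD[OF this, of 1] obtain N where
    "\<forall>n\<ge>N. \<forall>y\<in>cball p r \<inter> S. dist (h n y) (f y) < 1"
    unfolding eventually_sequentially by auto
  then have N: "dist (h n y) (f y) < 1" if "n \<ge> N" "y \<in> cball p r \<inter> S" for n y
    using that by blast
  have bd: "\<bar>?a k n\<bar> \<le> ?M k" if "n \<ge> N" for k n
  proof (rule harmonic_taylor(1)[OF hn r(2) x(1) p])
    fix y assume "y \<in> sphere p r \<inter> S"
    then have "y \<in> cball p r \<inter> S" by auto
    then show "\<bar>h n y\<bar> \<le> c + 1" using N[OF that, of y] c[of y] by (auto simp: dist_real_def)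
  qed
  have "\<forall>\<^sub>F (k, n) in at_top \<times>\<^sub>F sequentially. norm (?a k n) \<le> ?M k"
    unfolding eventually_prod_filter
    by (rule exI[of _ "\<lambda>_. True"], rule exI[of _ "\<lambda>n. n \<ge> N"])
      (use bd in \<open>auto simp: eventually_ge_at_top\<close>)
  moreover have sM: "summable ?M"
    using x r by (intro summable_sqrt_binomial_power) auto
  ultimately have tan: "summable (\<lambda>k. norm ((partial_deriv x ^^ k) f p / fact k))"
    "(\<lambda>n. suminf (\<lambda>k. ?a k n)) \<longlonglongrightarrow> suminf (\<lambda>k. (partial_deriv x ^^ k) f p / fact k)"
    using tannerys_theorem[where a = ?a and M = ?M and F = sequentially, OF lim] by auto
  have "suminf (\<lambda>k. ?a k n) = h n (p + x)" for n
  proof -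
    obtain c' where "\<forall>y\<in>cball p r \<inter> S. \<bar>h n y\<bar> \<le> c'"
    proof -
      have "compact (cball p r \<inter> S)"
        by (intro compact_Int_closed compact_cball closed_subspace subspace_span)
      then have "compact (h n ` (cball p r \<inter> S))"
        using hn by (intro compact_continuous_image continuous_poly_fun)
      then show ?thesis
        using that by (auto dest!: compact_imp_bounded simp: bounded_iff)
    qed
    then show ?thesis
      using sums_unique[OF harmonic_taylor(2)[OF hn r(2) x(1) p, of n c']] by auto
  qed
  with tan(2) harm_limit_tendsto[OF harm_limit pB(2)]
  have "suminf (\<lambda>k. (partial_deriv x ^^ k) f p / fact k) = f (p + x)"
    using LIMSEQ_unique by auto
  then show ?thesis using tan(1) summable_norm_cancel by (metis sums_iff)
qed

text \<open>Quantifying over all \<open>w\<close>, and not only over a basis, allows the scalar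
  estimate to be tested in the direction of the very vector to be estimated, so that no dimensional
  factor appears.\<close>

definition vharm_limit :: "'a \<Rightarrow> real \<Rightarrow> ('a \<Rightarrow> 'c::euclidean_space) \<Rightarrow> bool" where
  "vharm_limit p R f \<longleftrightarrow> (\<forall>w. \<exists>h. harm_limit p R h (\<lambda>x. f x \<bullet> w))"

lemma vharm_limit_has_dd:
  assumes "p \<in> S" "vharm_limit p R f" "u \<in> S" "x \<in> ball p R \<inter> S"
  shows "has_dd u f (partial_deriv u f x) x"
proof -
  have "has_dd u (\<lambda>x. f x \<bullet> w) (partial_deriv u (\<lambda>x. f x \<bullet> w) x) x" for w
  proof -
    obtain h where "harm_limit p R h (\<lambda>x. f x \<bullet> w)" using assms(2) by (auto simp: vharm_limit_def)
    then show ?thesis using harm_limit_dd(1)[OF assms(1) _ assms(3,4)] by blast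
  qed
  then have "has_dd u (\<lambda>x. \<Sum>e\<in>Basis. (f x \<bullet> e) *\<^sub>R e)
      (\<Sum>e\<in>Basis. partial_deriv u (\<lambda>x. f x \<bullet> e) x *\<^sub>R e) x"
    by (intro has_dd_sum has_dd_bounded_linear[OF bounded_linear_scaleR_left])
  then have "has_dd u f (\<Sum>e\<in>Basis. partial_deriv u (\<lambda>x. f x \<bullet> e) x *\<^sub>R e) x"
    by (simp add: euclidean_representation)
  then show ?thesis using has_dd_partial_deriv by metis
qed

lemma vharm_limit_dd_inner:
  assumes "p \<in> S" "vharm_limit p R f" "u \<in> S" "x \<in> ball p R \<inter> S"
  shows "partial_deriv u (\<lambda>x. f x \<bullet> w) x = partial_deriv u f x \<bullet> w"
  using has_dd_bounded_linear[OF bounded_linear_inner_left vharm_limit_has_dd[OF assms]]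
  by (rule has_dd_partial_deriv)

lemma vharm_limit_dd:
  assumes "p \<in> S" "vharm_limit p R f" "u \<in> S"
  shows "vharm_limit p R (partial_deriv u f)"
  unfolding vharm_limit_def
proof
  fix w
  obtain h where "harm_limit p R h (\<lambda>x. f x \<bullet> w)" using assms(2) by (auto simp: vharm_limit_def)
  from harm_limit_dd(2)[OF assms(1) this assms(3)]
  have "harm_limit p R (\<lambda>n. partial_deriv u (h n)) (\<lambda>x. partial_deriv u f x \<bullet> w)"
    by (rule harm_limit_cong) (rule vharm_limit_dd_inner[OF assms])
  then show "\<exists>h. harm_limit p R h (\<lambda>x. partial_deriv u f x \<bullet> w)" by blast
qed

lemma vharm_limit_iter_dd:
  "p \<in> S \<Longrightarrow> vharm_limit p R f \<Longrightarrow> u \<in> S \<Longrightarrow> vharm_limit p R ((partial_deriv u ^^ k) f)"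
  by (induction k) (auto intro: vharm_limit_dd)

lemma vharm_limit_dd_dd_inner:
  assumes "p \<in> S" "vharm_limit p R f" "u \<in> S" "v \<in> S" "x \<in> ball p R \<inter> S"
  shows "partial_deriv u (partial_deriv v (\<lambda>x. f x \<bullet> w)) x = partial_deriv u (partial_deriv v f) x \<bullet> w"
proof -
  have "partial_deriv u (partial_deriv v (\<lambda>x. f x \<bullet> w)) x
      = partial_deriv u (\<lambda>x. partial_deriv v f x \<bullet> w) x"
    using assms by (intro partial_deriv_cong[OF openin_ball_S subspace_span]) (auto simp: vharm_limit_dd_inner)
  also have "\<dots> = partial_deriv u (partial_deriv v f) x \<bullet> w"
    using assms by (intro vharm_limit_dd_inner) (auto intro: vharm_limit_dd)
  finally show ?thesis .
qed

text \<open>Componentwise, both mixed derivatives are limits of the same derivatives of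
  polynomials.\<close>

lemma vharm_limit_dd_commute:
  assumes "p \<in> S" "vharm_limit p R f" "u \<in> S" "v \<in> S" "x \<in> ball p R \<inter> S"
  shows "partial_deriv u (partial_deriv v f) x = partial_deriv v (partial_deriv u f) x"
proof (rule vector_eq_rdot[THEN iffD1], rule allI)
  fix w
  obtain h where h: "harm_limit p R h (\<lambda>x. f x \<bullet> w)" using assms(2) by (auto simp: vharm_limit_def)
  have "(\<lambda>n. partial_deriv u (partial_deriv v (h n)) x) \<longlonglongrightarrow> partial_deriv u (partial_deriv v (\<lambda>x. f x \<bullet> w)) x"
    using harm_limit_tendsto[OF harm_limit_dd(2)[OF assms(1) harm_limit_dd(2)[OF assms(1) h assms(4)] assms(3)] assms(5)] .
  moreover have "(\<lambda>n. partial_deriv v (partial_deriv u (h n)) x) \<longlonglongrightarrow> partial_deriv v (partial_deriv u (\<lambda>x. f x \<bullet> w)) x"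
    using harm_limit_tendsto[OF harm_limit_dd(2)[OF assms(1) harm_limit_dd(2)[OF assms(1) h assms(3)] assms(4)] assms(5)] .
  moreover have "partial_deriv u (partial_deriv v (h n)) = partial_deriv v (partial_deriv u (h n))" for n
    using h by (intro dd_commute) (simp add: harm_limit_def)
  ultimately have "partial_deriv u (partial_deriv v (\<lambda>x. f x \<bullet> w)) x
      = partial_deriv v (partial_deriv u (\<lambda>x. f x \<bullet> w)) x"
    using LIMSEQ_unique by simp
  then show "partial_deriv u (partial_deriv v f) x \<bullet> w = partial_deriv v (partial_deriv u f) x \<bullet> w"
    using assms by (simp add: vharm_limit_dd_dd_inner)
qed

lemma vharm_limit_chain:
  assumes "p \<in> S" "vharm_limit p R f" "u \<in> S" "x \<in> ball p R \<inter> S"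
  shows "partial_deriv u f x = (\<Sum>i=0..m. (u \<bullet> b i) *\<^sub>R pd i f x)"
proof (rule vector_eq_rdot[THEN iffD1], rule allI)
  fix w
  obtain h where h: "harm_limit p R h (\<lambda>x. f x \<bullet> w)" using assms(2) by (auto simp: vharm_limit_def)
  have "(\<lambda>n. partial_deriv u (h n) x) \<longlonglongrightarrow> partial_deriv u (\<lambda>x. f x \<bullet> w) x"
    using harm_limit_tendsto[OF harm_limit_dd(2)[OF assms(1) h assms(3)] assms(4)] .
  moreover have "(\<lambda>n. partial_deriv u (h n) x) \<longlonglongrightarrow> (\<Sum>i=0..m. (u \<bullet> b i) * pd i (\<lambda>x. f x \<bullet> w) x)"
  proof -
    have "partial_deriv u (h n) x = (\<Sum>i=0..m. (u \<bullet> b i) * pd i (h n) x)" for n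
      using h by (intro dd_chain) (simp add: harm_limit_def)
    moreover have "(\<lambda>n. pd i (h n) x) \<longlonglongrightarrow> pd i (\<lambda>x. f x \<bullet> w) x" if "i \<in> {0..m}" for i
      using harm_limit_tendsto[OF harm_limit_dd(2)[OF assms(1) h] assms(4), of "b i"] that b_in_S by auto
    ultimately show ?thesis by (auto intro!: tendsto_intros)
  qed
  ultimately have "partial_deriv u (\<lambda>x. f x \<bullet> w) x = (\<Sum>i=0..m. (u \<bullet> b i) * pd i (\<lambda>x. f x \<bullet> w) x)"
    by (rule LIMSEQ_unique)
  then show "partial_deriv u f x \<bullet> w = (\<Sum>i=0..m. (u \<bullet> b i) *\<^sub>R pd i f x) \<bullet> w"
    using assms b_in_S by (simp add: vharm_limit_dd_inner inner_sum_left)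
qed

lemma vharm_limit_iter_dd_inner:
  assumes "p \<in> S" "vharm_limit p R f" "u \<in> S"
  shows "x \<in> ball p R \<inter> S \<Longrightarrow> (partial_deriv u ^^ k) (\<lambda>x. f x \<bullet> w) x = (partial_deriv u ^^ k) f x \<bullet> w"
proof (induction k arbitrary: x)
  case (Suc k)
  have "partial_deriv u ((partial_deriv u ^^ k) (\<lambda>x. f x \<bullet> w)) x
      = partial_deriv u (\<lambda>x. (partial_deriv u ^^ k) f x \<bullet> w) x"
    using Suc assms by (intro partial_deriv_cong[OF openin_ball_S subspace_span]) auto
  then show ?case
    using vharm_limit_dd_inner[OF assms(1) vharm_limit_iter_dd[OF assms, of k] assms(3) Suc.prems] by simp
qed simp

theorem vharm_limit_taylor_bound:
  assumes p: "p \<in> S" and f: "vharm_limit p R f" and r: "0 < r" "r < R" and x: "x \<in> S"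
    and bd: "\<And>y. y \<in> sphere p r \<inter> S \<Longrightarrow> norm (f y) \<le> c"
  shows "norm ((1 / fact k) *\<^sub>R (partial_deriv x ^^ k) f p) \<le> sqrt (real (k + m choose m)) * (norm x / r) ^ k * c"
proof -
  define X where "X = (1 / fact k) *\<^sub>R (partial_deriv x ^^ k) f p"
  \<comment> \<open>The unit vector along \<open>X\<close>, so that \<open>X \<bullet> w\<close> is
    the norm of \<open>X\<close>; \<open>sgn 0 = 0\<close> covers \<open>X = 0\<close>.\<close>
  define w where "w = sgn X"
  have w: "norm w \<le> 1" by (simp add: w_def norm_sgn)
  have pB: "p \<in> ball p R \<inter> S" using p r by auto
  obtain h where h: "harm_limit p R h (\<lambda>x. f x \<bullet> w)" using f by (auto simp: vharm_limit_def)
  have "norm X = X \<bullet> w"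
    by (cases "X = 0") (simp_all add: w_def sgn_div_norm power2_norm_eq_inner[symmetric] power2_eq_square)
  also have "\<dots> = (partial_deriv x ^^ k) (\<lambda>x. f x \<bullet> w) p / fact k"
    using vharm_limit_iter_dd_inner[OF p f x pB] by (simp add: X_def)
  also have "\<dots> \<le> \<bar>(partial_deriv x ^^ k) (\<lambda>x. f x \<bullet> w) p / fact k\<bar>" by (rule abs_ge_self)
  also have "\<dots> \<le> sqrt (real (k + m choose m)) * (norm x / r) ^ k * c"
  proof (rule harm_limit_taylor_bound[OF p h r x])
    fix y assume y: "y \<in> sphere p r \<inter> S"
    have "\<bar>f y \<bullet> w\<bar> \<le> norm (f y) * norm w" by (rule Cauchy_Schwarz_ineq2)
    also have "\<dots> \<le> norm (f y)" using w by (simp add: mult_left_le)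
    finally show "\<bar>f y \<bullet> w\<bar> \<le> c" using bd[OF y] by simp
  qed
  finally show ?thesis by (simp add: X_def)
qed

theorem vharm_limit_taylor_sums:
  assumes p: "p \<in> S" and f: "vharm_limit p R f" and x: "x \<in> S" "norm x < R"
  shows "(\<lambda>k. (1 / fact k) *\<^sub>R (partial_deriv x ^^ k) f p) sums f (p + x)"
  unfolding sums_def tendsto_componentwise_iff[where f = "\<lambda>n. \<Sum>k<n. (1 / fact k) *\<^sub>R (partial_deriv x ^^ k) f p"]
proof
  fix w :: 'b assume "w \<in> Basis"
  obtain h where h: "harm_limit p R h (\<lambda>x. f x \<bullet> w)" using f by (auto simp: vharm_limit_def)
  have "p \<in> ball p R \<inter> S" using p le_less_trans[OF norm_ge_zero x(2)] by simp
  then have "(\<lambda>k. (1 / fact k) *\<^sub>R (partial_deriv x ^^ k) f p \<bullet> w) sums (f (p + x) \<bullet> w)"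
    using harm_limit_taylor_sums[OF p h x] vharm_limit_iter_dd_inner[OF p f x(1), of p _ w] by simp
  then show "(\<lambda>n. (\<Sum>k<n. (1 / fact k) *\<^sub>R (partial_deriv x ^^ k) f p) \<bullet> w) \<longlonglongrightarrow> f (p + x) \<bullet> w"
    by (simp add: sums_def inner_sum_left)
qed

section \<open>Monogenic functions are limits of harmonic polynomials\<close>

lemma norm_combination: "(norm (\<Sum>i=0..m. a i *\<^sub>R b i))\<^sup>2 = (\<Sum>i=0..m. (a i)\<^sup>2)"
proof -
  have "(norm (\<Sum>i=0..m. a i *\<^sub>R b i))\<^sup>2 = (\<Sum>i=0..m. \<Sum>j=0..m. if i = j then (a i)\<^sup>2 else 0)"
    unfolding power2_norm_eq_inner inner_sum_left inner_sum_right
    by (intro sum.cong refl) (auto simp: orth power2_eq_square)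
  then show ?thesis by simp
qed

text \<open>It shows that a point obtained from \<open>x\<close> by following only some coordinates
  of \<open>y - x\<close>, or only part of one, is no farther from \<open>x\<close> than
  \<open>y\<close> is.\<close>

lemma norm_combination_le:
  assumes "x \<in> S" "\<And>i. i \<le> m \<Longrightarrow> \<bar>a i\<bar> \<le> \<bar>x \<bullet> b i\<bar>"
  shows "norm (\<Sum>i=0..m. a i *\<^sub>R b i) \<le> norm x"
proof -
  have "(norm (\<Sum>i=0..m. a i *\<^sub>R b i))\<^sup>2 \<le> (\<Sum>i=0..m. (x \<bullet> b i)\<^sup>2)"
    unfolding norm_combination using assms(2) by (intro sum_mono) (auto simp: abs_le_square_iff)
  also have "\<dots> = (norm x)\<^sup>2"
    using rho_S[OF assms(1)] by (simp add: rho_def power2_eq_square)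
  finally show ?thesis by (simp add: abs_le_square_iff[symmetric])
qed

lemma has_dd_segment_bound:
  fixes f :: "'a \<Rightarrow> 'c::real_normed_vector"
  assumes dd: "\<And>s. 0 \<le> s \<Longrightarrow> s \<le> 1 \<Longrightarrow> has_dd w f (f' (y + (s * c) *\<^sub>R w)) (y + (s * c) *\<^sub>R w)"
    and bd: "\<And>s. 0 \<le> s \<Longrightarrow> s \<le> 1 \<Longrightarrow> norm (f' (y + (s * c) *\<^sub>R w)) \<le> C"
  shows "norm (f (y + c *\<^sub>R w) - f y) \<le> C * \<bar>c\<bar>"
proof -
  have "norm ((\<lambda>s. f (y + (s * c) *\<^sub>R w)) 1 - (\<lambda>s. f (y + (s * c) *\<^sub>R w)) 0) \<le> C * \<bar>c\<bar> * norm (1 - 0 :: real)"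
  proof (rule differentiable_bound[where S = "{0..1}" and f' = "\<lambda>s t. t *\<^sub>R (c *\<^sub>R f' (y + (s * c) *\<^sub>R w))"])
    fix s :: real assume s: "s \<in> {0..1}"
    have "((\<lambda>s. s * c) has_vector_derivative c) (at s)"
      by (auto intro!: derivative_eq_intros)
    from vector_diff_chain_at[OF this has_dd_line[OF dd]] s
    have "((\<lambda>s. f (y + (s * c) *\<^sub>R w)) has_vector_derivative c *\<^sub>R f' (y + (s * c) *\<^sub>R w)) (at s)"
      by (simp add: o_def)
    then show "((\<lambda>s. f (y + (s * c) *\<^sub>R w)) has_derivative (\<lambda>t. t *\<^sub>R (c *\<^sub>R f' (y + (s * c) *\<^sub>R w))))
        (at s within {0..1})"
      by (simp add: has_vector_derivative_def has_derivative_at_withinI)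
    show "onorm (\<lambda>t. t *\<^sub>R (c *\<^sub>R f' (y + (s * c) *\<^sub>R w))) \<le> C * \<bar>c\<bar>"
    proof (rule onorm_le)
      fix t :: real
      have "\<bar>t\<bar> * \<bar>c\<bar> * norm (f' (y + (s * c) *\<^sub>R w)) \<le> \<bar>t\<bar> * \<bar>c\<bar> * C"
        using bd s by (intro mult_left_mono) auto
      then show "norm (t *\<^sub>R (c *\<^sub>R f' (y + (s * c) *\<^sub>R w))) \<le> C * \<bar>c\<bar> * norm t"
        by (simp add: mult_ac abs_mult)
    qed
  qed auto
  then show ?thesis by simp
qed

text \<open>Class C^1 is expressed by partial derivatives only. Continuous partial derivatives are
  locally bounded, so \<open>f\<close> is Lipschitz along each edge of a path from \<open>x\<close>
  to \<open>y\<close> that changes one coordinate at a time.\<close>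

lemma C1_continuous:
  fixes f :: "'a \<Rightarrow> 'c::real_normed_vector"
  assumes dd: "\<And>i x. i \<le> m \<Longrightarrow> x \<in> ball p R \<inter> S \<Longrightarrow> has_dd (b i) f (f' i x) x"
    and cont: "\<And>i. i \<le> m \<Longrightarrow> continuous_on (ball p R \<inter> S) (f' i)"
  shows "continuous_on (ball p R \<inter> S) f"
  unfolding continuous_on_iff
proof (intro ballI allI impI)
  fix x and e :: real assume x: "x \<in> ball p R \<inter> S" and e: "e > 0"
  have "\<exists>d>0. \<forall>y\<in>ball p R \<inter> S. dist y x < d \<longrightarrow> dist (f' i y) (f' i x) < 1" if "i \<in> {0..m}" for i
    using cont[of i] x that unfolding continuous_on_iff by auto
  then obtain d where d: "\<And>i. i \<in> {0..m} \<Longrightarrow> d i > 0"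
    "\<And>i y. i \<in> {0..m} \<Longrightarrow> y \<in> ball p R \<inter> S \<Longrightarrow> dist y x < d i \<Longrightarrow> dist (f' i y) (f' i x) < 1"
    by metis
  define C where "C = (\<Sum>i=0..m. norm (f' i x)) + 1"
  have C: "C > 0" by (auto simp: C_def intro!: add_nonneg_pos sum_nonneg)
  \<comment> \<open>The three bounds keep each partial derivative within 1 of its value at
    \<open>x\<close>, keep the points in the ball, and keep the total change below
    \<open>e\<close>.\<close>
  define \<delta> where "\<delta> = min (min (Min (d ` {0..m})) (R - dist p x)) (e / (C * (real m + 1)))"
  have \<delta>: "\<delta> > 0" "\<delta> \<le> R - dist p x" "\<delta> \<le> e / (C * (real m + 1))"
    using x d(1) e C by (auto simp: \<delta>_def)
  have \<delta>d: "\<delta> \<le> d i" if "i \<in> {0..m}" for i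
  proof -
    have "Min (d ` {0..m}) \<le> d i" using that by (intro Min_le) auto
    then show ?thesis by (simp add: \<delta>_def)
  qed
  have near: "y \<in> ball p R \<inter> S \<and> (\<forall>i\<in>{0..m}. norm (f' i y) \<le> C)" if y: "y \<in> S" "dist y x < \<delta>" for y
  proof -
    have "dist p y \<le> dist p x + dist x y" by (rule dist_triangle)
    then have yB: "y \<in> ball p R \<inter> S" using y \<delta>(2) by (auto simp: dist_commute)
    moreover have "norm (f' i y) \<le> C" if i: "i \<in> {0..m}" for i
    proof -
      have "norm (f' i y) \<le> norm (f' i x) + norm (f' i y - f' i x)" by (rule norm_triangle_sub)
      also have "norm (f' i y - f' i x) \<le> 1"
        using d(2)[OF i yB] y \<delta>d[OF i] by (simp add: dist_norm)
      also have "norm (f' i x) \<le> (\<Sum>i=0..m. norm (f' i x))"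
        using i by (intro member_le_sum) auto
      finally show ?thesis by (simp add: C_def)
    qed
    ultimately show ?thesis by blast
  qed
  have "dist (f y) (f x) < e" if y: "y \<in> ball p R \<inter> S" "dist y x < \<delta>" for y
  proof -
    define c where "c i = (y - x) \<bullet> b i" for i
    have yx: "y - x \<in> S" using x y by (auto intro: span_diff)
    \<comment> \<open>\<open>z k\<close> has the coordinates of \<open>y\<close> below index
      \<open>k\<close> and those of \<open>x\<close> from \<open>k\<close> on.\<close>
    define z where "z k = x + (\<Sum>i=0..m. (if i < k then c i else 0) *\<^sub>R b i)" for k
    have zS: "z k + t *\<^sub>R b k \<in> S" if "k \<le> m" for k t
      using x that b_in_S unfolding z_def by (intro span_add span_scale span_sum) auto
    have z_Suc: "z (Suc k) = z k + c k *\<^sub>R b k" if "k \<le> m" for k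
    proof -
      have "z (Suc k) = x + (\<Sum>i=0..m. (if i < k then c i else 0) *\<^sub>R b i + (if i = k then c k *\<^sub>R b k else 0))"
        unfolding z_def by (auto intro!: sum.cong simp: less_Suc_eq)
      then show ?thesis using that by (simp add: z_def sum.distrib)
    qed
    have step: "norm (f (z (Suc k)) - f (z k)) \<le> C * \<bar>c k\<bar>" if k: "k \<le> m" for k
      unfolding z_Suc[OF k]
    proof (rule has_dd_segment_bound[where f' = "f' k"])
      fix s :: real assume s: "0 \<le> s" "s \<le> 1"
      have "z k + (s * c k) *\<^sub>R b k - x
          = (\<Sum>i=0..m. (if i < k then c i else 0) *\<^sub>R b i + (if i = k then (s * c k) *\<^sub>R b k else 0))"
        using k by (simp add: z_def sum.distrib)
      also have "\<dots> = (\<Sum>i=0..m. (if i < k then c i else if i = k then s * c k else 0) *\<^sub>R b i)"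
        by (intro sum.cong) auto
      also have "norm \<dots> \<le> norm (y - x)"
        using s by (intro norm_combination_le yx) (auto simp: c_def abs_mult mult_left_le_one_le)
      finally have "dist (z k + (s * c k) *\<^sub>R b k) x < \<delta>"
        using y(2) by (simp add: dist_norm)
      from near[OF zS[OF k] this]
      show "has_dd (b k) f (f' k (z k + (s * c k) *\<^sub>R b k)) (z k + (s * c k) *\<^sub>R b k)"
        "norm (f' k (z k + (s * c k) *\<^sub>R b k)) \<le> C"
        using dd k by auto
    qed
    have "f y - f x = f (z (Suc m)) - f (z 0)"
    proof -
      have "y - x = (\<Sum>i=0..m. c i *\<^sub>R b i)"
        unfolding c_def by (rule S_expand[OF yx])
      also have "\<dots> = (\<Sum>i=0..m. (if i < Suc m then c i else 0) *\<^sub>R b i)"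
        by (intro sum.cong) auto
      finally have "z (Suc m) = x + (y - x)" by (simp only: z_def)
      then show ?thesis by (simp add: z_def)
    qed
    also have "\<dots> = (\<Sum>k<Suc m. f (z (Suc k)) - f (z k))"
      by (rule sum_lessThan_telescope[symmetric])
    finally have "norm (f y - f x) = norm (\<Sum>k<Suc m. f (z (Suc k)) - f (z k))"
      by (rule arg_cong)
    also have "\<dots> \<le> (\<Sum>k<Suc m. C * \<bar>c k\<bar>)"
      using step by (intro sum_norm_le) auto
    also have "\<dots> \<le> (\<Sum>k<Suc m. C * norm (y - x))"
    proof (intro sum_mono mult_left_mono)
      fix k assume "k \<in> {..<Suc m}"
      then show "\<bar>c k\<bar> \<le> norm (y - x)"
        using Cauchy_Schwarz_ineq2[of "y - x" "b k"] norm_b[of k] by (simp add: c_def)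
    qed (use C in auto)
    also have "\<dots> = C * (real m + 1) * norm (y - x)" by (simp add: algebra_simps)
    also have "\<dots> < C * (real m + 1) * (e / (C * (real m + 1)))"
      using y(2) \<delta>(3) C by (intro mult_strict_left_mono) (auto simp: dist_norm)
    also have "\<dots> = e" using C by simp
    finally show ?thesis by (simp add: dist_norm)
  qed
  then show "\<exists>d>0. \<forall>y\<in>ball p R \<inter> S. dist y x < d \<longrightarrow> dist (f y) (f x) < e"
    using \<delta>(1) by blast
qed

section \<open>Averages along segments\<close>

definition pdc :: "'a \<Rightarrow> real \<Rightarrow> 'a \<Rightarrow> ('a \<Rightarrow> 'c::real_normed_vector) \<Rightarrow> ('a \<Rightarrow> 'c) \<Rightarrow> bool" where
  "pdc p \<rho> w f f' \<longleftrightarrow> (\<forall>x\<in>ball p \<rho> \<inter> S. has_dd w f (f' x) x) \<and> continuous_on (ball p \<rho> \<inter> S) f'"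

text \<open>The Steklov mean over the segment from \<open>x\<close> to
  \<open>x + \<epsilon> *\<^sub>R w\<close>. Applied once in each frame direction it averages over a
  cube, while each step needs only a one-dimensional integral.\<close>

definition avg :: "real \<Rightarrow> 'a \<Rightarrow> ('a \<Rightarrow> 'c::real_normed_vector) \<Rightarrow> 'a \<Rightarrow> 'c" where
  "avg \<epsilon> w f x = integral (cbox 0 1) (\<lambda>s. f (x + (\<epsilon> * s) *\<^sub>R w))"

lemma shift_in_ball:
  assumes "x \<in> ball p (\<rho> - \<epsilon>) \<inter> S" "w \<in> S" "norm w = 1" "\<bar>s\<bar> \<le> \<epsilon>"
  shows "x + s *\<^sub>R w \<in> ball p \<rho> \<inter> S"
proof -
  have "dist p (x + s *\<^sub>R w) \<le> dist p x + dist x (x + s *\<^sub>R w)" by (rule dist_triangle)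
  also have "dist x (x + s *\<^sub>R w) = \<bar>s\<bar>" using assms by (simp add: dist_norm)
  finally show ?thesis using assms by (auto intro: span_add span_scale)
qed

lemma avg_shift_in_ball:
  assumes "x \<in> ball p (\<rho> - \<epsilon>) \<inter> S" "w \<in> S" "norm w = 1" "\<epsilon> > 0" "t \<in> cbox 0 1"
  shows "x + (\<epsilon> * t) *\<^sub>R w \<in> ball p \<rho> \<inter> S"
  using assms by (intro shift_in_ball[OF assms(1-3)]) (simp add: abs_mult mult_left_le)

lemma continuous_avg_integrand:
  assumes "continuous_on (ball p \<rho> \<inter> S) f" "w \<in> S" "norm w = 1" "\<epsilon> > 0"
  shows "continuous_on ((ball p (\<rho> - \<epsilon>) \<inter> S) \<times> cbox 0 1) (\<lambda>(x, t). f (x + (\<epsilon> * t) *\<^sub>R w))"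
  unfolding split_beta
  by (rule continuous_on_compose2[OF assms(1)])
    (use avg_shift_in_ball[OF _ assms(2-4)] in \<open>auto intro!: continuous_intros\<close>)

lemma avg_integrable:
  fixes f :: "'a \<Rightarrow> 'c::euclidean_space"
  assumes "continuous_on (ball p \<rho> \<inter> S) f" "w \<in> S" "norm w = 1" "\<epsilon> > 0" "x \<in> ball p (\<rho> - \<epsilon>) \<inter> S"
  shows "(\<lambda>s. f (x + (\<epsilon> * s) *\<^sub>R w)) integrable_on cbox 0 1"
proof (rule integrable_continuous)
  show "continuous_on (cbox 0 1) (\<lambda>s. f (x + (\<epsilon> * s) *\<^sub>R w))"
    by (rule continuous_on_compose2[OF assms(1)])
      (use avg_shift_in_ball[OF assms(5) assms(2-4)] in \<open>auto intro!: continuous_intros\<close>)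
qed

lemma continuous_avg:
  fixes f :: "'a \<Rightarrow> 'c::euclidean_space"
  assumes "continuous_on (ball p \<rho> \<inter> S) f" "w \<in> S" "norm w = 1" "\<epsilon> > 0"
  shows "continuous_on (ball p (\<rho> - \<epsilon>) \<inter> S) (avg \<epsilon> w f)"
  unfolding avg_def by (rule integral_continuous_on_param[OF continuous_avg_integrand[OF assms]])

lemma line_in_ball:
  assumes "x \<in> ball p \<rho> \<inter> S" "u \<in> S" "norm u = 1" "\<bar>s\<bar> < \<rho> - dist p x"
  shows "x + s *\<^sub>R u \<in> ball p \<rho> \<inter> S"
proof (rule shift_in_ball[OF _ assms(2,3)])
  show "x \<in> ball p (\<rho> - \<bar>s\<bar>) \<inter> S" using assms by auto
qed simp

text \<open>This is differentiation under the integral sign; the radius shrinks by \<epsilon>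
  because the segments must stay in the ball.\<close>

lemma pdc_avg:
  fixes f :: "'a \<Rightarrow> 'c::euclidean_space"
  assumes f: "continuous_on (ball p \<rho> \<inter> S) f" and f': "pdc p \<rho> u f f'"
    and w: "w \<in> S" "norm w = 1" and u: "u \<in> S" "norm u = 1" and \<epsilon>: "\<epsilon> > 0"
  shows "pdc p (\<rho> - \<epsilon>) u (avg \<epsilon> w f) (avg \<epsilon> w f')"
  unfolding pdc_def
proof (intro conjI ballI)
  have cf': "continuous_on (ball p \<rho> \<inter> S) f'" using f' by (simp add: pdc_def)
  then show "continuous_on (ball p (\<rho> - \<epsilon>) \<inter> S) (avg \<epsilon> w f')"
    using continuous_avg w \<epsilon> by blast
  fix x assume x: "x \<in> ball p (\<rho> - \<epsilon>) \<inter> S"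
  define \<delta> where "\<delta> = \<rho> - \<epsilon> - dist p x"
  define I where "I = {-\<delta><..<\<delta>}"
  have I: "0 \<in> I" "open I" "convex I" using x by (auto simp: I_def \<delta>_def)
  have xI: "x + s *\<^sub>R u \<in> ball p (\<rho> - \<epsilon>) \<inter> S" if "s \<in> I" for s
    using that by (intro line_in_ball x u) (auto simp: I_def \<delta>_def)
  have "((\<lambda>s. integral (cbox 0 1) (\<lambda>t. f (x + s *\<^sub>R u + (\<epsilon> * t) *\<^sub>R w))) has_vector_derivative
      integral (cbox 0 1) (\<lambda>t. f' (x + 0 *\<^sub>R u + (\<epsilon> * t) *\<^sub>R w))) (at 0 within I)"
  proof (rule leibniz_rule_vector_derivative)
    fix s t :: real assume s: "s \<in> I" and t: "t \<in> cbox 0 1"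
    have eq: "x + s' *\<^sub>R u + (\<epsilon> * t) *\<^sub>R w = x + (\<epsilon> * t) *\<^sub>R w + s' *\<^sub>R u" for s'
      by (simp add: algebra_simps)
    have "has_dd u f (f' (x + s *\<^sub>R u + (\<epsilon> * t) *\<^sub>R w)) (x + s *\<^sub>R u + (\<epsilon> * t) *\<^sub>R w)"
      using f' avg_shift_in_ball[OF xI[OF s] w \<epsilon> t] by (auto simp: pdc_def)
    then show "((\<lambda>s. f (x + s *\<^sub>R u + (\<epsilon> * t) *\<^sub>R w)) has_vector_derivative
        f' (x + s *\<^sub>R u + (\<epsilon> * t) *\<^sub>R w)) (at s within I)"
      unfolding eq by (intro has_vector_derivative_at_within[OF has_dd_line])
  next
    show "(\<lambda>t. f (x + s *\<^sub>R u + (\<epsilon> * t) *\<^sub>R w)) integrable_on cbox 0 1" if "s \<in> I" for s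
      using avg_integrable[OF f w \<epsilon> xI[OF that]] .
    show "continuous_on (I \<times> cbox 0 1) (\<lambda>(s, t). f' (x + s *\<^sub>R u + (\<epsilon> * t) *\<^sub>R w))"
      unfolding split_beta
      by (rule continuous_on_compose2[OF cf'])
        (use avg_shift_in_ball[OF xI w \<epsilon>] in \<open>auto intro!: continuous_intros\<close>)
  qed (use I in auto)
  then show "has_dd u (avg \<epsilon> w f) (avg \<epsilon> w f' x) x"
    unfolding has_dd_def avg_def at_within_open[OF I(1,2)] by simp
qed

text \<open>Along \<open>w\<close> the average is a difference of two values of a primitive of
  \<open>f\<close>, so the fundamental theorem of calculus differentiates it although
  \<open>f\<close> is merely continuous.\<close>

lemma pdc_avg_same:
  fixes f :: "'a \<Rightarrow> 'c::euclidean_space"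
  assumes f: "continuous_on (ball p \<rho> \<inter> S) f" and w: "w \<in> S" "norm w = 1" and \<epsilon>: "\<epsilon> > 0"
  shows "pdc p (\<rho> - \<epsilon>) w (avg \<epsilon> w f) (\<lambda>x. (1 / \<epsilon>) *\<^sub>R (f (x + \<epsilon> *\<^sub>R w) - f x))"
  unfolding pdc_def
proof (intro conjI ballI)
  have sub: "ball p (\<rho> - \<epsilon>) \<inter> S \<subseteq> ball p \<rho> \<inter> S" using \<epsilon> by auto
  have "continuous_on (ball p (\<rho> - \<epsilon>) \<inter> S) (\<lambda>x. f (x + \<epsilon> *\<^sub>R w))"
    by (rule continuous_on_compose2[OF f])
      (use shift_in_ball[OF _ w, of _ p \<rho> \<epsilon> \<epsilon>] \<epsilon> in \<open>auto intro!: continuous_intros\<close>)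
  then show "continuous_on (ball p (\<rho> - \<epsilon>) \<inter> S) (\<lambda>x. (1 / \<epsilon>) *\<^sub>R (f (x + \<epsilon> *\<^sub>R w) - f x))"
    by (intro continuous_intros continuous_on_subset[OF f sub])
  fix x assume x: "x \<in> ball p (\<rho> - \<epsilon>) \<inter> S"
  \<comment> \<open>Half of the remaining room, so that the line is available on a neighbourhood of
    both end points 0 and \<epsilon>.\<close>
  define \<delta> where "\<delta> = (\<rho> - \<epsilon> - dist p x) / 2"
  have \<delta>: "\<delta> > 0" using x by (simp add: \<delta>_def)
  define \<psi> where "\<psi> s = f (x + s *\<^sub>R w)" for s
  have c\<psi>: "continuous_on {-\<delta>..\<epsilon> + \<delta>} \<psi>"
    unfolding \<psi>_def
  proof (rule continuous_on_compose2[OF f])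
    have "x + s *\<^sub>R w \<in> ball p \<rho> \<inter> S" if "s \<in> {-\<delta>..\<epsilon> + \<delta>}" for s
    proof (rule line_in_ball[OF _ w])
      have "\<bar>s\<bar> \<le> \<epsilon> + \<delta>" using that \<epsilon> \<delta> by auto
      also have "\<dots> < \<epsilon> + 2 * \<delta>" using \<delta> by simp
      also have "\<dots> = \<rho> - dist p x" unfolding \<delta>_def by argo
      finally show "\<bar>s\<bar> < \<rho> - dist p x" .
    qed (use x sub in auto)
    then show "(\<lambda>s. x + s *\<^sub>R w) ` {-\<delta>..\<epsilon> + \<delta>} \<subseteq> ball p \<rho> \<inter> S" by blast
  qed (intro continuous_intros)
  define \<Phi> where "\<Phi> s = integral {-\<delta>..s} \<psi>" for s
  have d\<Phi>: "(\<Phi> has_vector_derivative \<psi> s) (at s)" if "-\<delta> < s" "s < \<epsilon> + \<delta>" for s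
  proof -
    have "(\<Phi> has_vector_derivative \<psi> s) (at s within {-\<delta>..\<epsilon> + \<delta>})"
      unfolding \<Phi>_def using that by (intro integral_has_vector_derivative c\<psi>) auto
    moreover have "at s within {-\<delta>..\<epsilon> + \<delta>} = at s"
      using that by (intro at_within_interior) simp
    ultimately show ?thesis by simp
  qed
  have avg_eq: "avg \<epsilon> w f (x + s *\<^sub>R w) = (1 / \<epsilon>) *\<^sub>R (\<Phi> (s + \<epsilon>) - \<Phi> s)" if s: "s \<in> {-\<delta><..<\<delta>}" for s
  proof -
    have "((\<lambda>t. \<psi> (s + \<epsilon> * t)) has_integral
        (1 / \<epsilon>) *\<^sub>R \<Phi> (s + \<epsilon> * 1) - (1 / \<epsilon>) *\<^sub>R \<Phi> (s + \<epsilon> * 0)) {0..1}"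
    proof (rule fundamental_theorem_of_calculus)
      fix t :: real assume t: "t \<in> {0..1}"
      have "\<epsilon> * t \<le> \<epsilon>" "0 \<le> \<epsilon> * t" using t \<epsilon> by (auto simp: mult_left_le)
      then have "-\<delta> < s + \<epsilon> * t" "s + \<epsilon> * t < \<epsilon> + \<delta>" using s by auto
      have lin: "((\<lambda>t. s + \<epsilon> * t) has_vector_derivative \<epsilon>) (at t)"
        by (auto intro!: derivative_eq_intros)
      from d\<Phi>[OF \<open>-\<delta> < s + \<epsilon> * t\<close> \<open>s + \<epsilon> * t < \<epsilon> + \<delta>\<close>]
      have "((\<lambda>t. \<Phi> (s + \<epsilon> * t)) has_vector_derivative \<epsilon> *\<^sub>R \<psi> (s + \<epsilon> * t)) (at t)"
        using vector_diff_chain_at[of "\<lambda>t. s + \<epsilon> * t" \<epsilon> t \<Phi>] lin by (simp add: o_def)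
      then have "((\<lambda>t. (1 / \<epsilon>) *\<^sub>R \<Phi> (s + \<epsilon> * t)) has_vector_derivative (1 / \<epsilon>) *\<^sub>R (\<epsilon> *\<^sub>R \<psi> (s + \<epsilon> * t))) (at t)"
        by (rule bounded_linear.has_vector_derivative[OF bounded_linear_scaleR_right])
      then show "((\<lambda>t. (1 / \<epsilon>) *\<^sub>R \<Phi> (s + \<epsilon> * t)) has_vector_derivative \<psi> (s + \<epsilon> * t)) (at t within {0..1})"
        using \<epsilon> by (simp add: has_vector_derivative_at_within)
    qed simp
    then have "integral {0..1} (\<lambda>t. \<psi> (s + \<epsilon> * t)) = (1 / \<epsilon>) *\<^sub>R (\<Phi> (s + \<epsilon>) - \<Phi> s)"
      by (simp add: integral_unique scaleR_diff_right)
    moreover have "x + s *\<^sub>R w + (\<epsilon> * t) *\<^sub>R w = x + (s + \<epsilon> * t) *\<^sub>R w" for t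
      by (simp add: algebra_simps)
    ultimately show ?thesis by (simp only: avg_def \<psi>_def cbox_interval)
  qed
  have d1: "((\<lambda>s. \<Phi> (s + \<epsilon>)) has_vector_derivative \<psi> \<epsilon>) (at 0)"
  proof -
    have "((\<lambda>s. s + \<epsilon>) has_vector_derivative 1) (at 0)"
      by (auto intro!: derivative_eq_intros)
    from vector_diff_chain_at[OF this, of \<Phi> "\<psi> \<epsilon>"] d\<Phi>[of \<epsilon>] \<epsilon> \<delta>
    show ?thesis by (simp add: o_def)
  qed
  have "((\<lambda>s. (1 / \<epsilon>) *\<^sub>R (\<Phi> (s + \<epsilon>) - \<Phi> s)) has_vector_derivative (1 / \<epsilon>) *\<^sub>R (\<psi> \<epsilon> - \<psi> 0)) (at 0)"
    using d\<Phi>[of 0] \<delta> \<epsilon>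
    by (intro bounded_linear.has_vector_derivative[OF bounded_linear_scaleR_right]
        has_vector_derivative_diff d1) auto
  then have "((\<lambda>s. avg \<epsilon> w f (x + s *\<^sub>R w)) has_vector_derivative (1 / \<epsilon>) *\<^sub>R (\<psi> \<epsilon> - \<psi> 0)) (at 0)"
    by (rule has_vector_derivative_transform_within_open[where S = "{-\<delta><..<\<delta>}"])
      (use avg_eq \<delta> in auto)
  then show "has_dd w (avg \<epsilon> w f) ((1 / \<epsilon>) *\<^sub>R (f (x + \<epsilon> *\<^sub>R w) - f x)) x"
    by (simp add: has_dd_def \<psi>_def)
qed

lemma pdc_difference_quotient:
  assumes f: "pdc p \<rho> u f f'" and w: "w \<in> S" "norm w = 1" and \<epsilon>: "\<epsilon> > 0"
  shows "pdc p (\<rho> - \<epsilon>) u (\<lambda>x. (1 / \<epsilon>) *\<^sub>R (f (x + \<epsilon> *\<^sub>R w) - f x))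
    (\<lambda>x. (1 / \<epsilon>) *\<^sub>R (f' (x + \<epsilon> *\<^sub>R w) - f' x))"
  unfolding pdc_def
proof (intro conjI ballI)
  have sub: "ball p (\<rho> - \<epsilon>) \<inter> S \<subseteq> ball p \<rho> \<inter> S" using \<epsilon> by auto
  have cf': "continuous_on (ball p \<rho> \<inter> S) f'" using f by (simp add: pdc_def)
  have shift: "x + \<epsilon> *\<^sub>R w \<in> ball p \<rho> \<inter> S" if "x \<in> ball p (\<rho> - \<epsilon>) \<inter> S" for x
    using shift_in_ball[OF that w] \<epsilon> by simp
  have "continuous_on (ball p (\<rho> - \<epsilon>) \<inter> S) (\<lambda>x. f' (x + \<epsilon> *\<^sub>R w))"
    by (rule continuous_on_compose2[OF cf']) (use shift in \<open>auto intro!: continuous_intros\<close>)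
  then show "continuous_on (ball p (\<rho> - \<epsilon>) \<inter> S) (\<lambda>x. (1 / \<epsilon>) *\<^sub>R (f' (x + \<epsilon> *\<^sub>R w) - f' x))"
    by (intro continuous_intros continuous_on_subset[OF cf' sub])
  fix x assume x: "x \<in> ball p (\<rho> - \<epsilon>) \<inter> S"
  have "has_dd u f (f' (\<epsilon> *\<^sub>R w + 1 *\<^sub>R x)) (\<epsilon> *\<^sub>R w + 1 *\<^sub>R x)"
    using f shift[OF x] by (simp add: pdc_def add.commute)
  from has_dd_affine[OF this] have "has_dd u (\<lambda>x. f (x + \<epsilon> *\<^sub>R w)) (f' (x + \<epsilon> *\<^sub>R w)) x"
    by (simp add: add.commute)
  moreover have "has_dd u f (f' x) x" using f x sub by (auto simp: pdc_def)
  ultimately show "has_dd u (\<lambda>x. (1 / \<epsilon>) *\<^sub>R (f (x + \<epsilon> *\<^sub>R w) - f x))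
      ((1 / \<epsilon>) *\<^sub>R (f' (x + \<epsilon> *\<^sub>R w) - f' x)) x"
    by (intro has_dd_bounded_linear[OF bounded_linear_scaleR_right] has_dd_diff)
qed

text \<open>\<open>P\<close> is the set of directions already averaged over. For \<open>j\<close> in
  \<open>P\<close>, \<open>f2 i j\<close> is at once the derivative of \<open>f1 j\<close> along
  \<open>b i\<close> and that of \<open>f1 i\<close> along \<open>b j\<close>, so the equality of
  mixed derivatives is built in.\<close>

definition mollified where
  "mollified p \<rho> P f f1 f2 \<longleftrightarrow> continuous_on (ball p \<rho> \<inter> S) f \<and>
     (\<forall>i\<le>m. pdc p \<rho> (b i) f (f1 i)) \<and>
     (\<forall>j\<in>P. \<forall>i\<le>m. pdc p \<rho> (b i) (f1 j) (f2 i j) \<and> pdc p \<rho> (b j) (f1 i) (f2 i j))"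

text \<open>Averaging over a segment in direction \<open>b j\<close> makes \<open>\<partial>\<^sub>j f\<close> a difference quotient of \<open>f\<close>, hence
  again of class \<open>C\<^sup>1\<close>, and \<open>\<partial>\<^sub>i\<partial>\<^sub>j\<close>, \<open>\<partial>\<^sub>j\<partial>\<^sub>i\<close> are then the same difference quotient of \<open>\<partial>\<^sub>i f\<close>.\<close>

lemma mollified_avg:
  fixes f :: "'a \<Rightarrow> 'c::euclidean_space"
  assumes mol: "mollified p \<rho> P f f1 f2" and P: "P \<subseteq> {0..m}" and j: "j \<le> m" and \<epsilon>: "\<epsilon> > 0"
  defines "T \<equiv> \<lambda>g x. (1 / \<epsilon>) *\<^sub>R (g (x + \<epsilon> *\<^sub>R b j) - g x)"
  shows "mollified p (\<rho> - \<epsilon>) (insert j P) (avg \<epsilon> (b j) f)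
    (\<lambda>i. if i = j then T f else avg \<epsilon> (b j) (f1 i))
    (\<lambda>i k. if k = j then T (f1 i) else if i = j then T (f1 k) else avg \<epsilon> (b j) (f2 i k))"
    and "i \<le> m \<Longrightarrow> x \<in> ball p (\<rho> - \<epsilon>) \<inter> S \<Longrightarrow>
      (if i = j then T f else avg \<epsilon> (b j) (f1 i)) x = avg \<epsilon> (b j) (f1 i) x"
proof -
  have bS: "b i \<in> S" "norm (b i) = 1" if "i \<le> m" for i
    using that b_in_S norm_b by auto
  have f: "continuous_on (ball p \<rho> \<inter> S) f" and f1: "\<And>i. i \<le> m \<Longrightarrow> pdc p \<rho> (b i) f (f1 i)"
    and f2: "\<And>i k. k \<in> P \<Longrightarrow> i \<le> m \<Longrightarrow> pdc p \<rho> (b i) (f1 k) (f2 i k)"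
      "\<And>i k. k \<in> P \<Longrightarrow> i \<le> m \<Longrightarrow> pdc p \<rho> (b k) (f1 i) (f2 i k)"
    using mol by (auto simp: mollified_def)
  have cf1: "continuous_on (ball p \<rho> \<inter> S) (f1 i)" if "i \<le> m" for i
    using f1[OF that] by (simp add: pdc_def)
  have same: "pdc p (\<rho> - \<epsilon>) (b j) (avg \<epsilon> (b j) g) (T g)" if "continuous_on (ball p \<rho> \<inter> S) g" for g :: "'a \<Rightarrow> 'c"
    unfolding T_def using pdc_avg_same[OF that bS[OF j] \<epsilon>] .
  have quot: "pdc p (\<rho> - \<epsilon>) u (T g) (T g')" if "pdc p \<rho> u g g'" for u and g g' :: "'a \<Rightarrow> 'c"
    unfolding T_def using pdc_difference_quotient[OF that bS[OF j] \<epsilon>] .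
  have av: "pdc p (\<rho> - \<epsilon>) (b i) (avg \<epsilon> (b j) g) (avg \<epsilon> (b j) g')"
    if "pdc p \<rho> (b i) g g'" "continuous_on (ball p \<rho> \<inter> S) g" "i \<le> m" for i and g g' :: "'a \<Rightarrow> 'c"
    using pdc_avg[OF that(2,1) bS[OF j] bS[OF that(3)] \<epsilon>] .
  show "mollified p (\<rho> - \<epsilon>) (insert j P) (avg \<epsilon> (b j) f)
    (\<lambda>i. if i = j then T f else avg \<epsilon> (b j) (f1 i))
    (\<lambda>i k. if k = j then T (f1 i) else if i = j then T (f1 k) else avg \<epsilon> (b j) (f2 i k))"
    unfolding mollified_def
  proof (intro conjI ballI allI impI)
    show "continuous_on (ball p (\<rho> - \<epsilon>) \<inter> S) (avg \<epsilon> (b j) f)"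
      using continuous_avg[OF f bS[OF j] \<epsilon>] .
    show "pdc p (\<rho> - \<epsilon>) (b i) (avg \<epsilon> (b j) f) (if i = j then T f else avg \<epsilon> (b j) (f1 i))" if "i \<le> m" for i
      using same[OF f] av[OF f1[OF that] f that] by auto
    fix k i assume k: "k \<in> insert j P" and i: "i \<le> m"
    then have km: "k \<le> m" using P j by auto
    show "pdc p (\<rho> - \<epsilon>) (b i) (if k = j then T f else avg \<epsilon> (b j) (f1 k))
        (if k = j then T (f1 i) else if i = j then T (f1 k) else avg \<epsilon> (b j) (f2 i k))"
      using quot[OF f1[OF i]] same[OF cf1[OF km]] av[OF f2(1)[of k i] cf1[OF km] i] k i by auto
    show "pdc p (\<rho> - \<epsilon>) (b k) (if i = j then T f else avg \<epsilon> (b j) (f1 i))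
        (if k = j then T (f1 i) else if i = j then T (f1 k) else avg \<epsilon> (b j) (f2 i k))"
      using quot[OF f1[OF km]] quot[OF f1[OF i]] same[OF cf1[OF i]] av[OF f2(2)[of k i] cf1[OF i] km] k i
      by auto
  qed
  \<comment> \<open>The difference quotient and the average of \<open>f1 j\<close> are both the
    derivative of the averaged function along \<open>b j\<close>, hence equal. This carries the
    Dirac equation through the averaging.\<close>
  show "i \<le> m \<Longrightarrow> x \<in> ball p (\<rho> - \<epsilon>) \<inter> S \<Longrightarrow>
      (if i = j then T f else avg \<epsilon> (b j) (f1 i)) x = avg \<epsilon> (b j) (f1 i) x"
    using same[OF f] av[OF f1[OF j] f j] has_dd_unique[of "b j" "avg \<epsilon> (b j) f" "T f x" x]
    by (simp add: pdc_def)
qed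

text \<open>Stone--Weierstrass yields polynomials in all coordinates of the ambient space; composing
  with the projection onto \<open>S\<close> leaves only frame coordinates and changes nothing on
  \<open>S\<close>.\<close>

lemma proj_poly_fun:
  assumes "real_polynomial_function g"
  shows "poly_fun (\<lambda>x. g (\<Sum>i=0..m. (x \<bullet> b i) *\<^sub>R b i))"
  using assms
proof (induction rule: real_polynomial_function.induct)
  case (linear f)
  then have "f (\<Sum>i=0..m. (x \<bullet> b i) *\<^sub>R b i) = (\<Sum>i=0..m. f (b i) * (x \<bullet> b i))" for x
    by (simp add: linear_sum linear_cmul bounded_linear.linear mult.commute)
  then show ?case
    by (auto intro!: poly_fun_sum poly_fun_scale poly_fun_inner)
qed (auto intro: poly_fun.const poly_fun.add poly_fun_mult)

text \<open>A polynomial close to \<open>u\<close> on the sphere is replaced by the harmonic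
  extension of its boundary values; the maximum principle, applied to \<open>u - h\<close> and
  \<open>h - u\<close>, spreads the estimate over the ball.\<close>

lemma harmonic_approximation:
  fixes u :: "'a \<Rightarrow> real"
  assumes p: "p \<in> S" and r: "0 < r" "r < R" and e: "e > 0"
    and mol: "mollified p R {0..m} u u1 u2"
    and harmonic: "\<And>x. x \<in> ball p R \<inter> S \<Longrightarrow> (\<Sum>i=0..m. u2 i i x) = 0"
  obtains h where "poly_fun h" "lap h = (\<lambda>x. 0)" "\<And>x. x \<in> cball p r \<inter> S \<Longrightarrow> \<bar>u x - h x\<bar> \<le> e"
proof -
  have cu: "continuous_on (cball p r \<inter> S) u"
    using mol r by (auto simp: mollified_def intro: continuous_on_subset)
  have comp: "compact (sphere p r \<inter> S)"
    by (intro compact_Int_closed compact_sphere closed_subspace subspace_span)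
  obtain g where g: "real_polynomial_function g" "\<forall>x\<in>sphere p r \<inter> S. \<bar>u x - g x\<bar> < e"
  proof (rule Stone_Weierstrass_real_polynomial_function[OF comp _ e])
    show "continuous_on (sphere p r \<inter> S) u" by (rule continuous_on_subset[OF cu]) auto
  qed (use that in blast)
  let ?P = "\<lambda>x. \<Sum>i=0..m. (x \<bullet> b i) *\<^sub>R b i"
  have pf: "poly_fun (\<lambda>y. g (?P (p + 1 *\<^sub>R y)))"
    by (rule poly_fun_affine[OF proj_poly_fun[OF g(1)]])
  obtain v where v: "harm v" "\<forall>x. rho x = r\<^sup>2 \<longrightarrow> v x = g (?P (p + 1 *\<^sub>R x))"
    using dirichlet_poly[OF pf] by blast
  \<comment> \<open>\<open>v\<close> has the right values on the sphere about 0; the translation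
    moves it to the sphere about \<open>p\<close>.\<close>
  define h where "h = (\<lambda>x. v (- p + 1 *\<^sub>R x))"
  have h: "poly_fun h" "lap h = (\<lambda>x. 0)"
    using poly_fun_affine[OF harm_poly_fun[OF v(1)], of "- p" 1]
      lap_affine[OF harm_poly_fun[OF v(1)], of "- p" 1] harm_lap[OF v(1)]
    unfolding h_def by simp_all
  have bd: "\<bar>u x - h x\<bar> \<le> e" if x: "x \<in> sphere p r \<inter> S" for x
  proof -
    have "x - p \<in> S" using x p by (auto intro: span_diff)
    then have "rho (x - p) = r\<^sup>2" using x by (simp add: rho_S dist_norm norm_minus_commute)
    then have "h x = g (?P x)" using v(2) by (simp add: h_def)
    also have "?P x = x" using x S_expand[of x] by simp
    finally show ?thesis using bspec[OF g(2) x] by simp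
  qed
  have dd: "has_dd (b i) u (u1 i x) x" "has_dd (b i) (u1 i) (u2 i i x) x"
    if "x \<in> ball p r \<inter> S" "i \<le> m" for x i
  proof -
    have "x \<in> ball p R \<inter> S" using that r by auto
    then show "has_dd (b i) u (u1 i x) x" "has_dd (b i) (u1 i) (u2 i i x) x"
      using mol that(2) by (auto simp: mollified_def pdc_def)
  qed
  have hd: "has_dd (b i) h (pd i h x) x" "has_dd (b i) (pd i h) (pd i (pd i h) x) x" for x i
    using h(1) by (auto intro: poly_fun_has_dd poly_fun_partial_deriv)
  have sum0: "(\<Sum>i=0..m. u2 i i x - pd i (pd i h) x) = 0" "(\<Sum>i=0..m. pd i (pd i h) x - u2 i i x) = 0"
    if "x \<in> ball p r \<inter> S" for x
  proof -
    have "x \<in> ball p R \<inter> S" using that r by auto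
    then have "(\<Sum>i=0..m. u2 i i x) = 0" by (rule harmonic)
    moreover have "(\<Sum>i=0..m. pd i (pd i h) x) = 0" using h(2) unfolding lap_def by metis
    ultimately show "(\<Sum>i=0..m. u2 i i x - pd i (pd i h) x) = 0" "(\<Sum>i=0..m. pd i (pd i h) x - u2 i i x) = 0"
      by (auto simp: sum_subtractf)
  qed
  have ch: "continuous_on (cball p r \<inter> S) h" using h(1) by (rule continuous_poly_fun)
  have "\<bar>u x - h x\<bar> \<le> e" if x: "x \<in> cball p r \<inter> S" for x
  proof -
    have "u x - h x \<le> e"
    proof (rule max_principle[OF p continuous_on_diff[OF cu ch] _ _ sum0(1) _ x])
      fix y i assume y: "y \<in> ball p r \<inter> S" "i \<le> m"
      show "has_dd (b i) (\<lambda>x. u x - h x) (u1 i y - pd i h y) y"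
        by (intro has_dd_diff dd y hd)
      show "has_dd (b i) (\<lambda>x. u1 i x - pd i h x) (u2 i i y - pd i (pd i h) y) y"
        by (intro has_dd_diff dd y hd)
    next
      fix y assume y: "y \<in> sphere p r \<inter> S"
      show "u y - h y \<le> e" using bd[OF y] by (simp add: abs_le_iff)
    qed
    moreover have "h x - u x \<le> e"
    proof (rule max_principle[OF p continuous_on_diff[OF ch cu] _ _ sum0(2) _ x])
      fix y i assume y: "y \<in> ball p r \<inter> S" "i \<le> m"
      show "has_dd (b i) (\<lambda>x. h x - u x) (pd i h y - u1 i y) y"
        by (intro has_dd_diff dd y hd)
      show "has_dd (b i) (\<lambda>x. pd i h x - u1 i x) (pd i (pd i h) y - u2 i i y) y"
        by (intro has_dd_diff dd y hd)
    next
      fix y assume y: "y \<in> sphere p r \<inter> S"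
      show "h y - u y \<le> e" using bd[OF y] by (simp add: abs_le_iff)
    qed
    ultimately show ?thesis by (simp add: abs_le_iff)
  qed
  with h that show ?thesis by blast
qed

lemma mollified_inner:
  assumes "mollified p R P f f1 f2"
  shows "mollified p R P (\<lambda>x. f x \<bullet> w) (\<lambda>i x. f1 i x \<bullet> w) (\<lambda>i j x. f2 i j x \<bullet> w)"
  using assms unfolding mollified_def pdc_def
  by (auto intro!: continuous_intros has_dd_bounded_linear[OF bounded_linear_inner_left])

text \<open>\<open>c\<close> is the distance already accumulated between \<open>f\<close> and the
  target \<open>g\<close>, and \<eta> is the oscillation of \<open>g\<close> over the
  segment.\<close>

lemma avg_close:
  fixes f g :: "'a \<Rightarrow> 'c::euclidean_space"
  assumes f: "continuous_on (ball p \<rho> \<inter> S) f" and w: "w \<in> S" "norm w = 1" and \<epsilon>: "\<epsilon> > 0"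
    and x: "x \<in> ball p (\<rho> - \<epsilon>) \<inter> S"
    and fg: "\<And>y. y \<in> ball p \<rho> \<inter> S \<Longrightarrow> norm (f y - g y) \<le> c"
    and g: "\<And>y. y \<in> ball p \<rho> \<inter> S \<Longrightarrow> dist y x \<le> \<epsilon> \<Longrightarrow> norm (g y - g x) \<le> \<eta>"
  shows "norm (avg \<epsilon> w f x - g x) \<le> c + \<eta>"
proof -
  have "((\<lambda>s. f (x + (\<epsilon> * s) *\<^sub>R w) - g x) has_integral avg \<epsilon> w f x - g x) (cbox 0 1)"
    using has_integral_diff[OF integrable_integral[OF avg_integrable[OF f w \<epsilon> x]]
        has_integral_const[of "g x" 0 1]]
    by (simp add: avg_def)
  then have "norm (avg \<epsilon> w f x - g x) \<le> (c + \<eta>) * measure lborel (cbox 0 (1::real))"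
  proof (rule has_integral_bound[rotated])
    show le: "norm (f (x + (\<epsilon> * s) *\<^sub>R w) - g x) \<le> c + \<eta>" if s: "s \<in> cbox 0 1" for s
    proof -
      let ?y = "x + (\<epsilon> * s) *\<^sub>R w"
      have y: "?y \<in> ball p \<rho> \<inter> S" using avg_shift_in_ball[OF x w \<epsilon> s] .
      have "dist ?y x \<le> \<epsilon>" using s \<epsilon> w by (simp add: dist_norm abs_mult mult_left_le)
      then have "norm (g ?y - g x) \<le> \<eta>" using g[OF y] by simp
      moreover have "norm (f ?y - g x) \<le> norm (f ?y - g ?y) + norm (g ?y - g x)"
        using norm_triangle_ineq[of "f ?y - g ?y" "g ?y - g x"] by simp
      ultimately show ?thesis using fg[OF y] by linarith
    qed
    show "0 \<le> c + \<eta>"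
      using order_trans[OF norm_ge_zero le[of 0]] by simp
  qed
  then show ?thesis by simp
qed

end

section \<open>Clifford relations and the factorisation of the Laplacian\<close>

locale clifford_frame = orthonormal_frame b m
  for b :: "nat \<Rightarrow> 'a::{real_algebra_1, euclidean_space}" and m +
  assumes b_0: "b 0 = 1"
    and b_square: "1 \<le> i \<Longrightarrow> i \<le> m \<Longrightarrow> b i * b i = - 1"
    and b_anticommute: "1 \<le> i \<Longrightarrow> i \<le> m \<Longrightarrow> 1 \<le> j \<Longrightarrow> j \<le> m \<Longrightarrow> i \<noteq> j \<Longrightarrow> b i * b j = - (b j * b i)"

lemma bounded_linear_mult_algebra:
  fixes c :: "'a::{real_algebra_1, euclidean_space}"
  shows "bounded_linear (\<lambda>x. c * x)"
  by (simp add: linear_conv_bounded_linear[symmetric] linear_iff distrib_left)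

context clifford_frame
begin

text \<open>With \<open>F\<close> the matrix of second derivatives, this is the factorisation of the
  Laplacian into the conjugate Dirac operator and the Dirac operator.\<close>

lemma dirac_square_symmetric:
  fixes F :: "nat \<Rightarrow> nat \<Rightarrow> 'a"
  assumes sym: "\<And>i k. i \<le> m \<Longrightarrow> k \<le> m \<Longrightarrow> F i k = F k i"
    and zero: "\<And>k. k \<le> m \<Longrightarrow> (\<Sum>i=0..m. b i * F k i) = 0"
  shows "(\<Sum>i=0..m. F i i) = 0"
proof -
  \<comment> \<open>\<open>c k i\<close> is the conjugate of \<open>b k\<close> times
    \<open>b i\<close>; by the Clifford relations its symmetric part is the identity matrix.\<close>
  define c where "c k i = (if k = 0 then b i else - (b k * b i))" for k i
  have cc: "c k i + c i k = (if i = k then 2 else 0)" if "i \<le> m" "k \<le> m" for i k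
    using that b_square[of k] b_anticommute[of i k] b_0 by (auto simp: c_def)
  have "(\<Sum>i=0..m. c k i * F k i) = 0" if "k \<le> m" for k
  proof -
    have "(\<Sum>i=0..m. c k i * F k i) = (if k = 0 then 1 else - b k) * (\<Sum>i=0..m. b i * F k i)"
      unfolding sum_distrib_left by (intro sum.cong) (auto simp: c_def mult.assoc)
    then show ?thesis using zero[OF that] by simp
  qed
  then have z: "(\<Sum>k=0..m. \<Sum>i=0..m. c k i * F k i) = 0" by simp
  moreover have "(\<Sum>k=0..m. \<Sum>i=0..m. c k i * F k i) = (\<Sum>k=0..m. \<Sum>i=0..m. c i k * F k i)"
    by (subst sum.swap) (intro sum.cong refl, simp add: sym)
  ultimately have "0 = (\<Sum>k=0..m. \<Sum>i=0..m. c k i * F k i) + (\<Sum>k=0..m. \<Sum>i=0..m. c i k * F k i)"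
    by simp
  also have "\<dots> = (\<Sum>k=0..m. \<Sum>i=0..m. (c k i + c i k) * F k i)"
    by (simp add: sum.distrib distrib_right)
  also have "\<dots> = (\<Sum>k=0..m. \<Sum>i=0..m. if i = k then 2 * F k k else 0)"
    by (intro sum.cong refl) (auto simp: cc)
  also have "\<dots> = (\<Sum>k=0..m. 2 * F k k)" by simp
  also have "\<dots> = 2 *\<^sub>R (\<Sum>k=0..m. F k k)"
    by (simp add: scaleR_2 sum.distrib mult_2)
  finally show ?thesis by simp
qed

lemma dirac_avg:
  assumes c: "\<And>i. i \<le> m \<Longrightarrow> continuous_on (ball p \<rho> \<inter> S) (f i)"
    and z: "\<And>x. x \<in> ball p \<rho> \<inter> S \<Longrightarrow> (\<Sum>i=0..m. b i * f i x) = 0"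
    and w: "w \<in> S" "norm w = 1" and \<epsilon>: "\<epsilon> > 0" and x: "x \<in> ball p (\<rho> - \<epsilon>) \<inter> S"
  shows "(\<Sum>i=0..m. b i * avg \<epsilon> w (f i) x) = 0"
proof -
  have "((\<lambda>s. \<Sum>i=0..m. b i * f i (x + (\<epsilon> * s) *\<^sub>R w)) has_integral (\<Sum>i=0..m. b i * avg \<epsilon> w (f i) x)) (cbox 0 1)"
    unfolding avg_def
    by (intro has_integral_sum has_integral_linear[OF _ bounded_linear_mult_algebra, unfolded o_def]
        integrable_integral avg_integrable[OF c w \<epsilon> x]) auto
  moreover have "((\<lambda>s. \<Sum>i=0..m. b i * f i (x + (\<epsilon> * s) *\<^sub>R w)) has_integral 0) (cbox 0 1)"
    using z[OF avg_shift_in_ball[OF x w \<epsilon>]] by (intro has_integral_is_0) auto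
  ultimately show ?thesis by (rule has_integral_unique)
qed

text \<open>One average is taken per frame direction; each costs \<epsilon> in the radius and
  \<open>\<eta>'\<close> in the distance to \<open>f\<close>.\<close>

lemma mollify:
  fixes f :: "'a \<Rightarrow> 'a"
  assumes p: "p \<in> S" and r: "r < R" and \<eta>: "\<eta> > 0"
    and f: "continuous_on (ball p R \<inter> S) f" and f1: "\<And>i. i \<le> m \<Longrightarrow> pdc p R (b i) f (f1 i)"
    and z: "\<And>x. x \<in> ball p R \<inter> S \<Longrightarrow> (\<Sum>i=0..m. b i * f1 i x) = 0"
  obtains \<rho> g g1 g2 where "r < \<rho>" "mollified p \<rho> {0..m} g g1 g2"
    "\<And>x. x \<in> ball p \<rho> \<inter> S \<Longrightarrow> (\<Sum>i=0..m. g2 i i x) = 0"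
    "\<And>x. x \<in> ball p \<rho> \<inter> S \<Longrightarrow> norm (g x - f x) \<le> \<eta>"
proof -
  define r' where "r' = (r + R) / 2"
  have r': "r < r'" "r' < R" using r by (auto simp: r'_def)
  define \<eta>' where "\<eta>' = \<eta> / (real m + 1)"
  have \<eta>': "\<eta>' > 0" using \<eta> by (simp add: \<eta>'_def)
  have "compact (cball p r' \<inter> S)"
    by (intro compact_Int_closed compact_cball closed_subspace subspace_span)
  moreover have "continuous_on (cball p r' \<inter> S) f"
    using r' by (intro continuous_on_subset[OF f]) auto
  ultimately have "uniformly_continuous_on (cball p r' \<inter> S) f"
    by (rule compact_uniformly_continuous[rotated])
  then obtain d where d: "d > 0"
    "\<And>x y. x \<in> cball p r' \<inter> S \<Longrightarrow> y \<in> cball p r' \<inter> S \<Longrightarrow> dist y x < d \<Longrightarrow> dist (f y) (f x) < \<eta>'"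
    unfolding uniformly_continuous_on_def using \<eta>' by metis
  \<comment> \<open>The first bound serves the uniform continuity of \<open>f\<close>; by the
    second, m + 1 shrinkings use up at most half of \<open>r' - r\<close>.\<close>
  define \<epsilon> where "\<epsilon> = min (d / 2) ((r' - r) / (2 * (real m + 1)))"
  have \<epsilon>: "\<epsilon> > 0" "\<epsilon> < d" using d(1) r' by (auto simp: \<epsilon>_def)
  define \<rho> where "\<rho> k = r' - real k * \<epsilon>" for k
  have \<rho>_le: "\<rho> k \<le> r'" for k using \<epsilon> by (simp add: \<rho>_def)
  have ball_sub: "ball p (\<rho> k) \<inter> S \<subseteq> cball p r' \<inter> S" for k using \<rho>_le[of k] by auto
  have sub: "ball p r' \<inter> S \<subseteq> ball p R \<inter> S" using r' by auto
  have "\<exists>g g1 g2. mollified p (\<rho> k) {0..<k} g g1 g2 \<and>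
      (\<forall>x\<in>ball p (\<rho> k) \<inter> S. (\<Sum>i=0..m. b i * g1 i x) = 0) \<and>
      (\<forall>x\<in>ball p (\<rho> k) \<inter> S. norm (g x - f x) \<le> real k * \<eta>')" if "k \<le> Suc m" for k
    using that
  proof (induction k)
    case 0
    \<comment> \<open>No direction has been averaged over yet, so the second derivatives are
      arbitrary.\<close>
    have "mollified p (\<rho> 0) {0..<0} f f1 (\<lambda>i j x. 0)"
      using f f1 sub
      by (auto simp: mollified_def pdc_def \<rho>_def intro: continuous_on_subset)
    then show ?case using z sub by (auto simp: \<rho>_def intro!: exI[of _ f] exI[of _ f1])
  next
    case (Suc k)
    then obtain g g1 g2 where g: "mollified p (\<rho> k) {0..<k} g g1 g2"
      "\<And>x. x \<in> ball p (\<rho> k) \<inter> S \<Longrightarrow> (\<Sum>i=0..m. b i * g1 i x) = 0"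
      "\<And>x. x \<in> ball p (\<rho> k) \<inter> S \<Longrightarrow> norm (g x - f x) \<le> real k * \<eta>'"
      by force
    have k: "k \<le> m" "{0..<k} \<subseteq> {0..m}" using Suc.prems by auto
    have \<rho>S: "\<rho> (Suc k) = \<rho> k - \<epsilon>" by (simp add: \<rho>_def algebra_simps)
    have "{0..<Suc k} = insert k {0..<k}" by auto
    note mol = mollified_avg[OF g(1) k(2,1) \<epsilon>(1), folded \<rho>S this]
    have bk: "b k \<in> S" "norm (b k) = 1" using k b_in_S norm_b by auto
    have cg: "continuous_on (ball p (\<rho> k) \<inter> S) g" "\<And>i. i \<le> m \<Longrightarrow> continuous_on (ball p (\<rho> k) \<inter> S) (g1 i)"
      using g(1) by (auto simp: mollified_def pdc_def)
    show ?case
    proof (intro exI conjI ballI)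
      show "mollified p (\<rho> (Suc k)) {0..<Suc k} (avg \<epsilon> (b k) g)
        (\<lambda>i. if i = k then \<lambda>x. (1 / \<epsilon>) *\<^sub>R (g (x + \<epsilon> *\<^sub>R b k) - g x) else avg \<epsilon> (b k) (g1 i))
        (\<lambda>i ka. if ka = k then \<lambda>x. (1 / \<epsilon>) *\<^sub>R (g1 i (x + \<epsilon> *\<^sub>R b k) - g1 i x)
          else if i = k then \<lambda>x. (1 / \<epsilon>) *\<^sub>R (g1 ka (x + \<epsilon> *\<^sub>R b k) - g1 ka x)
          else avg \<epsilon> (b k) (g2 i ka))"
        by (rule mol(1))
      fix x assume x: "x \<in> ball p (\<rho> (Suc k)) \<inter> S"
      have "(\<Sum>i=0..m. b i * (if i = k then \<lambda>x. (1 / \<epsilon>) *\<^sub>R (g (x + \<epsilon> *\<^sub>R b k) - g x)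
          else avg \<epsilon> (b k) (g1 i)) x) = (\<Sum>i=0..m. b i * avg \<epsilon> (b k) (g1 i) x)"
        using mol(2) x by (intro sum.cong refl arg_cong2[where f = "(*)"]) auto
      also have "\<dots> = 0"
        using cg(2) g(2) bk \<epsilon>(1) x unfolding \<rho>S by (rule dirac_avg)
      finally show "(\<Sum>i=0..m. b i * (if i = k then \<lambda>x. (1 / \<epsilon>) *\<^sub>R (g (x + \<epsilon> *\<^sub>R b k) - g x)
          else avg \<epsilon> (b k) (g1 i)) x) = 0" .
      have "norm (avg \<epsilon> (b k) g x - f x) \<le> real k * \<eta>' + \<eta>'"
      proof (rule avg_close[OF cg(1) bk \<epsilon>(1) x[unfolded \<rho>S] g(3)])
        fix y assume y: "y \<in> ball p (\<rho> k) \<inter> S" "dist y x \<le> \<epsilon>"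
        have "x \<in> cball p r' \<inter> S" "y \<in> cball p r' \<inter> S" using x y ball_sub by blast+
        with d(2) y(2) \<epsilon>(2) have "dist (f y) (f x) < \<eta>'" by auto
        then show "norm (f y - f x) \<le> \<eta>'" by (simp add: dist_norm)
      qed
      then show "norm (avg \<epsilon> (b k) g x - f x) \<le> real (Suc k) * \<eta>'"
        by (simp add: algebra_simps)
    qed
  qed
  then obtain g g1 g2 where g: "mollified p (\<rho> (Suc m)) {0..<Suc m} g g1 g2"
      "\<And>x. x \<in> ball p (\<rho> (Suc m)) \<inter> S \<Longrightarrow> (\<Sum>i=0..m. b i * g1 i x) = 0"
      "\<And>x. x \<in> ball p (\<rho> (Suc m)) \<inter> S \<Longrightarrow> norm (g x - f x) \<le> real (Suc m) * \<eta>'"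
    by blast
  have atm: "{0..<Suc m} = {0..m}" by auto
  have "r < \<rho> (Suc m)"
  proof -
    have "real (Suc m) * \<epsilon> \<le> real (Suc m) * ((r' - r) / (2 * (real m + 1)))"
      by (intro mult_left_mono) (auto simp: \<epsilon>_def)
    also have "\<dots> = (r' - r) / 2" by (simp add: field_simps)
    finally show ?thesis using r'(1) unfolding \<rho>_def by argo
  qed
  moreover have "(\<Sum>i=0..m. g2 i i x) = 0" if x: "x \<in> ball p (\<rho> (Suc m)) \<inter> S" for x
  proof (rule dirac_square_symmetric[where F = "\<lambda>i k. g2 i k x"])
    have dd: "has_dd (b i) (g1 k) (g2 i k x) x" "has_dd (b k) (g1 i) (g2 i k x) x"
      if "i \<le> m" "k \<le> m" for i k
      using g(1) that x by (auto simp: mollified_def pdc_def)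
    then show "g2 i k x = g2 k i x" if "i \<le> m" "k \<le> m" for i k
      using that has_dd_unique by blast
    fix k assume k: "k \<le> m"
    \<comment> \<open>Differentiating the Dirac equation along \<open>b k\<close> supplies the
      hypothesis of the factorisation.\<close>
    have "has_dd (b k) (\<lambda>x. \<Sum>i=0..m. b i * g1 i x) (\<Sum>i=0..m. b i * g2 k i x) x"
      by (intro has_dd_sum has_dd_bounded_linear[OF bounded_linear_mult_algebra] dd) (use k in auto)
    moreover have "has_dd (b k) (\<lambda>x. \<Sum>i=0..m. b i * g1 i x) 0 x"
      by (rule has_dd_cong[OF has_dd_const openin_ball_S subspace_span b_in_S[OF k] x])
        (simp only: g(2))
    ultimately show "(\<Sum>i=0..m. b i * g2 k i x) = 0" by (rule has_dd_unique)
  qed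
  moreover have "real (Suc m) * \<eta>' = \<eta>" by (simp add: \<eta>'_def field_simps)
  ultimately show ?thesis
    using g(1,3) by (intro that[of "\<rho> (Suc m)" g g1 g2]) (simp_all only: atm)
qed

theorem monogenic_vharm_limit:
  fixes f :: "'a \<Rightarrow> 'a"
  assumes p: "p \<in> S" and R: "R > 0" and mono: "monogenic b m U f" and U: "ball p R \<inter> S \<subseteq> U"
  shows "vharm_limit p R f"
  unfolding vharm_limit_def
proof
  fix w :: 'a
  have dd: "has_dd (b i) f (pd i f x) x" if "i \<le> m" "x \<in> ball p R \<inter> S" for i x
    using mono that U unfolding monogenic_def C1_along_def has_dd_def partial_deriv_def
    by (auto simp: vector_derivative_works)
  have cont: "continuous_on (ball p R \<inter> S) (pd i f)" if "i \<le> m" for i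
    using mono that U unfolding monogenic_def C1_along_def by (auto intro: continuous_on_subset)
  have f: "continuous_on (ball p R \<inter> S) f"
    by (rule C1_continuous[OF dd cont])
  have pdc: "pdc p R (b i) f (pd i f)" if "i \<le> m" for i
    using dd cont that by (simp add: pdc_def)
  have z: "(\<Sum>i=0..m. b i * pd i f x) = 0" if "x \<in> ball p R \<inter> S" for x
    using mono that U by (auto simp: monogenic_def)
  have ex: "\<exists>h. poly_fun h \<and> lap h = (\<lambda>x. 0) \<and> (\<forall>x\<in>cball p r \<inter> S. \<bar>f x \<bullet> w - h x\<bar> \<le> e)"
    if r: "0 < r" "r < R" and e: "e > 0" for r e
  proof -
    define \<eta> where "\<eta> = e / (2 * (norm w + 1))"
    have nw: "norm w + 1 > 0" by (simp add: add_nonneg_pos)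
    have \<eta>: "\<eta> > 0" using e nw by (simp add: \<eta>_def)
    obtain \<rho> g g1 g2 where g: "r < \<rho>" "mollified p \<rho> {0..m} g g1 g2"
      "\<And>x. x \<in> ball p \<rho> \<inter> S \<Longrightarrow> (\<Sum>i=0..m. g2 i i x) = 0"
      "\<And>x. x \<in> ball p \<rho> \<inter> S \<Longrightarrow> norm (g x - f x) \<le> \<eta>"
      using mollify[OF p r(2) \<eta> f pdc z] by blast
    have "(\<Sum>i=0..m. g2 i i x \<bullet> w) = 0" if "x \<in> ball p \<rho> \<inter> S" for x
      using g(3)[OF that] by (simp flip: inner_sum_left)
    from harmonic_approximation[OF p r(1) g(1) _ mollified_inner[OF g(2), of w] this, of "e / 2"] e
    obtain h where h: "poly_fun h" "lap h = (\<lambda>x. 0)" "\<And>x. x \<in> cball p r \<inter> S \<Longrightarrow> \<bar>g x \<bullet> w - h x\<bar> \<le> e / 2"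
      by auto
    have "\<bar>f x \<bullet> w - h x\<bar> \<le> e" if x: "x \<in> cball p r \<inter> S" for x
    proof -
      have "\<bar>(g x - f x) \<bullet> w\<bar> \<le> norm (g x - f x) * norm w" by (rule Cauchy_Schwarz_ineq2)
      also have "\<dots> \<le> \<eta> * (norm w + 1)"
        using g(4)[of x] x g(1) \<eta> by (intro mult_mono) auto
      also have "\<dots> = e / 2" using nw by (simp add: \<eta>_def field_simps)
      finally have "\<bar>g x \<bullet> w - f x \<bullet> w\<bar> \<le> e / 2" by (simp add: inner_diff_left)
      then show ?thesis using h(3)[OF x] by linarith
    qed
    then show ?thesis using h by blast
  qed
  \<comment> \<open>Radii tending to \<open>R\<close>; the offset 2 keeps \<open>r 0\<close>
    positive.\<close>
  define r where "r n = R - R / (real n + 2)" for n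
  have r: "0 < r n" "r n < R" for n
    using R by (auto simp: r_def field_simps intro!: add_pos_nonneg)
  have "\<exists>h. poly_fun h \<and> lap h = (\<lambda>x. 0) \<and> (\<forall>x\<in>cball p (r n) \<inter> S. \<bar>f x \<bullet> w - h x\<bar> \<le> 1 / (real n + 1))" for n
    by (rule ex[OF r]) simp
  then obtain h where h: "\<And>n. poly_fun (h n)" "\<And>n. lap (h n) = (\<lambda>x. 0)"
    "\<And>n x. x \<in> cball p (r n) \<inter> S \<Longrightarrow> \<bar>f x \<bullet> w - h n x\<bar> \<le> 1 / (real n + 1)"
    by metis
  have "uniform_limit (cball p s \<inter> S) h (\<lambda>x. f x \<bullet> w) sequentially" if s: "s < R" for s
  proof (rule uniform_limitI)
    fix e :: real assume e: "e > 0"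
    have "(\<lambda>n. R - R / (real n + 2)) \<longlonglongrightarrow> R - 0"
      using LIMSEQ_ignore_initial_segment[OF lim_const_over_n[of R], of 2]
      by (intro tendsto_intros) (simp add: add.commute)
    then have "\<forall>\<^sub>F n in sequentially. s < r n"
      unfolding r_def using s by (intro order_tendstoD(1)) auto
    moreover have "(\<lambda>n. 1 / (real n + 1)) \<longlonglongrightarrow> 0"
      using LIMSEQ_inverse_real_of_nat by (simp add: inverse_eq_divide add.commute)
    then have "\<forall>\<^sub>F n in sequentially. 1 / (real n + 1) < e"
      using e by (intro order_tendstoD(2)) auto
    ultimately show "\<forall>\<^sub>F n in sequentially. \<forall>x\<in>cball p s \<inter> S. dist (h n x) (f x \<bullet> w) < e"
    proof eventually_elim
      case (elim n)
      show ?case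
      proof
        fix x assume "x \<in> cball p s \<inter> S"
        then have "x \<in> cball p (r n) \<inter> S" using elim(1) by auto
        from h(3)[OF this] elim(2) show "dist (h n x) (f x \<bullet> w) < e"
          by (simp add: dist_real_def abs_minus_commute)
      qed
    qed
  qed
  then show "\<exists>h. harm_limit p R h (\<lambda>x. f x \<bullet> w)" using h unfolding harm_limit_def by blast
qed

end

section \<open>Fueter polynomials and the Taylor expansion on a slice\<close>

lemma finite_multi_indices: "finite (multi_indices m K)"
proof (rule finite_subset)
  show "multi_indices m K \<subseteq> {k. \<forall>s. (s \<in> {1..m} \<longrightarrow> k s \<in> {0..K}) \<and> (s \<notin> {1..m} \<longrightarrow> k s = 0)}"
    unfolding multi_indices_def by (auto intro!: member_le_sum)
qed (rule finite_set_of_finite_funs; simp)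

lemma multi_indices_0: "multi_indices m 0 = {\<lambda>s. 0}"
proof -
  have "k s = 0" if "\<forall>s. s \<notin> {1..m} \<longrightarrow> k s = 0" "(\<Sum>s=1..m. k s) = 0" for k :: "nat \<Rightarrow> nat" and s
    using that by (cases "s \<in> {1..m}") auto
  then show ?thesis by (auto simp: multi_indices_def)
qed

lemma sum_fun_upd_Suc:
  fixes k :: "nat \<Rightarrow> nat"
  assumes "i \<in> {1..m}"
  shows "(\<Sum>s=1..m. (k(i := Suc (k i))) s) = Suc (\<Sum>s=1..m. k s)"
proof -
  have "(\<Sum>s\<in>{1..m} - {i}. (k(i := Suc (k i))) s) = (\<Sum>s\<in>{1..m} - {i}. k s)"
    by (intro sum.cong) auto
  then show ?thesis
    using sum.remove[OF finite_atLeastAtMost assms, of k]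
      sum.remove[OF finite_atLeastAtMost assms, of "k(i := Suc (k i))"] by simp
qed

lemma multi_fact_Suc:
  assumes "i \<in> {1..m}"
  shows "multi_fact m (k(i := Suc (k i))) = real (Suc (k i)) * multi_fact m k"
proof -
  have "(\<Prod>s\<in>{1..m} - {i}. fact ((k(i := Suc (k i))) s)) = (\<Prod>s\<in>{1..m} - {i}. fact (k s) :: real)"
    by (intro prod.cong) auto
  then show ?thesis
    using prod.remove[OF finite_atLeastAtMost assms, of "\<lambda>s. fact (k s) :: real"]
      prod.remove[OF finite_atLeastAtMost assms, of "\<lambda>s. fact ((k(i := Suc (k i))) s) :: real"]
    unfolding multi_fact_def by simp
qed

lemma multi_indices_Suc_image:
  assumes i: "i \<in> {1..m}"
  shows "(\<lambda>k. k(i := Suc (k i))) ` multi_indices m K = {k \<in> multi_indices m (Suc K). k i > 0}"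
proof (intro equalityI subsetI)
  fix k assume "k \<in> (\<lambda>k. k(i := Suc (k i))) ` multi_indices m K"
  then show "k \<in> {k \<in> multi_indices m (Suc K). k i > 0}"
    using i sum_fun_upd_Suc[OF i] by (auto simp: multi_indices_def)
next
  fix k assume k: "k \<in> {k \<in> multi_indices m (Suc K). k i > 0}"
  define k' where "k' = k(i := k i - 1)"
  have eq: "k = k'(i := Suc (k' i))" using k by (auto simp: k'_def)
  have "Suc (\<Sum>s=1..m. k' s) = Suc K"
    using sum_fun_upd_Suc[OF i, of k'] k by (simp add: multi_indices_def flip: eq)
  then have "k' \<in> multi_indices m K"
    using k i by (auto simp: multi_indices_def k'_def)
  then show "k \<in> (\<lambda>k. k(i := Suc (k i))) ` multi_indices m K"
    using eq by blast
qed

text \<open>Raising the entry \<open>i\<close> by one is a bijection onto the multi-indices of the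
  next degree whose entry \<open>i\<close> is positive; the remaining ones contribute zero.\<close>

lemma sum_multi_indices_Suc:
  fixes G :: "(nat \<Rightarrow> nat) \<Rightarrow> 'a::comm_monoid_add"
  assumes i: "i \<in> {1..m}" and G: "\<And>k. k i = 0 \<Longrightarrow> G k = 0"
  shows "(\<Sum>k\<in>multi_indices m (Suc K). G k) = (\<Sum>k\<in>multi_indices m K. G (k(i := Suc (k i))))"
proof -
  have inj: "inj_on (\<lambda>k. k(i := Suc (k i))) (multi_indices m K)"
  proof (rule inj_onI)
    fix k k' :: "nat \<Rightarrow> nat" assume eq: "k(i := Suc (k i)) = k'(i := Suc (k' i))"
    show "k = k'"
    proof
      fix s show "k s = k' s" using fun_cong[OF eq, of s] by (cases "s = i") auto
    qed
  qed
  have "(\<Sum>k\<in>multi_indices m (Suc K). G k) = (\<Sum>k\<in>{k \<in> multi_indices m (Suc K). k i > 0}. G k)"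
    using G by (intro sum.mono_neutral_right) (auto simp: finite_multi_indices)
  also have "\<dots> = (\<Sum>k\<in>multi_indices m K. G (k(i := Suc (k i))))"
    unfolding multi_indices_Suc_image[OF i, symmetric] by (rule sum.reindex[OF inj, unfolded o_def])
  finally show ?thesis .
qed

section \<open>Iterated derivatives of limits of harmonic polynomials\<close>

context orthonormal_frame
begin

lemma dd_cong_ball:
  fixes f g :: "'a \<Rightarrow> 'c::real_normed_vector"
  assumes "\<And>x. x \<in> ball p R \<inter> S \<Longrightarrow> f x = g x" "u \<in> S" "x \<in> ball p R \<inter> S"
  shows "partial_deriv u f x = partial_deriv u g x"
  using partial_deriv_cong[OF openin_ball_S subspace_span assms(2,3)] assms(1) by blast

lemma iter_dd_cong_ball:
  fixes f g :: "'a \<Rightarrow> 'c::real_normed_vector"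
  assumes "\<And>x. x \<in> ball p R \<inter> S \<Longrightarrow> f x = g x" "u \<in> S" "x \<in> ball p R \<inter> S"
  shows "(partial_deriv u ^^ n) f x = (partial_deriv u ^^ n) g x"
  using assms(3)
proof (induction n arbitrary: x)
  case (Suc n)
  then show ?case
    using dd_cong_ball[of p R "(partial_deriv u ^^ n) f" "(partial_deriv u ^^ n) g" u x] assms(2) by auto
qed (use assms in auto)

lemma vharm_limit_iter_linear_sum:
  fixes g :: "'i \<Rightarrow> 'a \<Rightarrow> 'c::euclidean_space" and L :: "'i \<Rightarrow> 'c \<Rightarrow> 'd::euclidean_space"
  assumes p: "p \<in> S" and g: "\<And>i. i \<in> A \<Longrightarrow> vharm_limit p R (g i)" and L: "\<And>i. i \<in> A \<Longrightarrow> bounded_linear (L i)"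
    and u: "u \<in> S"
  shows "x \<in> ball p R \<inter> S \<Longrightarrow>
    (partial_deriv u ^^ n) (\<lambda>x. \<Sum>i\<in>A. L i (g i x)) x = (\<Sum>i\<in>A. L i ((partial_deriv u ^^ n) (g i) x))"
proof (induction n arbitrary: x)
  case (Suc n)
  have "partial_deriv u ((partial_deriv u ^^ n) (\<lambda>x. \<Sum>i\<in>A. L i (g i x))) x
      = partial_deriv u (\<lambda>x. \<Sum>i\<in>A. L i ((partial_deriv u ^^ n) (g i) x)) x"
    using Suc u by (intro dd_cong_ball[of p R]) auto
  also have "\<dots> = (\<Sum>i\<in>A. L i (partial_deriv u ((partial_deriv u ^^ n) (g i)) x))"
    using Suc.prems
    by (intro has_dd_partial_deriv has_dd_sum has_dd_bounded_linear[OF L]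
        vharm_limit_has_dd[OF p vharm_limit_iter_dd[OF p g u] u])
  finally show ?case by simp
qed simp

lemma vharm_limit_dd_iter_commute:
  assumes p: "p \<in> S" and f: "vharm_limit p R f" and u: "u \<in> S" and w: "w \<in> S"
  shows "x \<in> ball p R \<inter> S \<Longrightarrow>
    partial_deriv w ((partial_deriv u ^^ n) f) x = (partial_deriv u ^^ n) (partial_deriv w f) x"
proof (induction n arbitrary: x)
  case (Suc n)
  have "partial_deriv w (partial_deriv u ((partial_deriv u ^^ n) f)) x
      = partial_deriv u (partial_deriv w ((partial_deriv u ^^ n) f)) x"
    using vharm_limit_dd_commute[OF p vharm_limit_iter_dd[OF p f u] w u Suc.prems] .
  also have "\<dots> = partial_deriv u ((partial_deriv u ^^ n) (partial_deriv w f)) x"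
    using Suc u by (intro dd_cong_ball[of p R]) auto
  finally show ?case by simp
qed simp

text \<open>\<open>iter_partial\<close> over an arbitrary list of indices, so that inductions over
  the list are possible.\<close>

abbreviation pd_list :: "(nat \<Rightarrow> nat) \<Rightarrow> nat list \<Rightarrow> ('a \<Rightarrow> 'c::real_normed_vector) \<Rightarrow> 'a \<Rightarrow> 'c" where
  "pd_list h L f \<equiv> foldr (\<lambda>i. pd i ^^ h i) L f"

lemma vharm_limit_pd_list: "p \<in> S \<Longrightarrow> vharm_limit p R f \<Longrightarrow> set L \<subseteq> {0..m} \<Longrightarrow> vharm_limit p R (pd_list h L f)"
  by (induction L) (auto intro!: vharm_limit_iter_dd b_in_S)

lemma pd_list_pd_notin:
  assumes p: "p \<in> S" and f: "vharm_limit p R f" and i: "i \<le> m"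
  shows "set L \<subseteq> {0..m} \<Longrightarrow> x \<in> ball p R \<inter> S \<Longrightarrow> pd_list h L (pd i f) x = pd i (pd_list h L f) x"
proof (induction L arbitrary: x)
  case (Cons j L)
  then have j: "b j \<in> S" "b i \<in> S" using i b_in_S by auto
  have "(pd j ^^ h j) (pd_list h L (pd i f)) x = (pd j ^^ h j) (pd i (pd_list h L f)) x"
    using Cons j by (intro iter_dd_cong_ball[of p R]) auto
  also have "\<dots> = pd i ((pd j ^^ h j) (pd_list h L f)) x"
    using Cons.prems j vharm_limit_pd_list[OF p f, of L h] by (intro vharm_limit_dd_iter_commute[symmetric, OF p]) auto
  finally show ?case by simp
qed simp

lemma pd_list_pd:
  assumes p: "p \<in> S" and f: "vharm_limit p R f" and i: "i \<le> m"
  shows "set L \<subseteq> {0..m} \<Longrightarrow> distinct L \<Longrightarrow> i \<in> set L \<Longrightarrow> x \<in> ball p R \<inter> S \<Longrightarrow>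
    pd_list h L (pd i f) x = pd_list (h(i := Suc (h i))) L f x"
proof (induction L arbitrary: x)
  case (Cons j L)
  then have j: "b j \<in> S" "b i \<in> S" using i b_in_S by auto
  show ?case
  proof (cases "i = j")
    case True
    have eq: "pd_list (h(i := Suc (h i))) L f = pd_list h L f"
      using Cons.prems True by (intro foldr_cong) auto
    have "(pd j ^^ h j) (pd_list h L (pd i f)) x = (pd j ^^ h j) (pd i (pd_list h L f)) x"
      using Cons.prems j pd_list_pd_notin[OF p f i, of L] by (intro iter_dd_cong_ball[of p R]) auto
    then show ?thesis using True eq by (simp add: funpow_swap1)
  next
    case False
    have "(pd j ^^ h j) (pd_list h L (pd i f)) x = (pd j ^^ h j) (pd_list (h(i := Suc (h i))) L f) x"
      using Cons False j by (intro iter_dd_cong_ball[of p R]) auto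
    then show ?thesis using False by simp
  qed
qed simp

lemma iter_partial_pd:
  assumes "p \<in> S" "vharm_limit p R f" "i \<le> m" "x \<in> ball p R \<inter> S"
  shows "iter_partial b m h (pd i f) x = iter_partial b m (h(i := Suc (h i))) f x"
  unfolding iter_partial_def using assms by (intro pd_list_pd[OF assms(1,2)]) auto

lemma iter_partial_0: "iter_partial b m (\<lambda>s. 0) f = f"
proof -
  have "pd_list (\<lambda>s. 0) L f = f" for L
    by (induction L) auto
  then show ?thesis by (simp add: iter_partial_def)
qed

end

section \<open>Regular functions and Fueter polynomials\<close>

context clifford_frame
begin

text \<open>The Dirac equation on a ball together with the approximation property; in this form
  monogenicity is inherited by partial derivatives.\<close>

definition regular :: "'a \<Rightarrow> real \<Rightarrow> ('a \<Rightarrow> 'a) \<Rightarrow> bool" where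
  "regular p R f \<longleftrightarrow> vharm_limit p R f \<and> (\<forall>x\<in>ball p R \<inter> S. (\<Sum>i=0..m. b i * pd i f x) = 0)"

lemma monogenic_regular:
  assumes "p \<in> S" "R > 0" "monogenic b m U f" "ball p R \<inter> S \<subseteq> U"
  shows "regular p R f"
  using monogenic_vharm_limit[OF assms] assms(3,4) by (auto simp: regular_def monogenic_def)

lemma regular_pd:
  assumes p: "p \<in> S" and f: "regular p R f" and j: "j \<le> m"
  shows "regular p R (pd j f)"
  unfolding regular_def
proof (intro conjI ballI)
  have v: "vharm_limit p R f" using f by (simp add: regular_def)
  then show "vharm_limit p R (pd j f)" using vharm_limit_dd[OF p] b_in_S[OF j] by blast
  fix x assume x: "x \<in> ball p R \<inter> S"
  have "has_dd (b j) (\<lambda>x. \<Sum>i=0..m. b i * pd i f x) (\<Sum>i=0..m. b i * pd j (pd i f) x) x"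
    by (intro has_dd_sum has_dd_bounded_linear[OF bounded_linear_mult_algebra]
        vharm_limit_has_dd[OF p vharm_limit_dd[OF p v] b_in_S[OF j] x] b_in_S) auto
  moreover have "has_dd (b j) (\<lambda>x. \<Sum>i=0..m. b i * pd i f x) 0 x"
    by (rule has_dd_cong[OF has_dd_const openin_ball_S subspace_span b_in_S[OF j] x])
      (use f in \<open>simp add: regular_def\<close>)
  ultimately have "(\<Sum>i=0..m. b i * pd j (pd i f) x) = 0" by (rule has_dd_unique)
  moreover have "(\<Sum>i=0..m. b i * pd i (pd j f) x) = (\<Sum>i=0..m. b i * pd j (pd i f) x)"
    using vharm_limit_dd_commute[OF p v _ _ x] b_in_S j by (intro sum.cong refl) auto
  ultimately show "(\<Sum>i=0..m. b i * pd i (pd j f) x) = 0" by simp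
qed

definition fueter_var :: "nat \<Rightarrow> 'a \<Rightarrow> 'a" where
  "fueter_var s x = of_real (x \<bullet> b s) - (x \<bullet> b 0) *\<^sub>R b s"

text \<open>For \<open>K\<close> the sum of the entries of \<open>k\<close>, this is the mean, over
  all orderings, of the product with \<open>k s\<close> factors \<open>fueter_var s\<close>. The
  degree is a separate argument to make the recursion structural.\<close>

primrec fueter :: "nat \<Rightarrow> (nat \<Rightarrow> nat) \<Rightarrow> 'a \<Rightarrow> 'a" where
  "fueter 0 k x = 1"
| "fueter (Suc K) k x = (1 / real (Suc K)) *\<^sub>R
     (\<Sum>s=1..m. real (k s) *\<^sub>R (fueter K (k(s := k s - 1)) x * fueter_var s x))"

text \<open>A mean over all orderings does not depend on the end from which a factor is removed. The
  definition removes factors on the right, whereas the Taylor induction produces them on the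
  left.\<close>

lemma fueter_left:
  "real (Suc K) *\<^sub>R fueter (Suc K) k x
    = (\<Sum>s=1..m. real (k s) *\<^sub>R (fueter_var s x * fueter K (k(s := k s - 1)) x))"
proof (induction K arbitrary: k)
  case 0
  show ?case by simp
next
  case (Suc K)
  let ?z = "\<lambda>s. fueter_var s x"
  \<comment> \<open>The weight of removing one factor \<open>s\<close> and then one factor
    \<open>u\<close>; its symmetry lets the two removals be exchanged.\<close>
  define c where "c s u = real (k s) * real ((k(s := k s - 1)) u) / real (Suc K)" for s u
  define G where "G s u = fueter K ((k(s := k s - 1))(u := (k(s := k s - 1)) u - 1)) x" for s u
  have csym: "c s u = c u s" for s u by (auto simp: c_def)
  have Gsym: "G s u = G u s" for s u
  proof (cases "s = u")
    case False
    then show ?thesis by (simp add: G_def fun_upd_twist)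
  qed simp
  have L: "fueter (Suc K) (k(s := k s - 1)) x
      = (1 / real (Suc K)) *\<^sub>R (\<Sum>u=1..m. real ((k(s := k s - 1)) u) *\<^sub>R (?z u * G s u))" for s
  proof -
    have "fueter (Suc K) (k(s := k s - 1)) x
        = (1 / real (Suc K)) *\<^sub>R (real (Suc K) *\<^sub>R fueter (Suc K) (k(s := k s - 1)) x)" by simp
    then show ?thesis unfolding G_def by (simp only: Suc)
  qed
  have R: "fueter (Suc K) (k(s := k s - 1)) x
      = (1 / real (Suc K)) *\<^sub>R (\<Sum>u=1..m. real ((k(s := k s - 1)) u) *\<^sub>R (G s u * ?z u))" for s
    by (simp add: G_def)
  have "real (Suc (Suc K)) *\<^sub>R fueter (Suc (Suc K)) k x
      = (\<Sum>s=1..m. real (k s) *\<^sub>R (fueter (Suc K) (k(s := k s - 1)) x * ?z s))"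
    by (simp only: fueter.simps(2)[of "Suc K"]) simp
  also have "\<dots> = (\<Sum>s=1..m. \<Sum>u=1..m. c s u *\<^sub>R (?z u * G s u * ?z s))"
    unfolding L by (simp add: scaleR_sum_right sum_distrib_right c_def)
  also have "\<dots> = (\<Sum>u=1..m. \<Sum>s=1..m. c u s *\<^sub>R (?z u * (G u s * ?z s)))"
    by (subst sum.swap) (simp only: csym[of _ _] Gsym mult.assoc)
  also have "\<dots> = (\<Sum>u=1..m. real (k u) *\<^sub>R (?z u * fueter (Suc K) (k(u := k u - 1)) x))"
    unfolding R by (simp add: scaleR_sum_right sum_distrib_left c_def)
  finally show ?case .
qed

lemma regular_dd:
  assumes p: "p \<in> S" and f: "regular p R f" and x: "x \<in> S" and y: "y \<in> ball p R \<inter> S"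
  shows "partial_deriv x f y = (\<Sum>i=1..m. fueter_var i x * pd i f y)"
proof -
  have "(\<Sum>i=0..m. b i * pd i f y) = 0" using f y by (simp add: regular_def)
  then have "pd 0 f y = - (\<Sum>i=1..m. b i * pd i f y)"
    by (simp add: sum.atLeast_Suc_atMost b_0 eq_neg_iff_add_eq_0)
  moreover have "partial_deriv x f y = (x \<bullet> b 0) *\<^sub>R pd 0 f y + (\<Sum>i=1..m. (x \<bullet> b i) *\<^sub>R pd i f y)"
    using vharm_limit_chain[OF p _ x y, of f] f by (simp add: regular_def sum.atLeast_Suc_atMost)
  ultimately show ?thesis
    by (simp add: fueter_var_def left_diff_distrib sum_subtractf scaleR_sum_right
        scaleR_conv_of_real[symmetric] flip: scaleR_conv_of_real)
qed

text \<open>The induction runs over all regular \<open>f\<close> at once: one derivative along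
  \<open>x\<close> is rewritten by the Dirac equation, and the remaining ones are applied to the
  functions \<open>pd i f\<close>, which are again regular.\<close>

theorem regular_taylor_fueter:
  assumes p: "p \<in> S" and R: "R > 0" and x: "x \<in> S"
  shows "regular p R f \<Longrightarrow> (partial_deriv x ^^ K) f p
    = (\<Sum>k\<in>multi_indices m K. (fact K / multi_fact m k) *\<^sub>R (fueter K k x * iter_partial b m k f p))"
proof (induction K arbitrary: f)
  case 0
  show ?case by (simp add: multi_indices_0 multi_fact_def iter_partial_0)
next
  case (Suc K)
  have v: "vharm_limit p R f" using Suc.prems by (simp add: regular_def)
  have pB: "p \<in> ball p R \<inter> S" using p R by simp
  have vi: "vharm_limit p R (pd i f)" if "i \<in> {1..m}" for i
    using vharm_limit_dd[OF p v] b_in_S that by auto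
  have pos: "multi_fact m k > 0" for k by (auto simp: multi_fact_def intro!: prod_pos)
  let ?D = "\<lambda>k. iter_partial b m k f p" and ?z = "\<lambda>i. fueter_var i x"
  define G where "G i k = (fact K / multi_fact m k * real (k i)) *\<^sub>R
      (?z i * fueter K (k(i := k i - 1)) x * ?D k)" for i k
  have "(partial_deriv x ^^ Suc K) f p = (partial_deriv x ^^ K) (partial_deriv x f) p"
    by (simp add: funpow_swap1)
  also have "\<dots> = (partial_deriv x ^^ K) (\<lambda>y. \<Sum>i=1..m. ?z i * pd i f y) p"
    using regular_dd[OF p Suc.prems x] x pB by (intro iter_dd_cong_ball[of p R]) auto
  \<comment> \<open>The factors \<open>fueter_var i x\<close> depend on the fixed direction
    \<open>x\<close>, not on the point of differentiation, and pass through as constants.\<close>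
  also have "\<dots> = (\<Sum>i=1..m. ?z i * (partial_deriv x ^^ K) (pd i f) p)"
    by (rule vharm_limit_iter_linear_sum[OF p vi bounded_linear_mult_algebra x pB])
  also have "\<dots> = (\<Sum>i=1..m. \<Sum>k\<in>multi_indices m K. G i (k(i := Suc (k i))))"
  proof (intro sum.cong refl)
    fix i assume i: "i \<in> {1..m}"
    then have "regular p R (pd i f)" using regular_pd[OF p Suc.prems] by simp
    then have "?z i * (partial_deriv x ^^ K) (pd i f) p = ?z i * (\<Sum>k\<in>multi_indices m K.
        (fact K / multi_fact m k) *\<^sub>R (fueter K k x * iter_partial b m k (pd i f) p))"
      by (simp only: Suc.IH)
    also have "\<dots> = (\<Sum>k\<in>multi_indices m K. G i (k(i := Suc (k i))))"
      unfolding sum_distrib_left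
    proof (intro sum.cong refl)
      fix k
      have "fact K / multi_fact m (k(i := Suc (k i))) * real ((k(i := Suc (k i))) i) = fact K / multi_fact m k"
        unfolding multi_fact_Suc[OF i] using pos[of k] by (simp del: of_nat_Suc)
      moreover have "iter_partial b m k (pd i f) p = ?D (k(i := Suc (k i)))"
        using i by (intro iter_partial_pd[OF p v _ pB]) simp
      ultimately show "?z i * ((fact K / multi_fact m k) *\<^sub>R (fueter K k x * iter_partial b m k (pd i f) p))
          = G i (k(i := Suc (k i)))"
        unfolding G_def by (simp add: mult.assoc)
    qed
    finally show "?z i * (partial_deriv x ^^ K) (pd i f) p = (\<Sum>k\<in>multi_indices m K. G i (k(i := Suc (k i))))" .
  qed
  also have "\<dots> = (\<Sum>i=1..m. \<Sum>k\<in>multi_indices m (Suc K). G i k)"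
    by (intro sum.cong refl sum_multi_indices_Suc[symmetric]) (auto simp: G_def)
  also have "\<dots> = (\<Sum>k\<in>multi_indices m (Suc K). \<Sum>i=1..m. G i k)" by (rule sum.swap)
  also have "\<dots> = (\<Sum>k\<in>multi_indices m (Suc K).
      (fact (Suc K) / multi_fact m k) *\<^sub>R (fueter (Suc K) k x * ?D k))"
  proof (intro sum.cong refl)
    fix k
    have "(\<Sum>i=1..m. G i k) = (fact K / multi_fact m k) *\<^sub>R
        ((\<Sum>i=1..m. real (k i) *\<^sub>R (?z i * fueter K (k(i := k i - 1)) x)) * ?D k)"
      by (simp add: G_def scaleR_sum_right sum_distrib_right)
    also have "\<dots> = (fact K / multi_fact m k) *\<^sub>R ((real (Suc K) *\<^sub>R fueter (Suc K) k x) * ?D k)"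
      by (simp only: fueter_left)
    also have "\<dots> = (fact (Suc K) / multi_fact m k) *\<^sub>R (fueter (Suc K) k x * ?D k)"
      by (simp only: mult_scaleR_left scaleR_scaleR fact_Suc) (simp add: mult.commute)
    finally show "(\<Sum>i=1..m. G i k) = (fact (Suc K) / multi_fact m k) *\<^sub>R (fueter (Suc K) k x * ?D k)" .
  qed
  finally show ?case .
qed

section \<open>Ordered products of the imaginary units\<close>

definition mono_list :: "(nat \<Rightarrow> nat) \<Rightarrow> nat list \<Rightarrow> 'a" where
  "mono_list k L = prod_list (map (\<lambda>i. b i ^ k i) L)"

lemma power_sign_commute:
  fixes x y :: 'a
  assumes "x * y = \<sigma> *\<^sub>R (y * x)"
  shows "x * y ^ n = \<sigma> ^ n *\<^sub>R (y ^ n * x)"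
proof (induction n)
  case (Suc n)
  have "x * y ^ Suc n = (x * y) * y ^ n" by (simp add: mult.assoc)
  also have "\<dots> = \<sigma> *\<^sub>R (y * (x * y ^ n))" by (simp add: assms mult.assoc)
  also have "\<dots> = \<sigma> ^ Suc n *\<^sub>R (y ^ Suc n * x)" by (simp add: Suc mult.assoc)
  finally show ?case .
qed simp

lemma mono_list_commute:
  assumes "\<And>i. i \<in> set L \<Longrightarrow> x * b i = \<sigma> i *\<^sub>R (b i * x)"
  shows "x * mono_list k L = (\<Prod>i\<leftarrow>L. \<sigma> i ^ k i) *\<^sub>R (mono_list k L * x)"
  using assms
proof (induction L)
  case Nil
  show ?case by (simp add: mono_list_def)
next
  case (Cons i L)
  have "x * mono_list k (i # L) = (x * b i ^ k i) * mono_list k L"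
    by (simp add: mono_list_def mult.assoc)
  also have "x * b i ^ k i = \<sigma> i ^ k i *\<^sub>R (b i ^ k i * x)"
    using Cons.prems by (intro power_sign_commute) simp
  also have "(\<sigma> i ^ k i *\<^sub>R (b i ^ k i * x)) * mono_list k L = \<sigma> i ^ k i *\<^sub>R (b i ^ k i * (x * mono_list k L))"
    by (simp add: mult.assoc)
  also have "x * mono_list k L = (\<Prod>i\<leftarrow>L. \<sigma> i ^ k i) *\<^sub>R (mono_list k L * x)"
    using Cons by simp
  finally show ?case by (simp add: mono_list_def mult.assoc)
qed

lemma prod_list_sign: "(\<Prod>i\<leftarrow>L. (if i = s then 1 else - 1 :: real) ^ k i) = (- 1) ^ (\<Sum>i\<leftarrow>L. if i = s then 0 else k i)"
  by (induction L) (auto simp: power_add)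

lemma b_sign_commute:
  "1 \<le> s \<Longrightarrow> s \<le> m \<Longrightarrow> 1 \<le> i \<Longrightarrow> i \<le> m \<Longrightarrow> b s * b i = (if i = s then 1 else - 1 :: real) *\<^sub>R (b i * b s)"
  using b_anticommute[of s i] by auto

text \<open>\<open>b s\<close> commutes with its own powers and changes sign with every other unit,
  so only the exponents of the other indices count.\<close>

lemma b_mono_list:
  assumes "1 \<le> s" "s \<le> m" "set L \<subseteq> {1..m}"
  shows "b s * mono_list k L = (- 1) ^ (\<Sum>i\<leftarrow>L. if i = s then 0 else k i) *\<^sub>R (mono_list k L * b s)"
  unfolding prod_list_sign[symmetric]
  using assms by (intro mono_list_commute b_sign_commute) auto

text \<open>Indices decrease, as in the product that has the last torus unit on the left;
  \<open>a = t 0\<close> selects exactly the torus directions.\<close>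

abbreviation tail_list :: "nat \<Rightarrow> nat list" where "tail_list a \<equiv> rev [a + 1..<m + 1]"

lemma sum_list_tail: "(\<Sum>i\<leftarrow>tail_list a. f i) = (\<Sum>i=a + 1..m. f i :: nat)"
proof -
  have "(\<Sum>i\<leftarrow>tail_list a. f i) = (\<Sum>i\<in>set (tail_list a). f i)"
    by (rule sum_list_distinct_conv_sum_set) simp
  also have "set (tail_list a) = {a + 1..m}" by auto
  finally show ?thesis .
qed

text \<open>One factor \<open>b s\<close> is carried to the front past the units of larger index;
  this is the origin of the sign with exponent \<open>bs\<close> in \<open>T_poly\<close>.\<close>

lemma mono_list_tail_split:
  assumes s: "a < s" "s \<le> m" and k: "k s > 0"
  shows "mono_list k (tail_list a) = (- 1) ^ (\<Sum>i=s + 1..m. k i) *\<^sub>R (b s * mono_list (k(s := k s - 1)) (tail_list a))"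
proof -
  have "[a + 1..<m + 1] = [a + 1..<s] @ s # [s + 1..<m + 1]"
    using s upt_add_eq_append[of "a + 1" s "m + 1 - s"] upt_conv_Cons[of s "m + 1"] by simp
  then have L: "tail_list a = tail_list s @ s # rev [a + 1..<s]" by simp
  let ?k = "k(s := k s - 1)"
  have eq: "mono_list ?k (tail_list s) = mono_list k (tail_list s)"
    "mono_list ?k (rev [a + 1..<s]) = mono_list k (rev [a + 1..<s])"
    unfolding mono_list_def by (rule arg_cong[where f = prod_list], rule map_cong, auto)+
  have split: "mono_list k' (tail_list a) = mono_list k' (tail_list s) * (b s ^ k' s * mono_list k' (rev [a + 1..<s]))" for k'
    unfolding L by (simp add: mono_list_def)
  have "b s * mono_list k (tail_list s)
      = (- 1) ^ (\<Sum>i\<leftarrow>tail_list s. if i = s then 0 else k i) *\<^sub>R (mono_list k (tail_list s) * b s)"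
    using s by (intro b_mono_list) auto
  also have "(\<Sum>i\<leftarrow>tail_list s. if i = s then 0 else k i) = (\<Sum>i=s + 1..m. k i)"
    unfolding sum_list_tail by (intro sum.cong) auto
  finally have c: "b s * mono_list k (tail_list s) = (- 1) ^ (\<Sum>i=s + 1..m. k i) *\<^sub>R (mono_list k (tail_list s) * b s)" .
  have "b s ^ k s = b s * b s ^ ?k s" using k by (cases "k s") auto
  then have "(- 1) ^ (\<Sum>i=s + 1..m. k i) *\<^sub>R (b s * mono_list ?k (tail_list a))
      = ((- 1) ^ (\<Sum>i=s + 1..m. k i) * (- 1) ^ (\<Sum>i=s + 1..m. k i)) *\<^sub>R mono_list k (tail_list a)"
    unfolding split eq mult.assoc[symmetric] by (simp only: c mult_scaleR_left scaleR_scaleR mult.assoc)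
  then show ?thesis by (simp flip: power_mult_distrib)
qed

end

section \<open>Comparison of slices\<close>

lemma has_dd_minus:
  assumes "has_dd w f D x"
  shows "has_dd (- w) f (- D) x"
proof -
  have "((\<lambda>s::real. - s) has_vector_derivative - 1) (at 0)"
    by (auto intro!: derivative_eq_intros)
  from vector_diff_chain_at[OF this, of "\<lambda>s. f (x + s *\<^sub>R w)" D]
  show ?thesis using assms by (simp add: has_dd_def o_def)
qed

lemma mult_inverse_works:
  fixes z :: "'a::monoid_mult"
  assumes "y * z = 1" "z * y = 1"
  shows "mult_inverse z = y"
  unfolding mult_inverse_def
proof (rule the_equality)
  fix y' assume y': "y' * z = 1 \<and> z * y' = 1"
  have "y' = y' * (z * y)" by (simp add: assms)
  also have "\<dots> = y" using y' by (simp flip: mult.assoc)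
  finally show "y' = y" .
qed (use assms in simp)

context clifford_frame
begin

lemma mono_list_cong:
  assumes "\<And>i. i \<in> set L \<Longrightarrow> k i = k' i"
  shows "mono_list k L = mono_list k' L"
  unfolding mono_list_def using assms by (auto intro!: arg_cong[where f = prod_list])

text \<open>Let \<open>Q\<close> be the monomial in the torus units. For a mirror index
  \<open>s\<close>, moving \<open>Q\<close> to the left of \<open>fueter_var s\<close> multiplies
  the \<open>b s\<close> part by a sign, with the parity of \<open>a\<close>. For a torus index one
  unit is first split off \<open>Q\<close>, and the parity is that of \<open>as\<close>. These two
  cases are the two sums in \<open>T_poly\<close>.\<close>

theorem T_poly_fueter:
  assumes mt: "m = t 0 + \<tau>" and b: "\<And>i. i \<le> m \<Longrightarrow> b i = frame v t J i"
    and block: "\<And>h. 1 \<le> h \<Longrightarrow> h \<le> \<tau> \<Longrightarrow> block v t h x = (x \<bullet> J h) *\<^sub>R J h"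
  shows "T_poly v \<tau> t (\<lambda>s. int (k s)) x
    = fueter (\<Sum>s=1..m. k s) k x * mono_list k (tail_list (t 0))"
proof (induction "\<Sum>s=1..m. k s" arbitrary: k)
  case 0
  then have z: "\<forall>s\<in>{1..m}. k s = 0" by auto
  have "mono_list k (tail_list (t 0)) = mono_list (\<lambda>i. 0) (tail_list (t 0))"
    using z by (intro mono_list_cong) auto
  also have "\<dots> = 1" by (simp add: mono_list_def map_replicate_const)
  finally have "mono_list k (tail_list (t 0)) = 1" .
  moreover have "T_poly v \<tau> t (\<lambda>s. int (k s)) x = 1"
    using z unfolding mt by (subst T_poly.simps) auto
  moreover have "fueter (\<Sum>s=1..m. k s) k x = 1"
    by (subst 0[symmetric]) simp
  ultimately show ?case by simp
next
  case (Suc K)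
  let ?T = "\<lambda>k. T_poly v \<tau> t (\<lambda>s. int (k s)) x"
  let ?Q = "\<lambda>k. mono_list k (tail_list (t 0))"
  let ?a = "\<Sum>u=t 0 + 1..m. k u"
  let ?as = "\<lambda>s. \<Sum>u=t 0 + 1..m. if u = s then 0 else k u"
  let ?bs = "\<lambda>s. \<Sum>u=s + 1..m. k u"
  let ?k = "\<lambda>s. k(s := k s - 1)"
  let ?x = "\<lambda>s. x \<bullet> b s"
  have bv: "v s = b s" if "s \<le> t 0" for s using b[of s] that mt by (simp add: frame_def)
  have bJ: "block v t (s - t 0) x = ?x s *\<^sub>R b s" if "s \<in> {t 0 + 1..m}" for s
    using block[of "s - t 0"] b[of s] that mt by (auto simp: frame_def)
  have IH: "?T (?k s) = fueter K (?k s) x * ?Q (?k s)" if s: "s \<in> {1..m}" "k s > 0" for s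
  proof -
    have "(?k s)(s := Suc (?k s s)) = k" using s by auto
    then have "Suc (\<Sum>u=1..m. ?k s u) = (\<Sum>u=1..m. k u)"
      using sum_fun_upd_Suc[OF s(1), of "?k s"] by simp
    then have K: "K = (\<Sum>u=1..m. ?k s u)" using Suc.hyps(2) by simp
    show ?thesis unfolding K by (rule Suc.hyps(1)[OF K])
  qed
  have upd: "(\<lambda>s. int (k s))(s := int (k s) - 1) = (\<lambda>u. int (?k s u))" if "k s > 0" for s
    using that by (auto simp: of_nat_diff)
  have as: "(\<Sum>u=t 0 + 1..m. int (k u)) - int (k s) = int (?as s)" if "s \<in> {t 0 + 1..m}" for s
  proof -
    have "?a = k s + (\<Sum>u\<in>{t 0 + 1..m} - {s}. k u)"
      using sum.remove[OF finite_atLeastAtMost that] .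
    also have "(\<Sum>u\<in>{t 0 + 1..m} - {s}. k u) = ?as s"
      using sum.remove[OF finite_atLeastAtMost that, of "\<lambda>u. if u = s then 0 else k u"]
      by (auto intro!: sum.cong)
    finally have "int ?a = int (k s) + int (?as s)" by (simp only: of_nat_add)
    then show ?thesis by simp
  qed
  have first: "real (k s) *\<^sub>R (fueter K (?k s) x * fueter_var s x * ?Q k)
      = of_int (int (k s)) *\<^sub>R (T_poly v \<tau> t ((\<lambda>s. int (k s))(s := int (k s) - 1)) x *
          (of_real (x \<bullet> v s) - ((-1) powi (\<Sum>u=t 0 + 1..m. int (k u)) * (x \<bullet> v 0)) *\<^sub>R v s))"
    if s: "s \<in> {1..t 0}" for s
  proof (cases "k s = 0")
    case False
    have sub: "set (tail_list (t 0)) \<subseteq> {1..m}" and s': "1 \<le> s" "s \<le> m" using s mt by auto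
    have "(\<Sum>i\<leftarrow>tail_list (t 0). if i = s then 0 else k i) = ?a"
      unfolding sum_list_tail using s by (intro sum.cong) auto
    then have bQ: "b s * ?Q k = (- 1) ^ ?a *\<^sub>R (?Q k * b s)"
      using b_mono_list[OF s' sub, of k] by simp
    have "?Q (?k s) = ?Q k" using s by (intro mono_list_cong) auto
    then have "?T (?k s) = fueter K (?k s) x * ?Q k" using IH[of s] s False mt by simp
    moreover have "fueter_var s x * ?Q k = ?Q k * (of_real (?x s) - ((-1) ^ ?a * ?x 0) *\<^sub>R b s)"
      unfolding fueter_var_def left_diff_distrib right_diff_distrib mult_scaleR_left mult_scaleR_right bQ
      by (simp add: scaleR_conv_of_real[symmetric] mult.commute flip: scaleR_conv_of_real)
        (simp add: of_real_def)
    moreover have "(-1::real) powi (\<Sum>u=t 0 + 1..m. int (k u)) = (-1) ^ ?a"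
      using power_int_of_nat[of "-1::real" ?a] by simp
    ultimately show ?thesis
      using upd[of s] False s bv[of s] bv[of 0] by (simp add: mult.assoc)
  qed simp
  have second: "real (k s) *\<^sub>R (fueter K (?k s) x * fueter_var s x * ?Q k)
      = ((-1) powi (\<Sum>u=s + 1..m. int (k u)) * of_int (int (k s))) *\<^sub>R
          (T_poly v \<tau> t ((\<lambda>s. int (k s))(s := int (k s) - 1)) x *
          (of_real (x \<bullet> v 0) + (-1) powi ((\<Sum>u=t 0 + 1..m. int (k u)) - int (k s)) *\<^sub>R block v t (s - t 0) x))"
    if s: "s \<in> {t 0 + 1..m}" for s
  proof (cases "k s = 0")
    case False
    have s': "1 \<le> s" "s \<le> m" "s \<in> {1..m}" "t 0 < s" using s by auto
    have sub: "set (tail_list (t 0)) \<subseteq> {1..m}" by auto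
    have "(\<Sum>i\<leftarrow>tail_list (t 0). if i = s then 0 else ?k s i) = ?as s"
      unfolding sum_list_tail by (intro sum.cong) auto
    then have bQ: "b s * ?Q (?k s) = (- 1) ^ ?as s *\<^sub>R (?Q (?k s) * b s)"
      using b_mono_list[OF s'(1,2) sub, of "?k s"] by simp
    \<comment> \<open>As \<open>b s\<close> squares to -1, multiplying the Fueter variable by
      \<open>b s\<close> exchanges the roles of the two coordinates.\<close>
    have "fueter_var s x * (b s * ?Q (?k s)) = (?x s *\<^sub>R b s + of_real (?x 0)) * ?Q (?k s)"
      unfolding mult.assoc[symmetric] fueter_var_def
      using b_square[OF s'(1,2)] by (simp add: left_diff_distrib distrib_right of_real_def)
    also have "\<dots> = ?Q (?k s) * (of_real (?x 0) + (-1) ^ ?as s *\<^sub>R (?x s *\<^sub>R b s))"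
      unfolding distrib_left distrib_right mult_scaleR_left mult_scaleR_right bQ
      by (simp add: of_real_def mult.commute add.commute)
    finally have "fueter_var s x * ?Q k
        = (-1) ^ ?bs s *\<^sub>R (?Q (?k s) * (of_real (?x 0) + (-1) ^ ?as s *\<^sub>R (?x s *\<^sub>R b s)))"
      using mono_list_tail_split[OF s'(4,2), of k] False by simp
    moreover have "?T (?k s) = fueter K (?k s) x * ?Q (?k s)" using IH[of s] s' False by simp
    moreover have "(-1::real) powi (\<Sum>u=s + 1..m. int (k u)) = (-1) ^ ?bs s"
      using power_int_of_nat[of "-1::real" "?bs s"] by simp
    moreover have "(-1::real) powi ((\<Sum>u=t 0 + 1..m. int (k u)) - int (k s)) = (-1) ^ ?as s"
      unfolding as[OF s] by (rule power_int_of_nat)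
    ultimately show ?thesis
      using upd[of s] False bv[of 0] bJ[OF s] by (simp add: mult.assoc mult.commute)
  qed simp
  obtain s0 where s0: "s0 \<in> {1..m}" "k s0 \<noteq> 0"
    using Suc.hyps(2) by (metis sum.neutral nat.distinct(1))
  then have c: "\<not> (\<exists>s\<in>{1..t 0 + \<tau>}. int (k s) < 0)" "\<not> (\<forall>s\<in>{1..t 0 + \<tau>}. int (k s) = 0)"
    unfolding mt by auto
  have K: "(\<Sum>s=1..m. int (k s)) = int (Suc K)" using Suc.hyps(2) by (simp flip: of_nat_sum)
  have "{1..m} = {1..t 0} \<union> {t 0 + 1..m}" using mt by auto
  then have "(\<Sum>s=1..m. real (k s) *\<^sub>R (fueter K (?k s) x * fueter_var s x * ?Q k))
      = (\<Sum>s=1..t 0. real (k s) *\<^sub>R (fueter K (?k s) x * fueter_var s x * ?Q k))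
      + (\<Sum>s=t 0 + 1..m. real (k s) *\<^sub>R (fueter K (?k s) x * fueter_var s x * ?Q k))"
    by (simp add: sum.union_disjoint)
  then have "fueter (Suc K) k x * ?Q k = (1 / real (Suc K)) *\<^sub>R
      ((\<Sum>s=1..t 0. real (k s) *\<^sub>R (fueter K (?k s) x * fueter_var s x * ?Q k))
      + (\<Sum>s=t 0 + 1..m. real (k s) *\<^sub>R (fueter K (?k s) x * fueter_var s x * ?Q k)))"
    by (simp add: sum_distrib_right)
  also have "\<dots> = (1 / of_int (\<Sum>s=1..m. int (k s))) *\<^sub>R
      ((\<Sum>s=1..t 0. of_int (int (k s)) *\<^sub>R (T_poly v \<tau> t ((\<lambda>s. int (k s))(s := int (k s) - 1)) x *
          (of_real (x \<bullet> v s) - ((-1) powi (\<Sum>u=t 0 + 1..m. int (k u)) * (x \<bullet> v 0)) *\<^sub>R v s)))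
      + (\<Sum>s=t 0 + 1..m. ((-1) powi (\<Sum>u=s + 1..m. int (k u)) * of_int (int (k s))) *\<^sub>R
          (T_poly v \<tau> t ((\<lambda>s. int (k s))(s := int (k s) - 1)) x *
          (of_real (x \<bullet> v 0) + (-1) powi ((\<Sum>u=t 0 + 1..m. int (k u)) - int (k s)) *\<^sub>R
            block v t (s - t 0) x))))"
    unfolding K by (simp only: sum.cong[OF refl first] sum.cong[OF refl second] of_int_of_nat_eq)
  also have "\<dots> = ?T k"
    by (subst (3) T_poly.simps) (simp only: c[folded mt] if_False Let_def mt[symmetric])
  finally show ?case using Suc.hyps(2) by simp
qed

text \<open>Regular functions vanishing on the hyperplane are closed under partial derivatives:
  tangential derivatives vanish there, and the Dirac equation then forces the normal one to vanish.
  Hence all Taylor coefficients at \<open>p\<close> are zero.\<close>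

lemma regular_vanishing:
  assumes p: "p \<in> S" "p \<bullet> b q = 0" and R: "R > 0" and q: "1 \<le> q" "q \<le> m"
    and f: "regular p R f" and z: "\<And>x. x \<in> ball p R \<inter> S \<Longrightarrow> x \<bullet> b q = 0 \<Longrightarrow> f x = 0"
    and x: "x \<in> ball p R \<inter> S"
  shows "f x = 0"
proof -
  define C where "C g \<longleftrightarrow> regular p R g \<and> (\<forall>x\<in>ball p R \<inter> S. x \<bullet> b q = 0 \<longrightarrow> g x = 0)" for g
  have pd: "C (pd i g)" if g: "C g" and i: "i \<le> m" for g i
  proof -
    have rg: "regular p R g" "vharm_limit p R g" using g by (auto simp: C_def regular_def)
    have other: "pd j g x = 0" if x: "x \<in> ball p R \<inter> S" "x \<bullet> b q = 0" and j: "j \<le> m" "j \<noteq> q" for x j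
    proof -
      have sub: "subspace (S \<inter> {x. x \<bullet> b q = 0})"
        by (intro subspace_inter subspace_span) (auto simp: subspace_def inner_add_left)
      have "has_dd (b j) g 0 x"
      proof (rule has_dd_cong[OF has_dd_const, of "S \<inter> {x. x \<bullet> b q = 0}" "ball p R \<inter> (S \<inter> {x. x \<bullet> b q = 0})"])
        show "openin (top_of_set (S \<inter> {x. x \<bullet> b q = 0})) (ball p R \<inter> (S \<inter> {x. x \<bullet> b q = 0}))"
          by (auto simp: openin_open)
      qed (use sub x j q orth[of j q] b_in_S[of j] g in \<open>auto simp: C_def\<close>)
      then show ?thesis by (rule has_dd_partial_deriv)
    qed
    have "pd q g x = 0" if x: "x \<in> ball p R \<inter> S" "x \<bullet> b q = 0" for x
    proof -
      have "0 = (\<Sum>j=0..m. b j * pd j g x)" using rg(1) x by (simp add: regular_def)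
      also have "\<dots> = (\<Sum>j=0..m. if j = q then b q * pd q g x else 0)"
        using other[OF x] by (intro sum.cong refl) auto
      also have "\<dots> = b q * pd q g x" using q by simp
      finally have "b q * (b q * pd q g x) = 0" by simp
      then show ?thesis using b_square[OF q] by (simp flip: mult.assoc)
    qed
    then show ?thesis using regular_pd[OF p(1) rg(1) i] other i
      by (cases "i = q") (auto simp: C_def)
  qed
  have iter: "C ((pd i ^^ n) g)" if "C g" "i \<le> m" for g i n
    using that by (induction n) (auto intro: pd)
  have list: "C (pd_list h L g)" if "C g" "set L \<subseteq> {0..m}" for g h L
    using that by (induction L) (auto intro: iter)
  have "C f" using f z by (simp add: C_def)
  then have "C (iter_partial b m h f)" for h
    unfolding iter_partial_def by (rule list) auto
  then have zero: "iter_partial b m h f p = 0" for h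
    using p R by (simp add: C_def)
  have xp: "x - p \<in> S" "norm (x - p) < R"
    using x p by (auto intro: span_diff simp: dist_norm norm_minus_commute)
  have "(\<lambda>k. (1 / fact k) *\<^sub>R (partial_deriv (x - p) ^^ k) f p) sums f (p + (x - p))"
    using f by (intro vharm_limit_taylor_sums[OF p(1) _ xp]) (simp add: regular_def)
  moreover have "(partial_deriv (x - p) ^^ k) f p = 0" for k
    using regular_taylor_fueter[OF p(1) R xp(1) f, of k] zero by simp
  ultimately have "(\<lambda>k. 0) sums f x" by simp
  then show ?thesis using sums_0 sums_unique2 by blast
qed

lemma mono_list_invertible: "set L \<subseteq> {1..m} \<Longrightarrow> \<exists>y. y * mono_list k L = 1 \<and> mono_list k L * y = 1"
proof (induction L)
  case Nil
  show ?case by (simp add: mono_list_def)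
next
  case (Cons i L)
  then obtain y where y: "y * mono_list k L = 1" "mono_list k L * y = 1" by auto
  have bi: "b i * b i = - 1" using Cons.prems b_square[of i] by auto
  have inv: "(- b i) ^ n * b i ^ n = 1 \<and> b i ^ n * (- b i) ^ n = 1" for n
  proof (induction n)
    case (Suc n)
    have "(- b i) ^ Suc n * b i ^ Suc n = (- b i) ^ n * ((- b i) * b i) * b i ^ n"
      unfolding power_Suc2[of "- b i"] power_Suc[of "b i"] mult.assoc ..
    moreover have "b i ^ Suc n * (- b i) ^ Suc n = b i ^ n * (b i * (- b i)) * (- b i) ^ n"
      unfolding power_Suc2[of "b i"] power_Suc[of "- b i"] mult.assoc ..
    ultimately show ?case using Suc bi by simp
  qed simp
  have "mono_list k (i # L) = b i ^ k i * mono_list k L" by (simp add: mono_list_def)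
  moreover have "(y * (- b i) ^ k i) * (b i ^ k i * mono_list k L) = y * ((- b i) ^ k i * b i ^ k i) * mono_list k L"
    "(b i ^ k i * mono_list k L) * (y * (- b i) ^ k i) = b i ^ k i * (mono_list k L * y) * (- b i) ^ k i"
    by (simp_all only: mult.assoc)
  ultimately have "(y * (- b i) ^ k i) * mono_list k (i # L) = 1 \<and> mono_list k (i # L) * (y * (- b i) ^ k i) = 1"
    using inv y by simp
  then show ?case by blast
qed

lemma mult_inverse_mono_list:
  assumes "set L \<subseteq> {1..m}"
  shows "mult_inverse (mono_list k L) * mono_list k L = 1" "mono_list k L * mult_inverse (mono_list k L) = 1"
  using mono_list_invertible[OF assms, of k] mult_inverse_works by metis+

end

section \<open>Two frames that differ in one vector\<close>

locale adjacent_frames = F: clifford_frame b m + G: clifford_frame b' m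
  for b b' :: "nat \<Rightarrow> 'a::{real_algebra_1, euclidean_space}" and m +
  fixes q :: nat and p :: 'a and R :: real
  assumes q: "1 \<le> q" "q \<le> m" and agree: "\<And>i. i \<le> m \<Longrightarrow> i \<noteq> q \<Longrightarrow> b i = b' i"
    and p: "p \<in> F.S" "p \<in> G.S" "p \<bullet> b q = 0" and R: "R > 0"
begin

text \<open>On the span of \<open>b\<close> this is the isometry onto the span of \<open>b'\<close>
  that replaces \<open>b q\<close> by \<open>b' q\<close>; it fixes \<open>p\<close>, which is
  orthogonal to \<open>b q\<close>.\<close>

definition turn :: "'a \<Rightarrow> 'a" where
  "turn z = z + (z \<bullet> b q) *\<^sub>R (b' q - b q)"

lemma turn_add_scale: "turn (z + s *\<^sub>R w) = turn z + s *\<^sub>R turn w"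
  by (simp add: turn_def inner_add_left algebra_simps)

lemma turn_b: "i \<le> m \<Longrightarrow> turn (b i) = b' i"
  using F.orth[of i q] q agree[of i] by (auto simp: turn_def)

lemma turn_fixed: "z \<bullet> b q = 0 \<Longrightarrow> turn z = z"
  by (simp add: turn_def)

lemma turn_linear: "linear turn"
  by (auto simp: turn_def linear_iff inner_add_left algebra_simps)

lemma continuous_turn: "continuous_on A turn"
  unfolding turn_def by (intro continuous_intros)

lemma turn_expand: "z \<in> F.S \<Longrightarrow> turn z = (\<Sum>i=0..m. (z \<bullet> b i) *\<^sub>R b' i)"
proof -
  assume "z \<in> F.S"
  then have "turn z = turn (\<Sum>i=0..m. (z \<bullet> b i) *\<^sub>R b i)" using F.S_expand by simp
  also have "\<dots> = (\<Sum>i=0..m. (z \<bullet> b i) *\<^sub>R b' i)"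
    using turn_linear by (simp add: linear_sum linear_cmul turn_b)
  finally show ?thesis .
qed

lemma turn_in: "z \<in> F.S \<Longrightarrow> turn z \<in> G.S"
  unfolding turn_expand by (intro span_sum span_scale G.b_in_S) auto

lemma norm_turn: "z \<in> F.S \<Longrightarrow> norm (turn z) = norm z"
proof -
  assume z: "z \<in> F.S"
  have "(norm (turn z))\<^sup>2 = (norm (\<Sum>i=0..m. (z \<bullet> b i) *\<^sub>R b i))\<^sup>2"
    unfolding turn_expand[OF z] F.norm_combination G.norm_combination ..
  then show ?thesis using F.S_expand[OF z] by simp
qed

lemma dist_turn: "z \<in> F.S \<Longrightarrow> dist p (turn z) = dist p z"
proof -
  assume z: "z \<in> F.S"
  have "p - turn z = turn (p - z)"
    using turn_linear turn_fixed[OF p(3)] by (simp add: linear_diff)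
  then show ?thesis using norm_turn[of "p - z"] z p by (simp add: dist_norm span_diff)
qed

lemma turn_ball: "z \<in> ball p R \<inter> F.S \<Longrightarrow> turn z \<in> ball p R \<inter> G.S"
  using turn_in dist_turn by auto

lemma has_dd_turn: "i \<le> m \<Longrightarrow> has_dd (b' i) f D (turn z) \<Longrightarrow> has_dd (b i) (\<lambda>z. f (turn z)) D z"
  by (simp add: has_dd_def turn_add_scale turn_b)

text \<open>For \<open>i = q\<close> both sides are \<open>b q + b' q\<close>. A common imaginary
  unit anticommutes with \<open>b q\<close> and with \<open>b' q\<close>, hence commutes with their
  product.\<close>

lemma exchange: "i \<le> m \<Longrightarrow> b i * (1 - b q * b' q) = (1 - b q * b' q) * b' i"
proof -
  assume i: "i \<le> m"
  have sq: "b q * b q = - 1" "b' q * b' q = - 1" using q F.b_square G.b_square by auto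
  consider "i = q" | "i = 0" | "i \<noteq> q" "1 \<le> i" by linarith
  then show ?thesis
  proof cases
    case 1
    then show ?thesis using sq by (simp add: algebra_simps flip: mult.assoc) (simp add: mult.assoc sq)
  next
    case 2
    then show ?thesis using F.b_0 G.b_0 by simp
  next
    case 3
    have "b i * b q = - (b q * b i)" "b' i * b' q = - (b' q * b' i)" "b i = b' i"
      using 3 i q F.b_anticommute[of i q] G.b_anticommute[of i q] agree by auto
    have "b i * (b q * b' q) = (b i * b q) * b' q" by (simp add: mult.assoc)
    also have "\<dots> = - (b q * (b' i * b' q))"
      unfolding \<open>b i * b q = - (b q * b i)\<close> by (simp add: mult.assoc \<open>b i = b' i\<close>)
    also have "\<dots> = (b q * b' q) * b' i"
      unfolding \<open>b' i * b' q = - (b' q * b' i)\<close> by (simp add: mult.assoc)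
    finally have "b i * (b q * b' q) = (b q * b' q) * b' i" .
    then show ?thesis using \<open>b i = b' i\<close> by (simp add: algebra_simps)
  qed
qed

text \<open>Since \<open>1 - b q * b' q\<close> intertwines the two frames, left multiplication by
  it turns the Dirac equation of one slice into that of the other. The derivatives are exposed
  because two such functions will be added.\<close>

lemma monogenic_turn:
  assumes f: "monogenic b' m U f" and U: "ball p R \<inter> G.S \<subseteq> U"
  defines "g \<equiv> \<lambda>z. (1 / 2) *\<^sub>R ((1 - b q * b' q) * f (turn z))"
    and "g' \<equiv> \<lambda>i z. (1 / 2) *\<^sub>R ((1 - b q * b' q) * partial_deriv (b' i) f (turn z))"
  shows "i \<le> m \<Longrightarrow> z \<in> ball p R \<inter> F.S \<Longrightarrow> has_dd (b i) g (g' i z) z"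
    and "i \<le> m \<Longrightarrow> continuous_on (ball p R \<inter> F.S) (g' i)"
    and "z \<in> ball p R \<inter> F.S \<Longrightarrow> (\<Sum>i=0..m. b i * g' i z) = 0"
proof -
  have L: "bounded_linear (\<lambda>y. (1 / 2) *\<^sub>R ((1 - b q * b' q) * y))"
    by (intro bounded_linear_compose[OF bounded_linear_scaleR_right bounded_linear_mult_algebra])
  show "has_dd (b i) g (g' i z) z" if "i \<le> m" "z \<in> ball p R \<inter> F.S" for i z
  proof -
    have "has_dd (b' i) f (partial_deriv (b' i) f (turn z)) (turn z)"
      using f U turn_ball[OF that(2)] that(1)
      unfolding monogenic_def C1_along_def has_dd_def partial_deriv_def
      by (auto simp: vector_derivative_works)
    from has_dd_bounded_linear[OF L has_dd_turn[OF that(1) this]]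
    show ?thesis unfolding g_def g'_def .
  qed
  show "continuous_on (ball p R \<inter> F.S) (g' i)" if "i \<le> m" for i
  proof -
    have "continuous_on U (partial_deriv (b' i) f)"
      using f that by (auto simp: monogenic_def C1_along_def)
    then have "continuous_on (ball p R \<inter> F.S) (\<lambda>z. partial_deriv (b' i) f (turn z))"
      by (rule continuous_on_compose2[OF _ continuous_turn]) (use turn_ball U in blast)
    then show ?thesis unfolding g'_def by (rule bounded_linear.continuous_on[OF L])
  qed
  show "(\<Sum>i=0..m. b i * g' i z) = 0" if z: "z \<in> ball p R \<inter> F.S" for z
  proof -
    have "(\<Sum>i=0..m. b i * g' i z)
        = (1 / 2) *\<^sub>R ((1 - b q * b' q) * (\<Sum>i=0..m. b' i * partial_deriv (b' i) f (turn z)))"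
      unfolding g'_def scaleR_sum_right sum_distrib_left
      by (intro sum.cong refl) (simp add: exchange flip: mult.assoc)
    also have "(\<Sum>i=0..m. b' i * partial_deriv (b' i) f (turn z)) = 0"
      using f U turn_ball[OF z] by (auto simp: monogenic_def)
    finally show ?thesis by simp
  qed
qed

end

lemma clifford_frame_flip:
  assumes "clifford_frame b m" "1 \<le> q" "q \<le> m"
  shows "clifford_frame (b(q := - b q)) m"
proof -
  interpret clifford_frame b m by fact
  show ?thesis
  proof
    show "(b(q := - b q)) i \<bullet> (b(q := - b q)) j = (if i = j then 1 else 0)" if "i \<le> m" "j \<le> m" for i j
      using orth[OF that] by auto
    show "(b(q := - b q)) 0 = 1" using b_0 assms by simp
    show "(b(q := - b q)) i * (b(q := - b q)) i = - 1" if "1 \<le> i" "i \<le> m" for i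
      using b_square[OF that] by (cases "i = q") simp_all
    show "(b(q := - b q)) i * (b(q := - b q)) j = - ((b(q := - b q)) j * (b(q := - b q)) i)"
      if "1 \<le> i" "i \<le> m" "1 \<le> j" "j \<le> m" "i \<noteq> j" for i j
      using b_anticommute[OF that] by auto
  qed
qed

lemma span_flip:
  fixes b :: "nat \<Rightarrow> 'a::real_vector"
  shows "span ((b(q := - b q)) ` A) = span (b ` A)"
proof -
  have "span ((b(q := - b q)) ` A) \<subseteq> span (b ` A)" for b :: "nat \<Rightarrow> 'a"
    by (rule span_minimal) (auto intro: span_neg span_base)
  from this[of b] this[of "b(q := - b q)"] show ?thesis by auto
qed

locale turned_frames = adjacent_frames +
  fixes U U' f
  assumes mono_b: "monogenic b m U f" and ball_b: "ball p R \<inter> F.S \<subseteq> U"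
    and mono_b': "monogenic b' m U' f" and ball_b': "ball p R \<inter> G.S \<subseteq> U'"
    and mono_flip: "monogenic (b'(q := - b' q)) m U' f"
begin

definition flip :: "nat \<Rightarrow> 'a" where "flip = b'(q := - b' q)"

sublocale H: clifford_frame flip m
  unfolding flip_def by (rule clifford_frame_flip) (use q G.clifford_frame_axioms in auto)

lemma S_flip: "H.S = G.S" unfolding flip_def by (rule span_flip)

lemma flip_q: "flip q = - b' q" by (simp add: flip_def)

sublocale B: adjacent_frames b flip m q p R
  using q agree p R S_flip by unfold_locales (auto simp: flip_def)

theorem representation_formula:
  assumes x: "x \<in> ball p R \<inter> F.S"
  shows "f x = (1 / 2) *\<^sub>R ((1 - b q * b' q) * f (turn x)) + (1 / 2) *\<^sub>R ((1 + b q * b' q) * f (B.turn x))"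
proof -
  define g where "g z = f z - ((1 / 2) *\<^sub>R ((1 - b q * b' q) * f (turn z))
    + (1 / 2) *\<^sub>R ((1 - b q * flip q) * f (B.turn z)))" for z
  define g' where "g' i z = partial_deriv (b i) f z
    - ((1 / 2) *\<^sub>R ((1 - b q * b' q) * partial_deriv (b' i) f (turn z))
      + (1 / 2) *\<^sub>R ((1 - b q * flip q) * partial_deriv (flip i) f (B.turn z)))" for i z
  note A1 = monogenic_turn[OF mono_b' ball_b']
  note A2 = B.monogenic_turn[OF mono_flip[folded flip_def] ball_b'[folded S_flip]]
  have dd: "has_dd (b i) g (g' i z) z" if "i \<le> m" "z \<in> ball p R \<inter> F.S" for i z
  proof -
    have "has_dd (b i) f (partial_deriv (b i) f z) z"
      using mono_b ball_b that
      unfolding monogenic_def C1_along_def has_dd_def partial_deriv_def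
      by (auto simp: vector_derivative_works)
    then show ?thesis
      unfolding g_def[abs_def] g'_def by (intro has_dd_diff has_dd_add A1(1) A2(1) that)
  qed
  have pdg: "partial_deriv (b i) g z = g' i z" if "i \<le> m" "z \<in> ball p R \<inter> F.S" for i z
    using has_dd_partial_deriv[OF dd[OF that]] .
  have "monogenic b m (ball p R \<inter> F.S) g"
    unfolding monogenic_def C1_along_def
  proof (intro conjI ballI)
    fix i assume "i \<in> {0..m}"
    then have i: "i \<le> m" by simp
    show "(\<lambda>s. g (x + s *\<^sub>R b i)) differentiable at 0" if "x \<in> ball p R \<inter> F.S" for x
      using dd[OF i that] unfolding has_dd_def by (rule differentiableI_vector)
    have "continuous_on (ball p R \<inter> F.S) (partial_deriv (b i) f)"
      using mono_b ball_b i by (auto simp: monogenic_def C1_along_def intro: continuous_on_subset)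
    then have "continuous_on (ball p R \<inter> F.S) (g' i)"
      unfolding g'_def[abs_def] by (intro continuous_on_diff continuous_on_add A1(2) A2(2) i)
    moreover have "continuous_on (ball p R \<inter> F.S) (partial_deriv (b i) g)
        \<longleftrightarrow> continuous_on (ball p R \<inter> F.S) (g' i)"
      by (rule continuous_on_cong) (use pdg[OF i] in auto)
    ultimately show "continuous_on (ball p R \<inter> F.S) (partial_deriv (b i) g)" by simp
  next
    fix z assume z: "z \<in> ball p R \<inter> F.S"
    have "(\<Sum>i=0..m. b i * partial_deriv (b i) g z) = (\<Sum>i=0..m. b i * g' i z)"
      using pdg z by (intro sum.cong refl) auto
    also have "\<dots> = (\<Sum>i=0..m. b i * partial_deriv (b i) f z)
        - ((\<Sum>i=0..m. b i * ((1 / 2) *\<^sub>R ((1 - b q * b' q) * partial_deriv (b' i) f (turn z))))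
        + (\<Sum>i=0..m. b i * ((1 / 2) *\<^sub>R ((1 - b q * flip q) * partial_deriv (flip i) f (B.turn z)))))"
      unfolding g'_def right_diff_distrib distrib_left[of "b _"] sum_subtractf sum.distrib ..
    also have "\<dots> = 0"
      using A1(3)[OF z] A2(3)[OF z] mono_b ball_b z by (auto simp: monogenic_def)
    finally show "(\<Sum>i=0..m. b i * partial_deriv (b i) g z) = 0" .
  qed
  from F.monogenic_regular[OF p(1) R this] have "F.regular p R g" by simp
  then have "g x = 0"
  proof (rule F.regular_vanishing[OF p(1,3) R q])
    fix z assume "z \<bullet> b q = 0"
    \<comment> \<open>On the hyperplane both turned points equal \<open>z\<close>, and the two
      coefficients add up to 1.\<close>
    then have "turn z = z" "B.turn z = z" by (auto simp: turn_fixed B.turn_fixed)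
    then show "g z = 0" by (simp add: g_def flip_q algebra_simps flip: scaleR_left_distrib)
  qed fact
  then show ?thesis by (simp add: g_def flip_q)
qed

lemma vharm_limit_f: "F.vharm_limit p R f" "G.vharm_limit p R f" "H.vharm_limit p R f"
  using F.monogenic_vharm_limit[OF p(1) R mono_b ball_b] G.monogenic_vharm_limit[OF p(2) R mono_b' ball_b']
    H.monogenic_vharm_limit[OF _ R mono_flip[folded flip_def]] p(2) ball_b' S_flip by auto

text \<open>Turning matches the derivative along \<open>b i\<close> with those along
  \<open>b' i\<close> and \<open>flip i\<close>. Three functions \<open>e\<close>, \<open>g\<close>,
  \<open>h\<close> are allowed because, after derivatives in different frames, they no longer come
  from one function.\<close>

lemma iter_dd_representation:
  assumes g: "G.vharm_limit p R g" and h: "H.vharm_limit p R h" and i: "i \<le> m"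
    and e: "\<And>z. z \<in> ball p R \<inter> F.S \<Longrightarrow> e z = (1 / 2) *\<^sub>R ((1 - b q * b' q) * g (turn z))
      + (1 / 2) *\<^sub>R ((1 + b q * b' q) * h (B.turn z))"
  shows "z \<in> ball p R \<inter> F.S \<Longrightarrow> (F.pd i ^^ n) e z
    = (1 / 2) *\<^sub>R ((1 - b q * b' q) * (G.pd i ^^ n) g (turn z))
      + (1 / 2) *\<^sub>R ((1 + b q * b' q) * (H.pd i ^^ n) h (B.turn z))"
proof (induction n arbitrary: z)
  case (Suc n)
  have L: "bounded_linear (\<lambda>y. (1 / 2) *\<^sub>R (c * y))" for c :: 'a
    by (intro bounded_linear_compose[OF bounded_linear_scaleR_right bounded_linear_mult_algebra])
  have pH: "p \<in> H.S" using p(2) S_flip by simp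
  have "has_dd (b' i) ((G.pd i ^^ n) g) (G.pd i ((G.pd i ^^ n) g) (turn z)) (turn z)"
    using G.vharm_limit_has_dd[OF p(2) G.vharm_limit_iter_dd[OF p(2) g] _ turn_ball[OF Suc.prems]] G.b_in_S i by blast
  from has_dd_turn[OF i this]
  have 1: "has_dd (b i) (\<lambda>z. (G.pd i ^^ n) g (turn z)) (G.pd i ((G.pd i ^^ n) g) (turn z)) z" .
  have "has_dd (flip i) ((H.pd i ^^ n) h) (H.pd i ((H.pd i ^^ n) h) (B.turn z)) (B.turn z)"
    using H.vharm_limit_has_dd[OF pH H.vharm_limit_iter_dd[OF pH h] _ B.turn_ball[OF Suc.prems]] H.b_in_S i by blast
  from B.has_dd_turn[OF i this]
  have 2: "has_dd (b i) (\<lambda>z. (H.pd i ^^ n) h (B.turn z)) (H.pd i ((H.pd i ^^ n) h) (B.turn z)) z" .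
  have "F.pd i ((F.pd i ^^ n) e) z = F.pd i (\<lambda>z. (1 / 2) *\<^sub>R ((1 - b q * b' q) * (G.pd i ^^ n) g (turn z))
      + (1 / 2) *\<^sub>R ((1 + b q * b' q) * (H.pd i ^^ n) h (B.turn z))) z"
    using Suc F.b_in_S[OF i] by (intro F.dd_cong_ball[of p R]) auto
  also have "\<dots> = (1 / 2) *\<^sub>R ((1 - b q * b' q) * G.pd i ((G.pd i ^^ n) g) (turn z))
      + (1 / 2) *\<^sub>R ((1 + b q * b' q) * H.pd i ((H.pd i ^^ n) h) (B.turn z))"
    by (intro has_dd_partial_deriv has_dd_add has_dd_bounded_linear[OF L] 1 2)
  finally show ?case by simp
qed (use e in simp)

lemma pd_list_representation:
  assumes "set L \<subseteq> {0..m}"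
  shows "z \<in> ball p R \<inter> F.S \<Longrightarrow> F.pd_list k L f z
    = (1 / 2) *\<^sub>R ((1 - b q * b' q) * G.pd_list k L f (turn z))
      + (1 / 2) *\<^sub>R ((1 + b q * b' q) * H.pd_list k L f (B.turn z))"
  using assms
proof (induction L arbitrary: z)
  case Nil
  then show ?case using representation_formula by simp
next
  case (Cons i L)
  have pH: "p \<in> H.S" using p(2) S_flip by simp
  have "(F.pd i ^^ k i) (F.pd_list k L f) z
    = (1 / 2) *\<^sub>R ((1 - b q * b' q) * (G.pd i ^^ k i) (G.pd_list k L f) (turn z))
      + (1 / 2) *\<^sub>R ((1 + b q * b' q) * (H.pd i ^^ k i) (H.pd_list k L f) (B.turn z))"
    using Cons G.vharm_limit_pd_list[OF p(2) vharm_limit_f(2), of L] H.vharm_limit_pd_list[OF pH vharm_limit_f(3), of L]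
    by (intro iter_dd_representation) auto
  then show ?case by simp
qed

lemma pd_list_flip:
  assumes "set L \<subseteq> {0..m}"
  shows "y \<in> ball p R \<inter> G.S \<Longrightarrow>
    H.pd_list k L f y = (- 1) ^ (\<Sum>i\<leftarrow>L. if i = q then k i else 0) *\<^sub>R G.pd_list k L f y"
  using assms
proof (induction L arbitrary: y)
  case (Cons i L)
  let ?c = "(- 1) ^ (\<Sum>i\<leftarrow>L. if i = q then k i else 0) :: real" and ?\<sigma> = "if i = q then - 1 else 1 :: real"
  have i: "i \<le> m" and v: "G.vharm_limit p R (G.pd_list k L f)"
    using Cons G.vharm_limit_pd_list[OF p(2) vharm_limit_f(2), of L] by auto
  have "(H.pd i ^^ n) (H.pd_list k L f) y = (?c * ?\<sigma> ^ n) *\<^sub>R (G.pd i ^^ n) (G.pd_list k L f) y"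
    if "y \<in> ball p R \<inter> G.S" for n y
    using that
  proof (induction n arbitrary: y)
    case 0
    then show ?case using Cons by simp
  next
    case (Suc n)
    let ?g = "(G.pd i ^^ n) (G.pd_list k L f)"
    have "has_dd (b' i) ?g (G.pd i ?g y) y"
      using G.vharm_limit_has_dd[OF p(2) G.vharm_limit_iter_dd[OF p(2) v] _ Suc.prems] G.b_in_S i by blast
    then have "has_dd (flip i) ?g (?\<sigma> *\<^sub>R G.pd i ?g y) y"
      using has_dd_minus by (auto simp: flip_def)
    from has_dd_bounded_linear[OF bounded_linear_scaleR_right this]
    have "H.pd i (\<lambda>y. (?c * ?\<sigma> ^ n) *\<^sub>R ?g y) y = (?c * ?\<sigma> ^ n) *\<^sub>R (?\<sigma> *\<^sub>R G.pd i ?g y)"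
      by (rule has_dd_partial_deriv)
    moreover have "H.pd i ((H.pd i ^^ n) (H.pd_list k L f)) y = H.pd i (\<lambda>y. (?c * ?\<sigma> ^ n) *\<^sub>R ?g y) y"
      using Suc S_flip H.b_in_S[OF i] by (intro H.dd_cong_ball[of p R]) auto
    ultimately show ?case by (simp add: mult.commute)
  qed
  from this[OF Cons.prems(1), of "k i"] show ?case
    by (simp add: power_add mult.commute)
qed simp

text \<open>Both turned points of \<open>p\<close> are \<open>p\<close> itself, so the derivatives
  in the flipped frame differ from those in \<open>b'\<close> only by the sign
  \<open>(- 1) ^ k q\<close>.\<close>

lemma iter_partial_turn:
  "iter_partial b m k f p = ((1 / 2) *\<^sub>R (1 - b q * b' q) + ((- 1) ^ k q / 2) *\<^sub>R (1 + b q * b' q))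
     * iter_partial b' m k f p"
proof -
  have "(\<Sum>i\<leftarrow>[0..<m + 1]. if i = q then k i else 0) = (\<Sum>i\<in>set [0..<m + 1]. if i = q then k i else 0)"
    by (rule sum_list_distinct_conv_sum_set) simp
  then have s: "(\<Sum>i\<leftarrow>[0..<m + 1]. if i = q then k i else 0) = k q"
    using q by simp
  have pB: "p \<in> ball p R \<inter> F.S" "p \<in> ball p R \<inter> G.S" using p R by auto
  have L: "set [0..<m + 1] \<subseteq> {0..m}" by auto
  show ?thesis
    using pd_list_representation[OF L pB(1), of k] pd_list_flip[OF L pB(2), of k] s
      turn_fixed[OF p(3)] B.turn_fixed[OF p(3)]
    unfolding iter_partial_def
    by (simp add: distrib_right scaleR_add_right mult.commute del: upt_Suc)
qed

text \<open>The factor \<open>?E\<close> between the derivatives also carries the monomial in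
  \<open>b'\<close> to the one in \<open>b\<close>. For even \<open>k q\<close> it is 1, and even
  powers of the two units agree; for odd \<open>k q\<close> it is \<open>- (b q * b' q)\<close> and
  exchanges one unit.\<close>

theorem adapted_value_turn:
  assumes a: "a < q"
  shows "mult_inverse (F.mono_list k (F.tail_list a)) * iter_partial b m k f p
    = mult_inverse (G.mono_list k (F.tail_list a)) * iter_partial b' m k f p"
proof -
  let ?L = "F.tail_list a"
  let ?E = "(1 / 2) *\<^sub>R (1 - b q * b' q) + ((- 1) ^ k q / 2) *\<^sub>R (1 + b q * b' q)"
  have L: "set ?L \<subseteq> {1..m}" by auto
  have sq: "b q * b q = - 1" "b' q * b' q = - 1" using q F.b_square G.b_square by auto
  have even_eq: "F.mono_list k' ?L = G.mono_list k' ?L" if ev: "even (k' q)" for k'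
  proof -
    have "b i ^ k' i = b' i ^ k' i" if i: "i \<in> set ?L" for i
    proof (cases "i = q")
      case True
      from ev obtain j where "k' q = 2 * j" by (auto elim: evenE)
      then show ?thesis using True sq by (simp add: power_mult power2_eq_square)
    next
      case False
      then show ?thesis using agree[of i] i by auto
    qed
    then show ?thesis
      unfolding F.mono_list_def G.mono_list_def
      by (intro arg_cong[where f = prod_list] map_cong refl) simp
  qed
  have EQ: "?E * G.mono_list k ?L = F.mono_list k ?L"
  proof (cases "even (k q)")
    case True
    then have "?E = 1" by (simp add: algebra_simps flip: scaleR_left_distrib)
    then show ?thesis using even_eq[of k] True by simp
  next
    case False
    then have "?E = - (b q * b' q)" by (simp add: algebra_simps flip: scaleR_left_distrib)
    moreover have "k q > 0" using False by (cases "k q") auto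
    note F.mono_list_tail_split[of a q k, OF a q(2) this] G.mono_list_tail_split[of a q k, OF a q(2) this]
    moreover have "F.mono_list (k(q := k q - 1)) ?L = G.mono_list (k(q := k q - 1)) ?L"
      using False by (intro even_eq) simp
    moreover have "- (b q * b' q) * (b' q * y) = b q * y" for y
    proof -
      have "- (b q * b' q) * (b' q * y) = - (b q * ((b' q * b' q) * y))" by (simp add: mult.assoc)
      then show ?thesis by (simp add: sq)
    qed
    ultimately show ?thesis by simp
  qed
  define X where "X = mult_inverse (G.mono_list k ?L) * iter_partial b' m k f p"
  have "iter_partial b' m k f p = G.mono_list k ?L * X"
    unfolding X_def using G.mult_inverse_mono_list(2)[OF L, of k] by (simp flip: mult.assoc)
  then have "iter_partial b m k f p = F.mono_list k ?L * X"
    unfolding iter_partial_turn EQ[symmetric] by (simp add: mult.assoc)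
  then show ?thesis
    using F.mult_inverse_mono_list(1)[OF L, of k] X_def by (simp flip: mult.assoc)
qed

text \<open>Each of \<open>b q\<close> and \<open>b' q\<close> costs a factor \<Omega>, since the
  norm is not submultiplicative; the two halves of the representation formula together give 1 +
  \<Omega>^2.\<close>

theorem sphere_bound_turn:
  assumes \<Omega>: "\<And>w. norm (b q * w) \<le> \<Omega> * norm w" "\<And>w. norm (b' q * w) \<le> \<Omega> * norm w" "\<Omega> \<ge> 0"
    and r: "r < R" and bd: "\<And>y. y \<in> sphere p r \<inter> G.S \<Longrightarrow> norm (f y) \<le> c"
    and x: "x \<in> sphere p r \<inter> F.S"
  shows "norm (f x) \<le> (1 + \<Omega>\<^sup>2) * c"
proof -
  have e: "norm (b q * b' q * w) \<le> \<Omega>\<^sup>2 * norm w" for w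
  proof -
    have "norm (b q * (b' q * w)) \<le> \<Omega> * norm (b' q * w)" by (rule \<Omega>)
    also have "\<dots> \<le> \<Omega> * (\<Omega> * norm w)" by (intro mult_left_mono \<Omega>)
    finally show ?thesis by (simp add: mult.assoc power2_eq_square)
  qed
  have "turn x \<in> sphere p r \<inter> G.S" "B.turn x \<in> sphere p r \<inter> G.S"
    using x turn_in dist_turn B.turn_in B.dist_turn S_flip by auto
  then have c: "norm (f (turn x)) \<le> c" "norm (f (B.turn x)) \<le> c" using bd by auto
  have part: "norm (w + b q * b' q * w) \<le> (1 + \<Omega>\<^sup>2) * c" "norm (w - b q * b' q * w) \<le> (1 + \<Omega>\<^sup>2) * c"
    if w: "norm w \<le> c" for w
  proof -
    have "norm w + norm (b q * b' q * w) \<le> norm w + \<Omega>\<^sup>2 * norm w" using e by simp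
    also have "\<dots> = (1 + \<Omega>\<^sup>2) * norm w" by (simp add: algebra_simps)
    also have "\<dots> \<le> (1 + \<Omega>\<^sup>2) * c" using w by (intro mult_left_mono) auto
    finally have "norm w + norm (b q * b' q * w) \<le> (1 + \<Omega>\<^sup>2) * c" .
    then show "norm (w + b q * b' q * w) \<le> (1 + \<Omega>\<^sup>2) * c" "norm (w - b q * b' q * w) \<le> (1 + \<Omega>\<^sup>2) * c"
      using norm_triangle_ineq[of w "b q * b' q * w"] norm_triangle_ineq4[of w "b q * b' q * w"] by auto
  qed
  have "x \<in> ball p R \<inter> F.S" using x r by auto
  from representation_formula[OF this]
  have "f x = (1 / 2) *\<^sub>R (f (turn x) - b q * b' q * f (turn x))
      + (1 / 2) *\<^sub>R (f (B.turn x) + b q * b' q * f (B.turn x))"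
    by (simp add: left_diff_distrib distrib_right)
  then have "norm (f x) \<le> norm ((1 / 2) *\<^sub>R (f (turn x) - b q * b' q * f (turn x)))
      + norm ((1 / 2) *\<^sub>R (f (B.turn x) + b q * b' q * f (B.turn x)))"
    by (metis norm_triangle_ineq)
  then show ?thesis using part(2)[OF c(1)] part(1)[OF c(2)] by simp
qed

end

section \<open>Hypercomplex bases and the torus\<close>

lemma bounded_bilinear_algebra:
  "bounded_bilinear ((*) :: 'a::{real_algebra_1, euclidean_space} \<Rightarrow> 'a \<Rightarrow> 'a)"
  by (intro bilinear_conv_bounded_bilinear[THEN iffD1])
    (auto simp: bilinear_def linear_iff distrib_left distrib_right)

lemma continuous_T_poly:
  "continuous_on A (T_poly v \<tau> t k)"
proof -
  have cont: "continuous_on A (\<lambda>x. T_poly v \<tau> t k x)"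
    if IH: "\<And>s. \<not> (\<exists>s\<in>{1..t 0 + \<tau>}. k s < 0) \<Longrightarrow> \<not> (\<forall>s\<in>{1..t 0 + \<tau>}. k s = 0) \<Longrightarrow>
      s \<in> {1..t 0 + \<tau>} \<Longrightarrow> continuous_on A (\<lambda>x. T_poly v \<tau> t (k(s := k s - 1)) x)" for k
  proof (cases "(\<exists>s\<in>{1..t 0 + \<tau>}. k s < 0) \<or> (\<forall>s\<in>{1..t 0 + \<tau>}. k s = 0)")
    case True
    show ?thesis
    proof (cases "\<exists>s\<in>{1..t 0 + \<tau>}. k s < 0")
      case neg: True
      show ?thesis by (subst T_poly.simps) (simp only: if_P[OF neg] continuous_on_const)
    next
      case nonneg: False
      then have "\<forall>s\<in>{1..t 0 + \<tau>}. k s = 0" using True by blast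
      then show ?thesis
        by (subst T_poly.simps) (simp only: if_not_P[OF nonneg] if_P continuous_on_const)
    qed
  next
    case False
    then have c: "\<not> (\<exists>s\<in>{1..t 0 + \<tau>}. k s < 0)" "\<not> (\<forall>s\<in>{1..t 0 + \<tau>}. k s = 0)" by blast+
    show ?thesis
      by (subst T_poly.simps, simp only: if_not_P[OF c(1)] if_not_P[OF c(2)] Let_def block_def of_real_def)
        (intro continuous_on_scaleR continuous_on_add continuous_on_sum continuous_on_diff
          bounded_bilinear.continuous_on[OF bounded_bilinear_algebra] continuous_on_const
          continuous_on_mult continuous_on_inner continuous_on_id IH[OF c]; simp)
  qed
  show ?thesis
  proof (induction "nat (sum k {1..t 0 + \<tau>})" arbitrary: k rule: less_induct)
    case less
    show ?case
      by (rule cont, rule less) (rule T_poly_index_decreases; simp)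
  qed
qed

lemma map_add_const_upt: "map (\<lambda>i. i + a) [b..<c] = [b + a..<c + a]"
  by (induction c) auto

section \<open>Clifford frames given by points of the torus\<close>

locale hypercomplex_torus =
  fixes star :: "'a::{real_algebra_1, euclidean_space} \<Rightarrow> 'a"
    and V :: "'a set" and v :: "nat \<Rightarrow> 'a" and n d \<tau> :: nat and t :: "nat \<Rightarrow> nat"
  assumes basis: "hypercomplex_basis star V n v"
    and completed: "completed_orthonormal n d v"
    and steps: "step_list n \<tau> t"
begin

lemma v_0: "v 0 = 1"
  using basis by (simp add: hypercomplex_basis_def)

lemma v_orth: "i \<le> n \<Longrightarrow> j \<le> n \<Longrightarrow> v i \<bullet> v j = (if i = j then 1 else 0)"
  using completed by (simp add: completed_orthonormal_def)

lemma v_square: "1 \<le> s \<Longrightarrow> s \<le> n \<Longrightarrow> v s * v s = - 1"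
proof -
  assume "1 \<le> s" "s \<le> n"
  then have "v s + star (v s) = 0" "v s * star (v s) = 1"
    using basis by (auto simp: hypercomplex_basis_def imag_units_def)
  moreover from this(1) have "star (v s) = - v s" by (simp add: eq_neg_iff_add_eq_0 add.commute)
  ultimately show ?thesis by (simp add: minus_equation_iff)
qed

lemma v_anticommute: "1 \<le> s \<Longrightarrow> s \<le> n \<Longrightarrow> 1 \<le> u \<Longrightarrow> u \<le> n \<Longrightarrow> s \<noteq> u \<Longrightarrow> v s * v u = - (v u * v s)"
  using basis unfolding hypercomplex_basis_def by (meson atLeastAtMost_iff)

lemma V_span: "V = span (v ` {0..n})"
  using basis by (simp add: hypercomplex_basis_def)

lemma span_orthogonal:
  assumes "A \<subseteq> {0..n}" "B \<subseteq> {0..n}" "A \<inter> B = {}" "x \<in> span (v ` A)" "y \<in> span (v ` B)"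
  shows "x \<bullet> y = 0"
proof -
  have 1: "x \<bullet> v j = 0" if "j \<in> B" for j
    using assms(4)
  proof (rule span_induct)
    fix z assume "z \<in> v ` A"
    then show "z \<bullet> v j = 0" using assms(1-3) that by (auto simp: v_orth subset_iff)
  qed (auto simp: subspace_def inner_add_left)
  show ?thesis
    using assms(5)
  proof (rule span_induct)
    fix z assume "z \<in> v ` B"
    then show "x \<bullet> z = 0" using 1 by auto
  qed (auto simp: subspace_def inner_add_right)
qed

lemma span_expand:
  assumes "A \<subseteq> {0..n}" "x \<in> span (v ` A)"
  shows "x = (\<Sum>l\<in>A. (x \<bullet> v l) *\<^sub>R v l)"
  using assms(2)
proof (induction rule: span_induct_alt)
  case base
  then show ?case by simp
next
  case (step c y z)
  then obtain j where j: "j \<in> A" "y = v j" by auto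
  have fin: "finite A" using assms(1) finite_subset by blast
  have "(\<Sum>l\<in>A. ((c *\<^sub>R y + z) \<bullet> v l) *\<^sub>R v l)
      = (\<Sum>l\<in>A. (if j = l then c *\<^sub>R v j else 0)) + (\<Sum>l\<in>A. (z \<bullet> v l) *\<^sub>R v l)"
    unfolding sum.distrib[symmetric]
  proof (intro sum.cong refl)
    fix l assume "l \<in> A"
    then have "v j \<bullet> v l = (if j = l then 1 else 0)"
      using assms(1) j(1) by (intro v_orth) auto
    then show "((c *\<^sub>R y + z) \<bullet> v l) *\<^sub>R v l = (if j = l then c *\<^sub>R v j else 0) + (z \<bullet> v l) *\<^sub>R v l"
      using j(2) by (auto simp: inner_add_left algebra_simps)
  qed
  then show ?case using step(2) j fin by simp
qed

text \<open>The bilinear form of the relations of the basis. Applied to a unit vector and to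
  orthogonal vectors, it gives the Clifford relations for arbitrary torus directions.\<close>

lemma imaginary_anticommutator:
  assumes "x \<in> span (v ` {1..n})" "y \<in> span (v ` {1..n})"
  shows "x * y + y * x = - (2 * (x \<bullet> y)) *\<^sub>R 1"
proof -
  have 1: "x * v j + v j * x = - (2 * (x \<bullet> v j)) *\<^sub>R 1" if j: "j \<in> {1..n}" for j
    using assms(1)
  proof (rule span_induct)
    fix z assume "z \<in> v ` {1..n}"
    then obtain i where i: "i \<in> {1..n}" "z = v i" by auto
    show "z * v j + v j * z = - (2 * (z \<bullet> v j)) *\<^sub>R 1"
    proof (cases "i = j")
      case True
      then show ?thesis using i j v_square[of j] v_orth[of j j] by (simp add: scaleR_2)
    next
      case False
      then show ?thesis using i j v_anticommute[of i j] v_orth[of i j] by simp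
    qed
  qed (auto simp: subspace_def inner_add_left algebra_simps,
      metis scaleR_right_distrib scaleR_minus_right scaleR_scaleR)
  show ?thesis
    using assms(2)
  proof (rule span_induct)
    fix z assume "z \<in> v ` {1..n}"
    then show "x * z + z * x = - (2 * (x \<bullet> z)) *\<^sub>R 1" using 1 by auto
  qed (auto simp: subspace_def inner_add_right algebra_simps,
      metis scaleR_right_distrib scaleR_minus_right scaleR_scaleR)
qed

lemma t_mono: "i < j \<Longrightarrow> j \<le> \<tau> \<Longrightarrow> t i < t j"
  using steps by (auto simp: step_list_def strict_mono_on_def)

lemma t_le: "i \<le> j \<Longrightarrow> j \<le> \<tau> \<Longrightarrow> t i \<le> t j"
  using t_mono[of i j] by (cases "i = j") auto

lemma t_le_n: "i \<le> \<tau> \<Longrightarrow> t i \<le> n"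
  using t_le[of i \<tau>] steps by (simp add: step_list_def)

abbreviation blk :: "nat \<Rightarrow> nat set" where "blk h \<equiv> {t (h - 1) + 1..t h}"

lemma blk_sub: "1 \<le> h \<Longrightarrow> h \<le> \<tau> \<Longrightarrow> blk h \<subseteq> {1..n}" "1 \<le> h \<Longrightarrow> h \<le> \<tau> \<Longrightarrow> blk h \<subseteq> {0..n}"
  using t_le_n[of h] by auto

lemma blk_mirror: "1 \<le> h \<Longrightarrow> h \<le> \<tau> \<Longrightarrow> {0..t 0} \<inter> blk h = {}"
proof -
  assume "1 \<le> h" "h \<le> \<tau>"
  then have "t 0 \<le> t (h - 1)" by (intro t_le) auto
  then show ?thesis by auto
qed

lemma blk_disjoint: "1 \<le> h \<Longrightarrow> h < h' \<Longrightarrow> h' \<le> \<tau> \<Longrightarrow> blk h \<inter> blk h' = {}"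
proof -
  assume "1 \<le> h" "h < h'" "h' \<le> \<tau>"
  then have "t h \<le> t (h' - 1)" by (intro t_le) auto
  then show ?thesis by auto
qed

lemma torusD:
  assumes "J \<in> torus v \<tau> t" "1 \<le> h" "h \<le> \<tau>"
  shows "J h \<in> span (v ` blk h)" "norm (J h) = 1"
  using assms by (auto simp: torus_def unit_sphere_in_def PiE_iff)

abbreviation m :: nat where "m \<equiv> t 0 + \<tau>"

lemma frame_imaginary:
  assumes "J \<in> torus v \<tau> t" "1 \<le> i" "i \<le> m"
  shows "frame v t J i \<in> span (v ` {1..n})"
proof (cases "i \<le> t 0")
  case True
  then show ?thesis using assms t_le_n[of 0] by (auto simp: frame_def intro!: span_base)
next
  case False
  then have h: "1 \<le> i - t 0" "i - t 0 \<le> \<tau>" using assms by auto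
  then show ?thesis
    using torusD(1)[OF assms(1) h] span_mono[OF image_mono[OF blk_sub(1)[OF h]]] False
    by (auto simp: frame_def)
qed

lemma frame_orth:
  assumes J: "J \<in> torus v \<tau> t" and "i \<le> m" "j \<le> m"
  shows "frame v t J i \<bullet> frame v t J j = (if i = j then 1 else 0)"
  using assms(2,3)
proof (induction i j rule: linorder_wlog)
  case (sym i j)
  then show ?case by (auto simp: inner_commute)
next
  case (le i j)
  show ?case
  proof (cases "j \<le> t 0")
    case True
    then show ?thesis using le t_le_n[of 0] by (simp add: frame_def v_orth)
  next
    case False
    define h where "h = j - t 0"
    have h: "1 \<le> h" "h \<le> \<tau>" "frame v t J j = J h" using False le by (auto simp: h_def frame_def)
    note Jh = torusD[OF J h(1,2)]
    show ?thesis
    proof (cases "i \<le> t 0")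
      case True
      then have "v i \<in> span (v ` {0..t 0})" by (auto intro: span_base)
      then have "v i \<bullet> J h = 0"
        using span_orthogonal[OF _ blk_sub(2)[OF h(1,2)] blk_mirror[OF h(1,2)]] t_le_n[of 0] Jh by auto
      then show ?thesis using True False h by (auto simp: frame_def)
    next
      case nT: False
      define g where "g = i - t 0"
      have g: "1 \<le> g" "g \<le> \<tau>" "frame v t J i = J g" "g \<le> h" using nT False le by (auto simp: g_def h_def frame_def)
      show ?thesis
      proof (cases "g = h")
        case True
        then show ?thesis using g h Jh nT False by (auto simp: norm_eq_1 g_def h_def)
      next
        case nGH: False
        then have "J g \<bullet> J h = 0"
          using span_orthogonal[OF blk_sub(2)[OF g(1,2)] blk_sub(2)[OF h(1,2)] blk_disjoint]
            torusD[OF J g(1,2)] Jh g h by auto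
        then show ?thesis using nGH g h by (auto simp: g_def h_def)
      qed
    qed
  qed
qed

lemma frame_clifford:
  assumes J: "J \<in> torus v \<tau> t"
  shows "clifford_frame (frame v t J) m"
proof
  show "frame v t J i \<bullet> frame v t J j = (if i = j then 1 else 0)" if "i \<le> m" "j \<le> m" for i j
    using frame_orth[OF J that] .
  show "frame v t J 0 = 1" by (simp add: frame_def v_0)
  show "frame v t J i * frame v t J i = - 1" if i: "1 \<le> i" "i \<le> m" for i
  proof -
    let ?x = "frame v t J i"
    have "?x * ?x + ?x * ?x = - (2 * (?x \<bullet> ?x)) *\<^sub>R 1"
      using frame_imaginary[OF J i] by (intro imaginary_anticommutator)
    then have "2 *\<^sub>R (?x * ?x) = 2 *\<^sub>R (- 1 :: 'a)"
      using frame_orth[OF J i(2) i(2)] by (simp add: scaleR_2)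
    then show ?thesis by (simp only: scaleR_cancel_left) simp
  qed
  show "frame v t J i * frame v t J j = - (frame v t J j * frame v t J i)"
    if i: "1 \<le> i" "i \<le> m" and j: "1 \<le> j" "j \<le> m" and ij: "i \<noteq> j" for i j
    using imaginary_anticommutator[OF frame_imaginary[OF J i] frame_imaginary[OF J j]]
      frame_orth[OF J i(2) j(2)] ij by (simp add: eq_neg_iff_add_eq_0)
qed

lemma slice_sub_V:
  assumes "J \<in> torus v \<tau> t"
  shows "slice v \<tau> t J \<subseteq> V"
  unfolding slice_def V_span
proof (rule span_minimal)
  show "frame v t J ` {0..t 0 + \<tau>} \<subseteq> span (v ` {0..n})"
  proof
    fix x assume "x \<in> frame v t J ` {0..t 0 + \<tau>}"
    then obtain i where i: "i \<le> m" "x = frame v t J i" by auto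
    show "x \<in> span (v ` {0..n})"
    proof (cases "i = 0")
      case True
      then show ?thesis using i by (auto simp: frame_def intro!: span_base)
    next
      case False
      then have "x \<in> span (v ` {1..n})" using frame_imaginary[OF assms, of i] i by auto
      moreover have "v ` {1..n} \<subseteq> v ` {0..n}" by auto
      ultimately show ?thesis using span_mono by blast
    qed
  qed
qed simp

lemma mirror_sub_slice: "mirror v t \<subseteq> slice v \<tau> t J"
  unfolding mirror_def slice_def
proof (rule span_mono)
  show "v ` {0..t 0} \<subseteq> frame v t J ` {0..t 0 + \<tau>}"
  proof
    fix x assume "x \<in> v ` {0..t 0}"
    then obtain i where "i \<le> t 0" "x = v i" by auto
    then show "x \<in> frame v t J ` {0..t 0 + \<tau>}"
      by (intro image_eqI[of _ _ i]) (auto simp: frame_def)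
  qed
qed

lemma mirror_orthogonal:
  assumes "J \<in> torus v \<tau> t" "p \<in> mirror v t" "1 \<le> h" "h \<le> \<tau>"
  shows "p \<bullet> J h = 0"
  using span_orthogonal[OF _ blk_sub(2)[OF assms(3,4)] blk_mirror[OF assms(3,4)], of p "J h"]
    torusD[OF assms(1,3,4)] assms(2) t_le_n[of 0] by (auto simp: mirror_def)

lemma v_in_unit_sphere:
  assumes "1 \<le> h" "h \<le> \<tau>"
  shows "v (t h) \<in> unit_sphere_in v (t (h - 1) + 1) (t h)"
proof -
  have "t (h - 1) < t h" using t_mono[of "h - 1" h] assms by simp
  moreover have "norm (v (t h)) = 1" using v_orth[of "t h" "t h"] t_le_n[of h] assms by (simp add: norm_eq_1)
  ultimately show ?thesis by (auto simp: unit_sphere_in_def intro!: span_base)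
qed

lemma torus_nonempty: "torus v \<tau> t \<noteq> {}"
  unfolding torus_def PiE_eq_empty_iff using v_in_unit_sphere by fastforce

lemma block_in: "1 \<le> h \<Longrightarrow> block v t h x \<in> span (v ` blk h)"
  unfolding block_def by (intro span_sum span_scale span_base) auto

lemma sum_blocks:
  "h \<le> \<tau> \<Longrightarrow> (\<Sum>l=0..t h. (x \<bullet> v l) *\<^sub>R v l) = (\<Sum>l=0..t 0. (x \<bullet> v l) *\<^sub>R v l) + (\<Sum>j=1..h. block v t j x)"
proof (induction h)
  case (Suc h)
  have "t h < t (Suc h)" using t_mono[of h "Suc h"] Suc.prems by simp
  then have "{0..t (Suc h)} = {0..t h} \<union> {t h + 1..t (Suc h)}" by auto
  then have "(\<Sum>l=0..t (Suc h). (x \<bullet> v l) *\<^sub>R v l)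
      = (\<Sum>l=0..t h. (x \<bullet> v l) *\<^sub>R v l) + (\<Sum>l=t h + 1..t (Suc h). (x \<bullet> v l) *\<^sub>R v l)"
    by (simp add: sum.union_disjoint)
  then show ?case using Suc by (simp add: block_def add.assoc)
qed simp

lemma in_some_slice:
  assumes "x \<in> V"
  obtains J where "J \<in> torus v \<tau> t" "x \<in> slice v \<tau> t J"
proof
  \<comment> \<open>Each block of \<open>x\<close> is normalised; a zero block has no direction, and
    \<open>v (t h)\<close> serves as some unit vector of its span.\<close>
  define J where "J = (\<lambda>h\<in>{1..\<tau>}. if block v t h x = 0 then v (t h) else sgn (block v t h x))"
  show J: "J \<in> torus v \<tau> t"
    unfolding torus_def
  proof (rule PiE_I)
    fix h assume h: "h \<in> {1..\<tau>}"
    show "J h \<in> unit_sphere_in v (t (h - 1) + 1) (t h)"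
    proof (cases "block v t h x = 0")
      case True
      then show ?thesis using v_in_unit_sphere h by (simp add: J_def)
    next
      case False
      then show ?thesis
        using h block_in[of h x] by (auto simp: J_def unit_sphere_in_def norm_sgn sgn_div_norm span_scale)
    qed
  qed (auto simp: J_def)
  have frame_in: "frame v t J i \<in> slice v \<tau> t J" if "i \<le> m" for i
    unfolding slice_def using that by (intro span_base) auto
  have vi: "v l \<in> slice v \<tau> t J" if "l \<le> t 0" for l
    using frame_in[of l] that by (simp add: frame_def)
  have bi: "block v t j x \<in> slice v \<tau> t J" if j: "j \<in> {1..\<tau>}" for j
  proof -
    have "J j \<in> slice v \<tau> t J" using frame_in[of "t 0 + j"] j by (simp add: frame_def)
    moreover have "block v t j x = norm (block v t j x) *\<^sub>R J j"
      using j by (auto simp: J_def sgn_div_norm)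
    ultimately show ?thesis unfolding slice_def by (metis span_scale)
  qed
  have "x = (\<Sum>l=0..t \<tau>. (x \<bullet> v l) *\<^sub>R v l)"
    using span_expand[of "{0..n}" x] assms V_span steps by (simp add: step_list_def)
  also have "\<dots> = (\<Sum>l=0..t 0. (x \<bullet> v l) *\<^sub>R v l) + (\<Sum>j=1..\<tau>. block v t j x)"
    by (rule sum_blocks) simp
  also have "\<dots> \<in> slice v \<tau> t J"
    using vi bi unfolding slice_def by (intro span_add span_sum span_scale) auto
  finally show "x \<in> slice v \<tau> t J" .
qed

text \<open>On a slice a whole block lies along one torus direction; this is what expresses
  \<open>T_poly\<close> there in frame coordinates.\<close>

lemma block_slice:
  assumes J: "J \<in> torus v \<tau> t" and h: "1 \<le> h" "h \<le> \<tau>" and x: "x \<in> slice v \<tau> t J"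
  shows "block v t h x = (x \<bullet> J h) *\<^sub>R J h"
  using x unfolding slice_def
proof (rule span_induct)
  fix z assume "z \<in> frame v t J ` {0..t 0 + \<tau>}"
  then obtain i where i: "i \<le> m" "z = frame v t J i" by auto
  have zero: "block v t h z = (z \<bullet> J h) *\<^sub>R J h"
    if A: "A \<subseteq> {0..n}" "A \<inter> blk h = {}" "z \<in> span (v ` A)" for A
  proof -
    have "z \<bullet> y = 0" if "y \<in> span (v ` blk h)" for y
      using span_orthogonal[OF A(1) blk_sub(2)[OF h] A(2,3) that] .
    from this[of "J h"] this[of "v _"] show ?thesis
      using torusD[OF J h] unfolding block_def by (auto intro!: sum.neutral simp: span_base)
  qed
  consider "i \<le> t 0" | "i = t 0 + h" | "i > t 0" "i \<noteq> t 0 + h" by linarith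
  then show "block v t h z = (z \<bullet> J h) *\<^sub>R J h"
  proof cases
    case 1
    then show ?thesis
      using i blk_mirror[OF h] t_le_n[of 0] by (intro zero[of "{0..t 0}"]) (auto simp: frame_def intro: span_base)
  next
    case 2
    then have "z = J h" using i h by (simp add: frame_def)
    then show ?thesis
      using span_expand[OF blk_sub(2)[OF h] torusD(1)[OF J h]] torusD(2)[OF J h]
      by (simp add: block_def norm_eq_1)
  next
    case 3
    define g where "g = i - t 0"
    have g: "1 \<le> g" "g \<le> \<tau>" "g \<noteq> h" "z = J g" using 3 i by (auto simp: g_def frame_def)
    then have "blk g \<inter> blk h = {}"
      using blk_disjoint[of g h] blk_disjoint[of h g] h by (cases "g < h") (auto simp: Int_commute)
    then show ?thesis
      using zero[OF blk_sub(2)[OF g(1,2)]] torusD(1)[OF J g(1,2)] g(4) by simp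
  qed
qed (auto simp: subspace_def block_def inner_add_left sum.distrib algebra_simps,
    simp flip: scaleR_scaleR scaleR_sum_right)

lemma unit_monomial_eq:
  assumes "clifford_frame (frame v t J) m"
  shows "unit_monomial \<tau> t k J = clifford_frame.mono_list (frame v t J) k (rev [t 0 + 1..<m + 1])"
proof -
  interpret clifford_frame "frame v t J" m by fact
  have "[t 0 + 1..<m + 1] = map (\<lambda>i. i + t 0) [1..<\<tau> + 1]"
    using map_add_const_upt[of "t 0" 1 "\<tau> + 1"] by (simp add: add.commute del: upt_Suc)
  then have "rev [t 0 + 1..<m + 1] = map (\<lambda>i. i + t 0) (rev [1..<\<tau> + 1])"
    by (simp only: rev_map)
  moreover have "map (\<lambda>i. J i ^ k (t 0 + i)) (rev [1..<\<tau> + 1])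
      = map (\<lambda>i. frame v t J i ^ k i) (map (\<lambda>i. i + t 0) (rev [1..<\<tau> + 1]))"
    by (auto simp: frame_def add.commute simp del: upt_Suc)
  ultimately show ?thesis unfolding unit_monomial_def mono_list_def by (simp only:)
qed

lemma v_in_V: "i \<le> n \<Longrightarrow> v i \<in> V"
  unfolding V_span by (intro span_base) auto

lemma omega_bdd: "bdd_above {norm (u * w) |u w. u \<in> V \<and> norm u = 1 \<and> norm w = 1}"
proof -
  obtain K where K: "\<And>u w :: 'a. norm (u * w) \<le> norm u * norm w * K"
    using bounded_bilinear.bounded[OF bounded_bilinear_algebra] by blast
  show ?thesis
  proof (rule bdd_aboveI)
    fix y assume "y \<in> {norm (u * w) |u w. u \<in> V \<and> norm u = 1 \<and> norm w = 1}"
    then obtain u w :: 'a where "y = norm (u * w)" "norm u = 1" "norm w = 1" by auto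
    then show "y \<le> K" using K[of u w] by simp
  qed
qed

lemma omega_bound: "u \<in> V \<Longrightarrow> norm u = 1 \<Longrightarrow> norm (u * w) \<le> omega V * norm w"
proof (cases "w = 0")
  case False
  assume u: "u \<in> V" "norm u = 1"
  have "norm (u * sgn w) \<le> omega V"
    unfolding omega_def using u False
    by (intro cSup_upper omega_bdd) (rule CollectI, rule exI[of _ u], rule exI[of _ "sgn w"], simp add: norm_sgn)
  then have "norm w * norm (u * sgn w) \<le> norm w * omega V" by (intro mult_left_mono) auto
  moreover have "norm w *\<^sub>R sgn w = w" using False by (simp add: sgn_div_norm)
  then have "u * w = norm w *\<^sub>R (u * sgn w)" by (metis mult_scaleR_right)
  then have "norm (u * w) = norm w * norm (u * sgn w)" by simp
  ultimately show ?thesis by (simp add: mult.commute)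
qed simp

text \<open>The unit of the algebra is a member of an orthonormal basis, so it has norm 1 and
  competes in the supremum.\<close>

lemma omega_ge_1: "1 \<le> omega V"
proof -
  have "norm (1::'a) = 1" using v_orth[of 0 0] v_0 by (simp add: norm_eq_1)
  then show ?thesis using omega_bound[of 1 1] v_in_V[of 0] v_0 by simp
qed

end

lemma monogenic_subset: "monogenic b m U f \<Longrightarrow> U' \<subseteq> U \<Longrightarrow> monogenic b m U' f"
  by (auto simp: monogenic_def C1_along_def subset_iff intro: continuous_on_subset)

section \<open>Taylor series of T-regular functions about a mirror point\<close>

locale T_regular_ball = hypercomplex_torus star V v n d \<tau> t
  for star :: "'a::{real_algebra_1, euclidean_space} \<Rightarrow> 'a" and V v n d \<tau> t +
  fixes \<Omega> :: "'a set" and f :: "'a \<Rightarrow> 'a" and p :: 'a and R :: real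
  assumes reg: "T_regular v \<tau> t \<Omega> f" and p: "p \<in> mirror v t" and R: "R > 0"
    and ball: "ball p R \<inter> V \<subseteq> \<Omega>"
begin

lemma monogenic_frame:
  assumes J: "J \<in> torus v \<tau> t"
  shows "monogenic (frame v t J) m (\<Omega> \<inter> slice v \<tau> t J) f"
    "ball p R \<inter> slice v \<tau> t J \<subseteq> \<Omega> \<inter> slice v \<tau> t J"
  using reg J slice_sub_V[OF J] ball by (auto simp: T_regular_def)

lemma p_in: "p \<in> slice v \<tau> t J" "p \<in> V"
  using p mirror_sub_slice slice_sub_V torus_nonempty by blast+

abbreviation turnable where "turnable J s a \<equiv> J \<in> torus v \<tau> t \<and> 1 \<le> s \<and> s \<le> \<tau> \<and> J(s := a) \<in> torus v \<tau> t"

lemma frame_upd: "frame v t (J(s := a)) i = (if i = t 0 + s \<and> s \<ge> 1 then a else frame v t J i)"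
  by (auto simp: frame_def)

lemma torus_uminus:
  assumes "J \<in> torus v \<tau> t" "1 \<le> s" "s \<le> \<tau>"
  shows "J(s := - J s) \<in> torus v \<tau> t"
  using assms by (auto simp: torus_def PiE_iff unit_sphere_in_def span_neg extensional_def)

text \<open>Reversing one torus component stays in the torus and does not change the slice, so
  T-regularity provides the Dirac equation for the flipped frame as well.\<close>

lemma turned:
  assumes "turnable J s a"
  shows "turned_frames (frame v t J) (frame v t (J(s := a))) m (t 0 + s) p R
    (\<Omega> \<inter> slice v \<tau> t J) (\<Omega> \<inter> slice v \<tau> t (J(s := a))) f"
proof -
  let ?J = "J(s := a)" and ?q = "t 0 + s"
  have J: "J \<in> torus v \<tau> t" "?J \<in> torus v \<tau> t" and s: "1 \<le> s" "s \<le> \<tau>" using assms by auto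
  interpret F: clifford_frame "frame v t J" m by (rule frame_clifford[OF J(1)])
  interpret G: clifford_frame "frame v t ?J" m by (rule frame_clifford[OF J(2)])
  have flip: "(frame v t ?J)(?q := - frame v t ?J ?q) = frame v t (?J(s := - ?J s))"
    using s by (auto simp: frame_def fun_eq_iff)
  have "slice v \<tau> t (?J(s := - ?J s)) = slice v \<tau> t ?J"
    unfolding slice_def flip[symmetric] by (rule span_flip)
  then have mono_flip: "monogenic ((frame v t ?J)(?q := - frame v t ?J ?q)) m (\<Omega> \<inter> slice v \<tau> t ?J) f"
    unfolding flip using monogenic_frame(1)[OF torus_uminus[OF J(2) s]] by simp
  show ?thesis
  proof
    show "1 \<le> ?q" "?q \<le> m" using s by auto
    show "frame v t J i = frame v t ?J i" if "i \<noteq> ?q" for i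
      using that by (simp only: frame_upd) auto
    show "p \<in> F.S" "p \<in> G.S" using p_in(1) unfolding slice_def by blast+
    show "p \<bullet> frame v t J ?q = 0"
      using mirror_orthogonal[OF J(1) p s] s by (simp add: frame_def)
  qed (use R monogenic_frame[OF J(1), unfolded slice_def] monogenic_frame[OF J(2), unfolded slice_def]
      mono_flip[unfolded slice_def] in \<open>simp_all only: slice_def\<close>)
qed

text \<open>\<open>H k\<close> takes its components up to \<open>k\<close> from \<open>I\<close>.
  Neighbours in this chain from \<open>J\<close> to \<open>I\<close> differ at most in one
  direction, as the comparison of slices requires.\<close>

lemma torus_chain:
  assumes J: "J \<in> torus v \<tau> t" and I: "I \<in> torus v \<tau> t"
  defines "H \<equiv> \<lambda>k h. if h \<le> k then I h else J h"
  shows "H \<tau> = I" "k \<le> \<tau> \<Longrightarrow> H k \<in> torus v \<tau> t"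
    "k < \<tau> \<Longrightarrow> H (Suc k) = (H k)(Suc k := I (Suc k))"
proof -
  have out: "I h = undefined" "J h = undefined" if "h \<notin> {1..\<tau>}" for h
    using that I J by (auto simp: torus_def PiE_iff extensional_def)
  show "H \<tau> = I" using out by (fastforce simp: H_def)
  show "H k \<in> torus v \<tau> t" if "k \<le> \<tau>"
    unfolding torus_def
  proof (rule PiE_I)
    fix h assume "h \<in> {1..\<tau>}"
    then show "H k h \<in> unit_sphere_in v (t (h - 1) + 1) (t h)"
      using I J by (auto simp: H_def torus_def PiE_iff)
  next
    fix h assume "h \<notin> {1..\<tau>}"
    then show "H k h = undefined" using out by (simp add: H_def)
  qed
  show "H (Suc k) = (H k)(Suc k := I (Suc k))" by (auto simp: H_def fun_eq_iff le_Suc_eq)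
qed

lemma torus_chain_0:
  assumes "J \<in> torus v \<tau> t" "I \<in> torus v \<tau> t"
  shows "(\<lambda>h. if h \<le> 0 then I h else J h) = J"
  using assms by (auto simp: torus_def PiE_iff extensional_def fun_eq_iff)

definition adapted_value :: "(nat \<Rightarrow> nat) \<Rightarrow> (nat \<Rightarrow> 'a) \<Rightarrow> 'a" where
  "adapted_value h J = mult_inverse (unit_monomial \<tau> t h J) * iter_partial (frame v t J) m h f p"

lemma adapted_value_turned:
  assumes "turnable J s a"
  shows "adapted_value h J = adapted_value h (J(s := a))"
proof -
  interpret turned_frames "frame v t J" "frame v t (J(s := a))" m "t 0 + s" p R
    "\<Omega> \<inter> slice v \<tau> t J" "\<Omega> \<inter> slice v \<tau> t (J(s := a))" f
    by (rule turned[OF assms])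
  have "t 0 < t 0 + s" using assms by simp
  from adapted_value_turn[OF this, of h] show ?thesis
    unfolding adapted_value_def unit_monomial_eq[OF F.clifford_frame_axioms] unit_monomial_eq[OF G.clifford_frame_axioms] .
qed

lemma adapted_value_eq:
  assumes J: "J \<in> torus v \<tau> t" and I: "I \<in> torus v \<tau> t"
  shows "adapted_value h J = adapted_value h I"
proof -
  let ?H = "\<lambda>k h. if h \<le> k then I h else J h"
  have "k \<le> \<tau> \<Longrightarrow> adapted_value h J = adapted_value h (?H k)" for k
  proof (induction k)
    case 0
    show ?case unfolding torus_chain_0[OF J I] ..
  next
    case (Suc k)
    then have "turnable (?H k) (Suc k) (I (Suc k))"
      using torus_chain(2,3)[OF J I, of k] torus_chain(2)[OF J I, of "Suc k"] by auto
    from adapted_value_turned[OF this, of h] Suc torus_chain(3)[OF J I, of k] show ?case by simp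
  qed
  from this[of \<tau>] torus_chain(1)[OF J I] show ?thesis by simp
qed

text \<open>\<open>p\<close> lies on every slice, so the description in \<open>adapted_deriv\<close>
  ranges over the whole torus, on which the value is constant.\<close>

lemma adapted_deriv_eq:
  assumes J: "J \<in> torus v \<tau> t"
  shows "adapted_deriv v \<tau> t h f p = adapted_value h J"
  unfolding adapted_deriv_def
proof (rule the_equality)
  show "\<forall>I\<in>torus v \<tau> t. p \<in> slice v \<tau> t I \<longrightarrow>
      adapted_value h J = mult_inverse (unit_monomial \<tau> t h I) * iter_partial (frame v t I) m h f p"
    using adapted_value_eq[OF J] by (simp add: adapted_value_def)
next
  fix y assume "\<forall>I\<in>torus v \<tau> t. p \<in> slice v \<tau> t I \<longrightarrow>
      y = mult_inverse (unit_monomial \<tau> t h I) * iter_partial (frame v t I) m h f p"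
  then show "y = adapted_value h J" using J p_in by (simp add: adapted_value_def)
qed

text \<open>The monomial on the right of \<open>T_poly\<close> meets the inverse of the same
  monomial in the adapted derivative; what remains is the Fueter form of the Taylor polynomial on
  the slice.\<close>

lemma taylor_term_slice:
  assumes J: "J \<in> torus v \<tau> t" and x: "x \<in> slice v \<tau> t J"
  shows "taylor_term v \<tau> t f p K x = (1 / fact K) *\<^sub>R (partial_deriv (x - p) ^^ K) f p"
proof -
  interpret clifford_frame "frame v t J" m by (rule frame_clifford[OF J])
  let ?L = "rev [t 0 + 1..<m + 1]"
  have S: "S = slice v \<tau> t J" by (simp add: slice_def)
  have xp: "x - p \<in> S" using x p_in(1)[of J] unfolding slice_def by (intro span_diff)
  have pS: "p \<in> S" using p_in S by simp
  have f: "regular p R f"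
    using monogenic_regular[OF pS R] monogenic_frame[OF J] S by simp
  have summand: "T_poly v \<tau> t (\<lambda>s. int (k s)) (x - p) *
        ((1 / multi_fact m k) *\<^sub>R adapted_deriv v \<tau> t (k(0 := 0)) f p)
      = (1 / fact K) *\<^sub>R ((fact K / multi_fact m k) *\<^sub>R (fueter K k (x - p) * iter_partial (frame v t J) m k f p))"
    if k: "k \<in> multi_indices m K" for k
  proof -
    have k0: "k(0 := 0) = k" and kK: "(\<Sum>s=1..m. k s) = K"
      using k by (auto simp: multi_indices_def fun_eq_iff)
    have "T_poly v \<tau> t (\<lambda>s. int (k s)) (x - p) = fueter K k (x - p) * mono_list k ?L"
      using T_poly_fueter[OF refl refl, of "x - p" k] block_slice[OF J _ _ xp[unfolded S]] kK by simp
    moreover have "adapted_deriv v \<tau> t k f p = mult_inverse (mono_list k ?L) * iter_partial (frame v t J) m k f p"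
      unfolding adapted_deriv_eq[OF J] adapted_value_def unit_monomial_eq[OF clifford_frame_axioms] ..
    moreover have "mono_list k ?L * (mult_inverse (mono_list k ?L) * y) = y" for y
    proof -
      have "set ?L \<subseteq> {1..m}" by auto
      from mult_inverse_mono_list(2)[OF this, of k] show ?thesis by (simp only: mult.assoc[symmetric] mult_1_left)
    qed
    ultimately show ?thesis unfolding k0 by (simp add: mult.assoc)
  qed
  show ?thesis
    unfolding taylor_term_def regular_taylor_fueter[OF pS R xp f] scaleR_sum_right
    by (intro sum.cong refl summand)
qed

lemma taylor_sums:
  assumes "x \<in> ball p R \<inter> V"
  shows "(\<lambda>k. taylor_term v \<tau> t f p k x) sums f x"
proof -
  obtain J where J: "J \<in> torus v \<tau> t" "x \<in> slice v \<tau> t J"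
    using in_some_slice[of x] assms by auto
  interpret clifford_frame "frame v t J" m by (rule frame_clifford[OF J(1)])
  have xp: "x - p \<in> S" "p \<in> S" using J(2) p_in(1)[of J] unfolding slice_def by (auto intro: span_diff)
  have "vharm_limit p R f"
    using monogenic_vharm_limit[OF xp(2) R] monogenic_frame[OF J(1)] by (simp add: slice_def)
  from vharm_limit_taylor_sums[OF xp(2) this xp(1)] assms show ?thesis
    by (simp add: taylor_term_slice[OF J] dist_norm norm_minus_commute)
qed

lemma sphere_bound:
  assumes J: "J \<in> torus v \<tau> t" and I: "I \<in> torus v \<tau> t" and r: "r < R"
    and bd: "\<And>y. y \<in> sphere p r \<inter> slice v \<tau> t I \<Longrightarrow> norm (f y) \<le> c"
    and x: "x \<in> sphere p r \<inter> slice v \<tau> t J"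
  shows "norm (f x) \<le> (1 + (omega V)\<^sup>2) ^ \<tau> * c"
proof -
  let ?H = "\<lambda>k h. if h \<le> k then I h else J h"
  have one: "norm (f x) \<le> (1 + (omega V)\<^sup>2) * c"
    if tb: "turnable J s a" and bd: "\<And>y. y \<in> sphere p r \<inter> slice v \<tau> t (J(s := a)) \<Longrightarrow> norm (f y) \<le> c"
      and x: "x \<in> sphere p r \<inter> slice v \<tau> t J" for J s a c x
  proof -
    interpret turned_frames "frame v t J" "frame v t (J(s := a))" m "t 0 + s" p R
      "\<Omega> \<inter> slice v \<tau> t J" "\<Omega> \<inter> slice v \<tau> t (J(s := a))" f
      by (rule turned[OF tb])
    have "norm (frame v t J' (t 0 + s) * w) \<le> omega V * norm w" if J': "J' \<in> torus v \<tau> t" for J' w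
    proof (rule omega_bound)
      have "frame v t J' (t 0 + s) \<in> slice v \<tau> t J'"
        using tb unfolding slice_def by (intro span_base) auto
      then show "frame v t J' (t 0 + s) \<in> V" using slice_sub_V[OF J'] by blast
      show "norm (frame v t J' (t 0 + s)) = 1"
        using frame_orth[OF J', of "t 0 + s" "t 0 + s"] tb by (simp add: norm_eq_1)
    qed
    then show ?thesis
      using sphere_bound_turn[of "omega V" r c x] omega_ge_1 tb bd x r by (simp add: slice_def)
  qed
  \<comment> \<open>\<open>k\<close> counts the components still to be changed on the way to
    \<open>I\<close>; each change costs one factor.\<close>
  have "k \<le> \<tau> \<Longrightarrow> x \<in> sphere p r \<inter> slice v \<tau> t (?H (\<tau> - k)) \<Longrightarrow> norm (f x) \<le> (1 + (omega V)\<^sup>2) ^ k * c" for k x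
  proof (induction k arbitrary: x)
    case 0
    then show ?case using bd torus_chain(1)[OF J I] by simp
  next
    case (Suc k)
    let ?j = "\<tau> - Suc k"
    have j: "Suc ?j = \<tau> - k" "?j < \<tau>" using Suc.prems by auto
    have upd: "?H (Suc ?j) = (?H ?j)(Suc ?j := I (Suc ?j))"
      using torus_chain(3)[OF J I j(2)] .
    have upd': "(?H ?j)(Suc ?j := I (Suc ?j)) = ?H (\<tau> - k)"
      by (subst upd[symmetric]) (simp only: j(1))
    have "turnable (?H ?j) (Suc ?j) (I (Suc ?j))"
      using torus_chain(2)[OF J I, of ?j] torus_chain(2)[OF J I, of "Suc ?j"] j unfolding upd[symmetric] by auto
    then have "norm (f x) \<le> (1 + (omega V)\<^sup>2) * ((1 + (omega V)\<^sup>2) ^ k * c)"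
    proof (rule one)
      fix y assume "y \<in> sphere p r \<inter> slice v \<tau> t ((?H ?j)(Suc ?j := I (Suc ?j)))"
      then have "y \<in> sphere p r \<inter> slice v \<tau> t (?H (\<tau> - k))" by (simp only: upd')
      then show "norm (f y) \<le> (1 + (omega V)\<^sup>2) ^ k * c" using Suc.prems by (intro Suc.IH) auto
    qed (use Suc.prems in simp)
    then show ?case by (simp add: mult.assoc)
  qed
  from this[of \<tau> x] x show ?thesis unfolding diff_self_eq_0 torus_chain_0[OF J I] by simp
qed

text \<open>The harmonic bound is used on the slice through \<open>x\<close>; the passage from its
  sphere to the sphere in the slice of \<open>I\<close> brings in the power of 1 +
  \<omega>^2.\<close>

lemma taylor_term_bound:
  assumes I: "I \<in> torus v \<tau> t" and r: "0 < r" "r < R"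
    and bd: "\<And>y. y \<in> sphere p r \<inter> slice v \<tau> t I \<Longrightarrow> norm (f y) \<le> c" and x: "x \<in> V"
  shows "norm (taylor_term v \<tau> t f p K x)
    \<le> sqrt (real (K + m choose m)) * (norm (x - p) / r) ^ K * ((1 + (omega V)\<^sup>2) ^ \<tau> * c)"
proof -
  obtain J where J: "J \<in> torus v \<tau> t" "x \<in> slice v \<tau> t J"
    using in_some_slice[OF x] .
  interpret clifford_frame "frame v t J" m by (rule frame_clifford[OF J(1)])
  have xp: "x - p \<in> S" "p \<in> S" using J(2) p_in(1)[of J] unfolding slice_def by (auto intro: span_diff)
  have "vharm_limit p R f"
    using monogenic_vharm_limit[OF xp(2) R] monogenic_frame[OF J(1)] by (simp add: slice_def)
  from vharm_limit_taylor_bound[OF xp(2) this r xp(1)] show ?thesis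
    unfolding taylor_term_slice[OF J]
    using sphere_bound[OF J(1) I r(2) bd] by (simp add: slice_def)
qed

lemma continuous_on_slice_ball:
  assumes I: "I \<in> torus v \<tau> t"
  shows "continuous_on (ball p R \<inter> slice v \<tau> t I) f"
proof -
  interpret clifford_frame "frame v t I" m by (rule frame_clifford[OF I])
  have mono: "monogenic (frame v t I) m (ball p R \<inter> S) f"
    using monogenic_subset[OF monogenic_frame[OF I]] by (simp add: slice_def)
  have "continuous_on (ball p R \<inter> S) f"
    by (rule C1_continuous[where f' = "\<lambda>i. pd i f"])
      (use mono in \<open>auto simp: monogenic_def C1_along_def has_dd_def partial_deriv_def vector_derivative_works\<close>)
  then show ?thesis by (simp add: slice_def)
qed

lemma slice_sphere:
  assumes I: "I \<in> torus v \<tau> t" and r: "0 < r" "r < R"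
  shows "y \<in> sphere p r \<inter> slice v \<tau> t I \<Longrightarrow> norm (f y) \<le> (SUP x\<in>sphere p r \<inter> slice v \<tau> t I. norm (f x))"
    "0 \<le> (SUP x\<in>sphere p r \<inter> slice v \<tau> t I. norm (f x))"
proof -
  have comp: "compact (sphere p r \<inter> slice v \<tau> t I)"
    unfolding slice_def by (intro compact_Int_closed compact_sphere closed_subspace subspace_span)
  have "continuous_on (sphere p r \<inter> slice v \<tau> t I) (\<lambda>x. norm (f x))"
    using r by (intro continuous_on_norm continuous_on_subset[OF continuous_on_slice_ball[OF I]]) auto
  then have "bdd_above ((\<lambda>x. norm (f x)) ` (sphere p r \<inter> slice v \<tau> t I))"
    using comp by (intro bounded_imp_bdd_above compact_imp_bounded compact_continuous_image)
  then show upper: "norm (f y) \<le> (SUP x\<in>sphere p r \<inter> slice v \<tau> t I. norm (f x))"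
    if "y \<in> sphere p r \<inter> slice v \<tau> t I" for y
    using that by (intro cSUP_upper)
  have "v 0 \<in> mirror v t" unfolding mirror_def by (intro span_base) auto
  then have "v 0 \<in> slice v \<tau> t I" using mirror_sub_slice by blast
  \<comment> \<open>A point of the sphere, so that the supremum is taken over a nonempty set and is
    nonnegative.\<close>
  then have "p + r *\<^sub>R v 0 \<in> sphere p r \<inter> slice v \<tau> t I"
    using p_in(1)[of I] v_orth[of 0 0] r unfolding slice_def
    by (auto simp: dist_norm norm_eq_1 intro: span_add span_scale)
  from order_trans[OF norm_ge_zero upper[OF this]]
  show "0 \<le> (SUP x\<in>sphere p r \<inter> slice v \<tau> t I. norm (f x))" .
qed

lemma continuous_taylor_term: "continuous_on A (taylor_term v \<tau> t f p K)"
  unfolding taylor_term_def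
  by (intro continuous_on_sum bounded_bilinear.continuous_on[OF bounded_bilinear_algebra]
      continuous_on_compose2[OF continuous_T_poly[of UNIV]] continuous_intros) auto

lemma taylor_normally_convergent: "normally_convergent_on (ball p R \<inter> V) (taylor_term v \<tau> t f p)"
  unfolding normally_convergent_on_def
proof (intro conjI allI impI continuous_taylor_term)
  fix C assume C: "compact C \<and> C \<noteq> {} \<and> C \<subseteq> ball p R \<inter> V"
  obtain I where I: "I \<in> torus v \<tau> t" using torus_nonempty by blast
  have "continuous_on C (dist p)" by (intro continuous_intros)
  then obtain x0 where x0: "x0 \<in> C" "\<forall>x\<in>C. dist p x \<le> dist p x0"
    using continuous_attains_sup[of C "dist p"] C by blast
  \<comment> \<open>The largest distance from \<open>p\<close> attained on \<open>C\<close>; the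
    estimate is then used on the sphere halfway from there to the boundary.\<close>
  define r1 where "r1 = dist p x0"
  define r2 where "r2 = (r1 + R) / 2"
  have r1: "0 \<le> r1" "r1 < R" using x0 C by (auto simp: r1_def)
  then have r2: "r1 < r2" "0 < r2" "r2 < R" by (auto simp: r2_def)
  define c where "c = (1 + (omega V)\<^sup>2) ^ \<tau> * (SUP x\<in>sphere p r2 \<inter> slice v \<tau> t I. norm (f x))"
  have c: "0 \<le> c"
    unfolding c_def using slice_sphere(2)[OF I r2(2,3)] by (intro mult_nonneg_nonneg) auto
  have bd: "norm (taylor_term v \<tau> t f p k x) \<le> sqrt (real (k + m choose m)) * (r1 / r2) ^ k * c"
    if x: "x \<in> C" for x k
  proof -
    have "norm (x - p) \<le> r1" using bspec[OF x0(2) x] by (simp add: r1_def dist_norm norm_minus_commute)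
    then have "(norm (x - p) / r2) ^ k \<le> (r1 / r2) ^ k"
      using r2 by (intro power_mono divide_right_mono) auto
    then have "sqrt (real (k + m choose m)) * (norm (x - p) / r2) ^ k * c
        \<le> sqrt (real (k + m choose m)) * (r1 / r2) ^ k * c"
      using c by (intro mult_right_mono mult_left_mono) auto
    moreover have "norm (taylor_term v \<tau> t f p k x) \<le> sqrt (real (k + m choose m)) * (norm (x - p) / r2) ^ k * c"
      unfolding c_def using x C by (intro taylor_term_bound[OF I r2(2,3) slice_sphere(1)[OF I r2(2,3)]]) auto
    ultimately show ?thesis by (rule order_trans[rotated])
  qed
  interpret clifford_frame "frame v t I" m by (rule frame_clifford[OF I])
  have "summable (\<lambda>k. sqrt (real (k + m choose m)) * (r1 / r2) ^ k * c)"
    using r1 r2 by (intro summable_sqrt_binomial_power) auto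
  then show "summable (\<lambda>k. SUP x\<in>C. norm (taylor_term v \<tau> t f p k x))"
  proof (rule summable_comparison_test'[where N = 0])
    fix k
    have "bdd_above ((\<lambda>x. norm (taylor_term v \<tau> t f p k x)) ` C)"
      using bd by (intro bdd_aboveI2)
    then have "norm (taylor_term v \<tau> t f p k x0) \<le> (SUP x\<in>C. norm (taylor_term v \<tau> t f p k x))"
      by (rule cSUP_upper[OF x0(1)])
    then have "0 \<le> (SUP x\<in>C. norm (taylor_term v \<tau> t f p k x))"
      by (rule order_trans[OF norm_ge_zero])
    moreover have "(SUP x\<in>C. norm (taylor_term v \<tau> t f p k x)) \<le> sqrt (real (k + m choose m)) * (r1 / r2) ^ k * c"
      using bd C by (intro cSUP_least) auto
    ultimately show "norm (SUP x\<in>C. norm (taylor_term v \<tau> t f p k x))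
        \<le> sqrt (real (k + m choose m)) * (r1 / r2) ^ k * c" by simp
  qed
qed

lemma taylor_estimate:
  assumes I: "I \<in> torus v \<tau> t" and r: "0 < r1" "r1 < r2" "r2 < R"
  shows "(SUP x\<in>cball p r1 \<inter> V. norm (taylor_term v \<tau> t f p k x))
    \<le> (1 + (omega V)\<^sup>2) ^ \<tau> * (omega V)\<^sup>2 * sqrt 2 * real ((k + m) choose m) * (r1 / r2) ^ k *
      (SUP x\<in>sphere p r2 \<inter> slice v \<tau> t I. norm (f x))"
proof (rule cSUP_least)
  have "p \<in> cball p r1 \<inter> V" using p_in(2) r by simp
  then show "cball p r1 \<inter> V \<noteq> {}" by blast
  fix x assume x: "x \<in> cball p r1 \<inter> V"
  let ?c = "SUP x\<in>sphere p r2 \<inter> slice v \<tau> t I. norm (f x)" and ?B = "real (k + m choose m)"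
  have r2: "0 < r2" "r2 < R" using r by auto
  have c: "0 \<le> ?c" using slice_sphere(2)[OF I r2] .
  \<comment> \<open>The bound at hand has only \<open>sqrt ?B\<close>; it lies below the stated
    constant because \<omega> and \<open>?B\<close> are at least 1.\<close>
  have "1 * 1 \<le> (omega V)\<^sup>2 * sqrt 2"
    using omega_ge_1 by (intro mult_mono) (auto simp: one_le_power)
  moreover have "1 \<le> ?B" by (simp add: Suc_le_eq)
  then have "sqrt ?B \<le> sqrt (?B\<^sup>2)" by (intro real_sqrt_le_mono self_le_power) auto
  then have "sqrt ?B \<le> ?B" by simp
  ultimately have B: "1 * sqrt ?B \<le> ((omega V)\<^sup>2 * sqrt 2) * ?B"
    by (intro mult_mono) auto
  have "norm (x - p) \<le> r1" using x by (simp add: dist_norm norm_minus_commute)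
  then have pw: "(norm (x - p) / r2) ^ k \<le> (r1 / r2) ^ k"
    using r2 by (intro power_mono divide_right_mono) auto
  have "norm (taylor_term v \<tau> t f p k x)
      \<le> sqrt ?B * (norm (x - p) / r2) ^ k * ((1 + (omega V)\<^sup>2) ^ \<tau> * ?c)"
    using x by (intro taylor_term_bound[OF I r2 slice_sphere(1)[OF I r2]]) auto
  also have "\<dots> \<le> ((omega V)\<^sup>2 * sqrt 2 * ?B) * (r1 / r2) ^ k * ((1 + (omega V)\<^sup>2) ^ \<tau> * ?c)"
    using B pw c r2 by (intro mult_right_mono[of _ _ "_ * ?c"] mult_mono[of "sqrt ?B"]) auto
  finally show "norm (taylor_term v \<tau> t f p k x)
      \<le> (1 + (omega V)\<^sup>2) ^ \<tau> * (omega V)\<^sup>2 * sqrt 2 * ?B * (r1 / r2) ^ k * ?c"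
    by (simp add: mult_ac)
qed

end

theorem theorem7p2:
  fixes star :: "'a::{real_algebra_1, euclidean_space} \<Rightarrow> 'a"
    and V \<Omega> :: "'a set" and v :: "nat \<Rightarrow> 'a" and n d \<tau> :: nat and t :: "nat \<Rightarrow> nat"
    and f :: "'a \<Rightarrow> 'a" and p :: 'a and R :: real
  assumes "star_involution star"
    and "imag_units star \<noteq> {}"
    and "hypercomplex_subspace star V"
    and "hypercomplex_basis star V n v"
    and "completed_orthonormal n d v"
    and "step_list n \<tau> t"
    and "domain_in V \<Omega>"
    and "T_regular v \<tau> t \<Omega> f"
    and "p \<in> mirror v t"
    and "R > 0"
    and "ball p R \<inter> V \<subseteq> \<Omega>"
  shows "(\<forall>x\<in>ball p R \<inter> V. (\<lambda>k. taylor_term v \<tau> t f p k x) sums f x) \<and>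
    normally_convergent_on (ball p R \<inter> V) (taylor_term v \<tau> t f p) \<and>
    (\<forall>k r1 r2. \<forall>I\<in>torus v \<tau> t. 0 < r1 \<and> r1 < r2 \<and> r2 < R \<longrightarrow>
       (SUP x\<in>cball p r1 \<inter> V. norm (taylor_term v \<tau> t f p k x))
       \<le> (1 + (omega V)\<^sup>2) ^ \<tau> * (omega V)\<^sup>2 * sqrt 2 *
          real ((k + (t 0 + \<tau>)) choose (t 0 + \<tau>)) * (r1 / r2) ^ k *
          (SUP x\<in>sphere p r2 \<inter> slice v \<tau> t I. norm (f x)))"
proof -
  interpret T_regular_ball star V v n d \<tau> t \<Omega> f p R
    using assms by unfold_locales auto
  show ?thesis
    using taylor_sums taylor_normally_convergent taylor_estimate by blast
qed

end
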